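(* Let $\psi$ be a $C^1$ wavelet ($\{\psi_I:I\in\mathcal{D}\}$ an orthonormal basis of $L^2(\mathbb{R})$) with $|\psi(x)|+|\psi'(x)|\leq C(1+|x|)^{-1-\varepsilon}$ for all $x$ and some $C,\varepsilon>0$, and let $\{a_I:I\in\mathcal{D}\}$ be independent random variables with $\sum_I\mathscr{E}|a_I|<\infty$ and $a_I\in\mathscr{G}(\nu)$ for all $I$, for some $\nu>0$. Let $Tf(x,\omega)=\sum_{I\in\mathcal{D}}a_I(\omega)\langle f,\psi_I\rangle\psi_I(x)$ for $f\in L^2(\mathbb{R})$. Then for each $1<p<\infty$ there is $C_p$ with $$\Big(\int_{\mathbb{R}}\|Tf(x,\cdot)\|^p_{L^2(\Omega,d\mathscr{P})}\,dx\Big)^{1/p}\leq C_p\|f\|_{L^p(\mathbb{R})}\quad\text{for all } f\in L^2(\mathbb{R})\cap L^p(\mathbb{R}),$$ so $T$ extends to a bounded operator from $L^p(\mathbb{R},dx)$ to $L^p(L^2(\Omega,d\mathscr{P});dx)$; moreover there is $C$ such that for all $t>0$ and $f\in L^1(\mathbb{R})\cap L^2(\mathbb{R})$, $$\big|\{x\in\mathbb{R}:\|Tf(x,\cdot)\|_{L^2(\Omega,d\mathscr{P})}>t\}\big|\leq\frac{C}{t}\|f\|_{L^1(\mathbb{R})}.$$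
   Context: $\mathcal{D}=\bigcup_{j\in\mathbb{Z}}\{[k2^{-j},(k+1)2^{-j}):k\in\mathbb{Z}\}$ is the family of dyadic intervals of $\mathbb{R}$; for $I=[k2^{-j},(k+1)2^{-j})$, $\psi_I(x)=2^{j/2}\psi(2^jx-k)$. $|E|$ denotes Lebesgue measure. For an integrable random variable $X$, $\eta_{X-\mathscr{E}X}(\lambda)=\log \mathscr{E}e^{\lambda(X-\mathscr{E}X)}$, and $X\in\mathscr{G}(\nu)$ means $X$ is integrable and $\eta_{X-\mathscr{E}X}(\lambda)\leq \lambda^2\nu/2$ for all $\lambda\in\mathbb{R}$. *)

theory Defs
  imports "HOL-Probability.Probability"
begin

text \<open>Dyadic interval I = [k 2^-j, (k+1) 2^-j) is indexed by the pair (j,k);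
  psi_I(x) = 2^(j/2) psi(2^j x - k).\<close>
definition dyadic_fn :: "(real \<Rightarrow> real) \<Rightarrow> int \<times> int \<Rightarrow> real \<Rightarrow> real" where
  "dyadic_fn \<psi> I x = (case I of (j, k) \<Rightarrow>
      2 powr (real_of_int j / 2) * \<psi> (2 powr (real_of_int j) * x - real_of_int k))"

definition wavelet_coeff :: "(real \<Rightarrow> real) \<Rightarrow> (real \<Rightarrow> real) \<Rightarrow> int \<times> int \<Rightarrow> real" where
  "wavelet_coeff \<psi> f I = (\<integral>x. f x * dyadic_fn \<psi> I x \<partial>lborel)"

definition wavelet_onb :: "(real \<Rightarrow> real) \<Rightarrow> bool" where
  "wavelet_onb \<psi> \<longleftrightarrow>
     (\<forall>I. dyadic_fn \<psi> I \<in> borel_measurable lborel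
          \<and> integrable lborel (\<lambda>x. (dyadic_fn \<psi> I x)\<^sup>2)) \<and>
     (\<forall>I J. (\<integral>x. dyadic_fn \<psi> I x * dyadic_fn \<psi> J x \<partial>lborel) = (if I = J then 1 else 0)) \<and>
     (\<forall>f. f \<in> borel_measurable lborel \<longrightarrow> integrable lborel (\<lambda>x. (f x)\<^sup>2) \<longrightarrow>
          (\<forall>I. wavelet_coeff \<psi> f I = 0) \<longrightarrow> (AE x in lborel. f x = 0))"

definition subgaussian :: "'a measure \<Rightarrow> ('a \<Rightarrow> real) \<Rightarrow> real \<Rightarrow> bool" where
  "subgaussian M X \<nu> \<longleftrightarrow> integrable M X \<and>
     (\<forall>l::real. integrable M (\<lambda>\<omega>. exp (l * (X \<omega> - integral\<^sup>L M X))) \<and>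
        ln (\<integral>\<omega>. exp (l * (X \<omega> - integral\<^sup>L M X)) \<partial>M) \<le> l\<^sup>2 * \<nu> / 2)"

definition wavelet_T :: "(int \<times> int \<Rightarrow> 'a \<Rightarrow> real) \<Rightarrow> (real \<Rightarrow> real) \<Rightarrow> (real \<Rightarrow> real)
     \<Rightarrow> real \<Rightarrow> 'a \<Rightarrow> real" where
  "wavelet_T a \<psi> f x \<omega> = infsum (\<lambda>I. a I \<omega> * wavelet_coeff \<psi> f I * dyadic_fn \<psi> I x) UNIV"

definition L2sq :: "'a measure \<Rightarrow> ('a \<Rightarrow> real) \<Rightarrow> ennreal" where
  "L2sq M g = (\<integral>\<^sup>+\<omega>. ennreal ((g \<omega>)\<^sup>2) \<partial>M)"

end

theory Submission
  imports Defs
begin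

text \<open>Since the \<open>a\<^sub>I\<close> are independent with bounded variances and summable means, \<open>\<parallel>T f x\<parallel>\<close> in
  \<open>L\<^sup>2\<close> of the probability space is at most a constant times the square function
  \<open>S f x = sqrt (\<Sum>\<^sub>I \<langle>f, \<psi>\<^sub>I\<rangle>\<^sup>2 \<psi>\<^sub>I(x)\<^sup>2)\<close>; the means contribute by Cauchy--Schwarz, and the passage from finite
  partial sums is Fatou's lemma. By Khinchine's inequality, in the Paley--Zygmund form that also
  transfers weak-type bounds, \<open>S\<close> is controlled by the operators
  \<open>f \<mapsto> \<Sum>\<^sub>I \<plusminus> \<langle>f, \<psi>\<^sub>I\<rangle> \<psi>\<^sub>I\<close> over finite sets of \<open>I\<close>. These are self-adjoint contractions of \<open>L\<^sup>2\<close> whose kernels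
  satisfy Hoermander's condition uniformly in the signs and the finite set. The Calderon--Zygmund
  decomposition gives the weak (1,1) bound, interpolation gives \<open>1 < p < 2\<close>, duality gives \<open>p > 2\<close>.
  The decomposition stops after finitely many bisections: the part of \<open>f\<close> below the finest scale is
  absorbed by the smoothness of the finitely many \<open>\<psi>\<^sub>I\<close>, so no differentiation theorem is needed.\<close>

subsection \<open>Rademacher sums\<close>

text \<open>Every constant is fixed before the finite set, the signs and \<open>f\<close> are
  chosen; only this uniformity permits averaging over signs and letting finite sets exhaust the
  dyadic intervals. Hoermander's condition is therefore proved term by term: each wavelet
  contributes its oscillation over the interval of the atom times its mass outside the tripled
  interval, and already the sum of these products is bounded, so the signs vanish under absolute
  values. The decay exponent is written as 1 + 2 e. Of it, 1 + e pays for the sum over translations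
  and for integrability, and the remaining e gives geometric decay over the scales that are fine
  compared with the atom; the derivative handles the coarse scales. Additivity of the operators is
  available on \<open>L2fun\<close> only, so every piece of every decomposition is shown to lie
  there. Measurability in x of the random norm is never established: its integrals and superlevel
  sets are bounded through measurable majorants.\<close>

definition sgn_set :: "'i set \<Rightarrow> 'i \<Rightarrow> real" where
  "sgn_set A i = (if i \<in> A then 1 else -1)"

lemma sum_Pow_insert:
  fixes h :: "'i set \<Rightarrow> real"
  assumes "finite F" "x \<notin> F"
  shows "(\<Sum>A\<in>Pow (insert x F). h A) = (\<Sum>A\<in>Pow F. h A + h (insert x A))"
proof -
  have inj: "inj_on (insert x) (Pow F)"
    using assms(2) by (auto simp: inj_on_def)
  have "(\<Sum>A\<in>Pow (insert x F). h A) = (\<Sum>A\<in>Pow F. h A) + (\<Sum>A\<in>insert x ` Pow F. h A)"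
    unfolding Pow_insert using assms by (intro sum.union_disjoint) auto
  also have "(\<Sum>A\<in>insert x ` Pow F. h A) = (\<Sum>A\<in>Pow F. h (insert x A))"
    using inj by (simp add: sum.reindex)
  finally show ?thesis by (simp add: sum.distrib)
qed

lemma rademacher_step:
  fixes v :: "'i \<Rightarrow> real"
  assumes "finite F" "x \<notin> F" "A \<subseteq> F"
  shows "(\<Sum>i\<in>insert x F. sgn_set A i * v i) = (\<Sum>i\<in>F. sgn_set A i * v i) - v x"
    and "(\<Sum>i\<in>insert x F. sgn_set (insert x A) i * v i) = (\<Sum>i\<in>F. sgn_set A i * v i) + v x"
proof -
  have "(\<Sum>i\<in>F. sgn_set (insert x A) i * v i) = (\<Sum>i\<in>F. sgn_set A i * v i)"
    using assms by (intro sum.cong) (auto simp: sgn_set_def)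
  then show "(\<Sum>i\<in>insert x F. sgn_set (insert x A) i * v i) = (\<Sum>i\<in>F. sgn_set A i * v i) + v x"
    using assms by (simp add: sgn_set_def)
  show "(\<Sum>i\<in>insert x F. sgn_set A i * v i) = (\<Sum>i\<in>F. sgn_set A i * v i) - v x"
    using assms by (auto simp: sgn_set_def)
qed

text \<open>Pairing \<open>A\<close> with \<open>insert x A\<close> flips only the sign of the term
  at \<open>x\<close>, so the cross terms of the two squares cancel.\<close>

lemma rademacher_second_moment:
  fixes v :: "'i \<Rightarrow> real"
  assumes "finite F"
  shows "(\<Sum>A\<in>Pow F. (\<Sum>i\<in>F. sgn_set A i * v i)\<^sup>2) = 2 ^ card F * (\<Sum>i\<in>F. (v i)\<^sup>2)"
  using assms
proof (induction F rule: finite_induct)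
  case (insert x F)
  have "(\<Sum>A\<in>Pow (insert x F). (\<Sum>i\<in>insert x F. sgn_set A i * v i)\<^sup>2)
     = (\<Sum>A\<in>Pow F. 2 * (\<Sum>i\<in>F. sgn_set A i * v i)\<^sup>2 + 2 * (v x)\<^sup>2)"
    unfolding sum_Pow_insert[OF insert.hyps]
  proof (intro sum.cong refl)
    fix A assume "A \<in> Pow F"
    then have A: "A \<subseteq> F" by simp
    show "(\<Sum>i\<in>insert x F. sgn_set A i * v i)\<^sup>2 + (\<Sum>i\<in>insert x F. sgn_set (insert x A) i * v i)\<^sup>2 = 2 * (\<Sum>i\<in>F. sgn_set A i * v i)\<^sup>2 + 2 * (v x)\<^sup>2"
      unfolding rademacher_step[OF insert.hyps A] by (simp add: power2_eq_square power4_eq_xxxx algebra_simps)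
  qed
  then show ?case
    using insert by (simp add: sum.distrib sum_distrib_left[symmetric] card_Pow algebra_simps)
qed simp

text \<open>In the same pairing all odd powers cancel, and the mixed term is summed by the second
  moment. The factor 3 is the fourth moment of a standard Gaussian.\<close>

lemma rademacher_fourth_moment:
  fixes v :: "'i \<Rightarrow> real"
  assumes "finite F"
  shows "(\<Sum>A\<in>Pow F. (\<Sum>i\<in>F. sgn_set A i * v i) ^ 4) \<le> 3 * 2 ^ card F * (\<Sum>i\<in>F. (v i)\<^sup>2)\<^sup>2"
  using assms
proof (induction F rule: finite_induct)
  case (insert x F)
  have "(\<Sum>A\<in>Pow (insert x F). (\<Sum>i\<in>insert x F. sgn_set A i * v i) ^ 4)
     = (\<Sum>A\<in>Pow F. 2 * (\<Sum>i\<in>F. sgn_set A i * v i) ^ 4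
          + 12 * (v x)\<^sup>2 * (\<Sum>i\<in>F. sgn_set A i * v i)\<^sup>2 + 2 * (v x) ^ 4)"
    unfolding sum_Pow_insert[OF insert.hyps]
  proof (intro sum.cong refl)
    fix A assume "A \<in> Pow F"
    then have A: "A \<subseteq> F" by simp
    show "(\<Sum>i\<in>insert x F. sgn_set A i * v i) ^ 4 + (\<Sum>i\<in>insert x F. sgn_set (insert x A) i * v i) ^ 4
        = 2 * (\<Sum>i\<in>F. sgn_set A i * v i) ^ 4 + 12 * (v x)\<^sup>2 * (\<Sum>i\<in>F. sgn_set A i * v i)\<^sup>2 + 2 * (v x) ^ 4"
      unfolding rademacher_step[OF insert.hyps A] by (simp add: power2_eq_square power4_eq_xxxx algebra_simps)
  qed
  also have "\<dots> = 2 * (\<Sum>A\<in>Pow F. (\<Sum>i\<in>F. sgn_set A i * v i) ^ 4)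
       + 12 * (v x)\<^sup>2 * (2 ^ card F * (\<Sum>i\<in>F. (v i)\<^sup>2)) + 2 ^ card F * (2 * (v x) ^ 4)"
    using insert.hyps
    by (simp add: sum.distrib sum_distrib_left[symmetric] rademacher_second_moment card_Pow)
  \<comment> \<open>The coefficient 2 of the last fourth power is raised to 6 to complete the
    square.\<close>
  also have "\<dots> \<le> 2 * (3 * 2 ^ card F * (\<Sum>i\<in>F. (v i)\<^sup>2)\<^sup>2)
       + 12 * (v x)\<^sup>2 * (2 ^ card F * (\<Sum>i\<in>F. (v i)\<^sup>2)) + 2 ^ card F * (6 * (v x) ^ 4)"
    using insert.IH by (intro add_mono mult_left_mono) auto
  also have "\<dots> = 3 * 2 ^ card (insert x F) * (\<Sum>i\<in>insert x F. (v i)\<^sup>2)\<^sup>2"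
    using insert.hyps by (simp add: power2_eq_square power4_eq_xxxx algebra_simps)
  finally show ?case .
qed simp

text \<open>A lower bound on the number of signs, rather than on a moment, is what transfers weak-type
  as well as strong-type bounds to the square function.\<close>

lemma rademacher_paley_zygmund:
  fixes v :: "'i \<Rightarrow> real"
  assumes "finite F"
  shows "3 / 16 * 2 ^ card F
    \<le> real (card {A \<in> Pow F. (\<Sum>i\<in>F. (v i)\<^sup>2) \<le> 4 * (\<Sum>i\<in>F. sgn_set A i * v i)\<^sup>2})"
proof -
  define S where "S = (\<Sum>i\<in>F. (v i)\<^sup>2)"
  define X where "X A = (\<Sum>i\<in>F. sgn_set A i * v i)" for A
  define G where "G = {A \<in> Pow F. S \<le> 4 * (X A)\<^sup>2}"
  have fin: "finite (Pow F)" "finite G" using assms by (auto simp: G_def)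
  have "S \<ge> 0" by (auto simp: S_def intro: sum_nonneg)
  show ?thesis
  proof (cases "S = 0")
    case True
    then have "G = Pow F" by (auto simp: G_def)
    then show ?thesis using assms
      unfolding S_def[symmetric] X_def[symmetric] G_def[symmetric] by (simp add: card_Pow)
  next
    case False
    with \<open>S \<ge> 0\<close> have S: "S > 0" by simp
    have "2 ^ card F * S = (\<Sum>A\<in>Pow F. (X A)\<^sup>2)"
      using rademacher_second_moment[OF assms, of v] by (simp add: S_def X_def)
    \<comment> \<open>A sign pattern outside \<open>G\<close> contributes less than S / 4, so
      \<open>G\<close> carries at least three quarters of the second moment. Cauchy--Schwarz against
      the fourth moment then yields the proportion (3/4)^2 / 3 = 3/16.\<close>
    also have "\<dots> \<le> (\<Sum>A\<in>Pow F. S / 4 + indicator G A * (X A)\<^sup>2)"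
      using S by (intro sum_mono) (auto simp: G_def indicator_def)
    also have "\<dots> = 2 ^ card F * S / 4 + (\<Sum>A\<in>Pow F. indicator G A * (X A)\<^sup>2)"
      using assms by (simp add: sum.distrib card_Pow)
    finally have 1: "3 / 4 * (2 ^ card F * S) \<le> (\<Sum>A\<in>Pow F. indicator G A * (X A)\<^sup>2)" by simp
    have "(\<Sum>A\<in>Pow F. indicator G A * (X A)\<^sup>2)\<^sup>2
        \<le> (\<Sum>A\<in>Pow F. (indicator G A)\<^sup>2) * (\<Sum>A\<in>Pow F. ((X A)\<^sup>2)\<^sup>2)"
      by (rule Cauchy_Schwarz_ineq_sum)
    also have "(\<Sum>A\<in>Pow F. (indicator G A :: real)\<^sup>2) = (\<Sum>A\<in>Pow F. indicator G A)"
      by (intro sum.cong) (auto simp: indicator_def)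
    also have "\<dots> = real (card G)"
      using fin by (simp add: indicator_def sum.If_cases G_def Collect_conj_eq[symmetric] Int_def)
    also have "(\<Sum>A\<in>Pow F. ((X A)\<^sup>2)\<^sup>2) \<le> 3 * 2 ^ card F * S\<^sup>2"
      using rademacher_fourth_moment[OF assms, of v] by (simp add: S_def X_def power2_eq_square power4_eq_xxxx mult.assoc)
    finally have 2: "(\<Sum>A\<in>Pow F. indicator G A * (X A)\<^sup>2)\<^sup>2 \<le> real (card G) * (3 * 2 ^ card F * S\<^sup>2)"
      by (simp add: mult_left_mono)
    have "(3 / 4 * (2 ^ card F * S))\<^sup>2 \<le> (\<Sum>A\<in>Pow F. indicator G A * (X A)\<^sup>2)\<^sup>2"
      using 1 S by (intro power_mono) auto
    with 2 have "(3 / 4 * (2 ^ card F * S))\<^sup>2 \<le> real (card G) * (3 * 2 ^ card F * S\<^sup>2)" by linarith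
    then have "3 * 2 ^ card F * S\<^sup>2 * (3 / 16 * 2 ^ card F) \<le> 3 * 2 ^ card F * S\<^sup>2 * real (card G)"
      by (simp add: power2_eq_square algebra_simps)
    then have "3 / 16 * 2 ^ card F \<le> real (card G)"
      using S by (subst (asm) mult_le_cancel_left_pos) auto
    then show ?thesis by (simp add: G_def S_def X_def)
  qed
qed

text \<open>At least 3/16 of the sign patterns satisfy sqrt S \<le> 2 |X|; keeping only these in the
  average gives the constant 16/3 times \<open>2 powr p\<close>, for every positive
  exponent.\<close>

lemma rademacher_khinchine:
  fixes v :: "'i \<Rightarrow> real"
  assumes "finite F" "p > 0"
  shows "2 ^ card F * (sqrt (\<Sum>i\<in>F. (v i)\<^sup>2)) powr p
    \<le> 16 / 3 * 2 powr p * (\<Sum>A\<in>Pow F. \<bar>\<Sum>i\<in>F. sgn_set A i * v i\<bar> powr p)"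
proof -
  define S where "S = (\<Sum>i\<in>F. (v i)\<^sup>2)"
  define X where "X A = (\<Sum>i\<in>F. sgn_set A i * v i)" for A
  define G where "G = {A \<in> Pow F. S \<le> 4 * (X A)\<^sup>2}"
  have fin: "finite (Pow F)" "finite G" "G \<subseteq> Pow F" using assms by (auto simp: G_def)
  have S: "S \<ge> 0" by (auto simp: S_def intro: sum_nonneg)
  have "3 / 16 * 2 ^ card F * (sqrt S) powr p \<le> real (card G) * (sqrt S) powr p"
    using rademacher_paley_zygmund[OF assms(1), of v]
    by (intro mult_right_mono) (auto simp: S_def G_def X_def)
  also have "\<dots> = (\<Sum>A\<in>G. (sqrt S) powr p)" by simp
  also have "\<dots> \<le> (\<Sum>A\<in>G. 2 powr p * \<bar>X A\<bar> powr p)"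
  proof (intro sum_mono)
    fix A assume "A \<in> G"
    then have "sqrt S \<le> sqrt ((2 * X A)\<^sup>2)" by (intro real_sqrt_le_mono) (auto simp: G_def power2_eq_square)
    then have "sqrt S \<le> 2 * \<bar>X A\<bar>" unfolding real_sqrt_abs by (simp add: abs_mult)
    then have "(sqrt S) powr p \<le> (2 * \<bar>X A\<bar>) powr p" using assms S by (intro powr_mono2) auto
    then show "(sqrt S) powr p \<le> 2 powr p * \<bar>X A\<bar> powr p" by (simp add: powr_mult)
  qed
  also have "\<dots> \<le> (\<Sum>A\<in>Pow F. 2 powr p * \<bar>X A\<bar> powr p)"
    using fin by (intro sum_mono2) auto
  finally show ?thesis by (simp add: S_def X_def sum_distrib_left[symmetric])
qed

subsection \<open>Square-integrable functions\<close>

definition L2fun :: "(real \<Rightarrow> real) \<Rightarrow> bool" where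
  "L2fun f \<longleftrightarrow> f \<in> borel_measurable borel \<and> integrable lborel (\<lambda>x. (f x)\<^sup>2)"

lemma L2fun_measurable [measurable_dest]: "L2fun f \<Longrightarrow> f \<in> borel_measurable borel"
  by (simp add: L2fun_def)

lemma L2fun_bound:
  assumes "L2fun f" "g \<in> borel_measurable borel" "\<And>x. \<bar>g x\<bar> \<le> \<bar>f x\<bar>"
  shows "L2fun g"
  unfolding L2fun_def
proof
  show "integrable lborel (\<lambda>x. (g x)\<^sup>2)"
    by (rule Bochner_Integration.integrable_bound[of _ "\<lambda>x. (f x)\<^sup>2"])
       (use assms in \<open>auto simp: L2fun_def abs_le_square_iff\<close>)
qed fact

lemma L2fun_mult_integrable:
  assumes "L2fun f" "L2fun g"
  shows "integrable lborel (\<lambda>x. f x * g x)"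
proof (rule Bochner_Integration.integrable_bound)
  show "integrable lborel (\<lambda>x. (f x)\<^sup>2 + (g x)\<^sup>2)" using assms by (auto simp: L2fun_def)
  show "(\<lambda>x. f x * g x) \<in> borel_measurable lborel" using assms by (auto simp: L2fun_def)
  have "\<bar>f x * g x\<bar> \<le> (f x)\<^sup>2 + (g x)\<^sup>2" for x
  proof -
    have "2 * \<bar>f x\<bar> * \<bar>g x\<bar> \<le> (f x)\<^sup>2 + (g x)\<^sup>2"
      using sum_squares_bound[of "\<bar>f x\<bar>" "\<bar>g x\<bar>"] by simp
    moreover have "0 \<le> \<bar>f x\<bar> * \<bar>g x\<bar>" by simp
    ultimately show ?thesis unfolding abs_mult by linarith
  qed
  then show "AE x in lborel. norm (f x * g x) \<le> norm ((f x)\<^sup>2 + (g x)\<^sup>2)" by auto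
qed

lemma L2fun_add:
  assumes "L2fun f" "L2fun g"
  shows "L2fun (\<lambda>x. f x + g x)"
  unfolding L2fun_def
proof
  show "(\<lambda>x. f x + g x) \<in> borel_measurable borel" using assms by (auto simp: L2fun_def)
  have "integrable lborel (\<lambda>x. (f x)\<^sup>2 + (g x)\<^sup>2 + 2 * (f x * g x))"
    using assms L2fun_mult_integrable[OF assms] by (auto simp: L2fun_def)
  then show "integrable lborel (\<lambda>x. (f x + g x)\<^sup>2)"
    by (simp add: power2_sum mult.assoc)
qed

lemma L2fun_cmult: "L2fun f \<Longrightarrow> L2fun (\<lambda>x. c * f x)"
  by (auto simp: L2fun_def power_mult_distrib)

lemma L2fun_zero [simp]: "L2fun (\<lambda>_. 0)"
  by (simp add: L2fun_def)

lemma L2fun_diff: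
  assumes "L2fun f" "L2fun g"
  shows "L2fun (\<lambda>x. f x - g x)"
  using L2fun_add[OF assms(1) L2fun_cmult[OF assms(2), of "-1"]] by simp

lemma L2fun_indicator:
  assumes "L2fun f" "E \<in> sets borel"
  shows "L2fun (\<lambda>x. f x * indicator E x)"
  by (rule L2fun_bound[OF assms(1)]) (use assms in \<open>auto simp: indicator_def L2fun_def\<close>)

lemma integrable_lborel_interval: "integrable lborel (indicator {a..<b} :: real \<Rightarrow> real)"
  by (cases "a \<le> b") (auto intro!: integrable_real_indicator)

lemma L2fun_interval: "L2fun (indicator {a..<b})"
proof -
  have "(\<lambda>x. (indicator {a..<b} x :: real)\<^sup>2) = indicator {a..<b}"
    by (auto simp: indicator_def)
  then show ?thesis by (simp add: L2fun_def integrable_lborel_interval)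
qed

lemma lborel_markov:
  assumes "u \<in> borel_measurable borel" "c > 0" "(\<integral>\<^sup>+x. ennreal \<bar>u x\<bar> \<partial>lborel) \<le> ennreal B"
  shows "emeasure lborel {x. c \<le> \<bar>u x\<bar>} \<le> ennreal (B / c)"
proof -
  have "{x. c \<le> \<bar>u x\<bar>} = {x \<in> space lborel. 1 \<le> ennreal (1 / c) * ennreal \<bar>u x\<bar>}"
    using assms(2) by (auto simp: ennreal_mult[symmetric] field_simps simp flip: ennreal_1)
  then have "emeasure lborel {x. c \<le> \<bar>u x\<bar>} \<le> ennreal (1 / c) * (\<integral>\<^sup>+x. ennreal \<bar>u x\<bar> * indicator (space lborel) x \<partial>lborel)"
    using nn_integral_Markov_inequality[of "\<lambda>x. ennreal \<bar>u x\<bar>" "space lborel" lborel "ennreal (1/c)"] assms(1)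
    by simp
  also have "\<dots> \<le> ennreal (1 / c) * ennreal B"
    using assms(3) by (intro mult_left_mono) auto
  also have "\<dots> = ennreal (B / c)"
    using assms(2) by (simp add: ennreal_mult'[symmetric])
  finally show ?thesis .
qed

subsection \<open>Calderon--Zygmund decomposition\<close>

text \<open>In contrast to Hardy-space atoms there is no size normalisation: the L1 norm of
  \<open>b\<close> stays as a factor in every estimate.\<close>

definition atom :: "real \<Rightarrow> real \<Rightarrow> (real \<Rightarrow> real) \<Rightarrow> bool" where
  "atom u v b \<longleftrightarrow> u < v \<and> L2fun b \<and> integrable lborel b \<and> (\<forall>x. x \<notin> {u..<v} \<longrightarrow> b x = 0)
     \<and> (\<integral>x. b x \<partial>lborel) = 0"

text \<open>The mean times the length costs at most one more copy of the mass, hence the factor 2.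
  This serves both the stopped intervals and the intervals of the finest scale.\<close>

lemma atom_mean_deviation:
  fixes f :: "real \<Rightarrow> real"
  assumes "L2fun f" "integrable lborel f" "a < b"
  defines "N \<equiv> (\<integral>x. \<bar>f x\<bar> * indicator {a..<b} x \<partial>lborel)"
  defines "m \<equiv> (\<integral>x. f x * indicator {a..<b} x \<partial>lborel) / (b - a)"
  defines "w \<equiv> (\<lambda>x. (f x - m) * indicator {a..<b} x)"
  shows "atom a b w" "(\<integral>x. \<bar>w x\<bar> \<partial>lborel) \<le> 2 * N" "\<bar>m\<bar> * (b - a) \<le> N"
proof -
  have w_eq: "w x = f x * indicator {a..<b} x - m * indicator {a..<b} x" for x
    by (simp add: w_def algebra_simps)
  have int: "integrable lborel (\<lambda>x. f x * indicator {a..<b} x)"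
    "integrable lborel (\<lambda>x. \<bar>f x\<bar> * indicator {a..<b} x)"
    using integrable_mult_indicator[of "{a..<b}" lborel f]
      integrable_mult_indicator[of "{a..<b}" lborel "\<lambda>x. \<bar>f x\<bar>"] assms(2)
    by (auto simp: mult.commute)
  have int2: "integrable lborel (\<lambda>x. m * indicator {a..<b} x)"
    by (intro integrable_mult_right integrable_lborel_interval)
  have mi: "(\<integral>x. c * indicator {a..<b} x \<partial>lborel) = c * (b - a)" for c :: real
    using assms(3) by simp
  show m: "\<bar>m\<bar> * (b - a) \<le> N"
  proof -
    have "\<bar>m\<bar> * (b - a) = \<bar>\<integral>x. f x * indicator {a..<b} x \<partial>lborel\<bar>"
      using assms(3) by (simp add: m_def)
    also have "\<dots> \<le> (\<integral>x. \<bar>f x * indicator {a..<b} x\<bar> \<partial>lborel)" by (rule integral_abs_bound)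
    also have "\<dots> = N" by (simp add: N_def abs_mult)
    finally show ?thesis .
  qed
  have wi: "integrable lborel w" unfolding w_eq using int int2 by (intro Bochner_Integration.integrable_diff)
  have "L2fun w"
    unfolding w_eq
    using assms(1) by (intro L2fun_diff L2fun_indicator L2fun_cmult L2fun_interval) auto
  moreover have "(\<integral>x. w x \<partial>lborel) = 0"
    unfolding w_eq using assms(3) int int2
    by (subst Bochner_Integration.integral_diff) (auto simp: m_def)
  ultimately show "atom a b w"
    using wi assms(3) by (auto simp: atom_def w_def)
  have "(\<integral>x. \<bar>w x\<bar> \<partial>lborel) \<le> (\<integral>x. \<bar>f x\<bar> * indicator {a..<b} x + \<bar>m\<bar> * indicator {a..<b} x \<partial>lborel)"
    by (intro integral_mono Bochner_Integration.integrable_add integrable_abs wi int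
      integrable_mult_right integrable_lborel_interval) (auto simp: w_def indicator_def)
  also have "\<dots> = N + \<bar>m\<bar> * (b - a)"
    using int integrable_lborel_interval assms(3) by (subst Bochner_Integration.integral_add) (auto simp: N_def)
  finally show "(\<integral>x. \<bar>w x\<bar> \<partial>lborel) \<le> 2 * N" using m by simp
qed

text \<open>Only \<open>A\<close> enters the weak-type constant. The bound \<open>K\<close> depends on the number of terms of the
  operator and merely serves to absorb a tail and the finest scale of the stopping-time argument.\<close>

locale cz_operator =
  fixes T :: "(real \<Rightarrow> real) \<Rightarrow> real \<Rightarrow> real" and A K :: real
  assumes A_nonneg: "A \<ge> 0" and K_nonneg: "K \<ge> 0"
    and T_add: "L2fun f \<Longrightarrow> L2fun g \<Longrightarrow> T (\<lambda>x. f x + g x) y = T f y + T g y"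
    and T_meas: "L2fun f \<Longrightarrow> T f \<in> borel_measurable borel"
    and T_L2: "L2fun f \<Longrightarrow> (\<integral>\<^sup>+x. ennreal ((T f x)\<^sup>2) \<partial>lborel) \<le> ennreal (\<integral>x. (f x)\<^sup>2 \<partial>lborel)"
    and T_sup: "L2fun f \<Longrightarrow> integrable lborel f \<Longrightarrow> \<bar>T f x\<bar> \<le> K * (\<integral>y. \<bar>f y\<bar> \<partial>lborel)"
    and T_small: "atom u v b \<Longrightarrow> \<bar>T b x\<bar> \<le> K * (v - u) * (\<integral>y. \<bar>b y\<bar> \<partial>lborel)"
    and T_atom: "atom u v b \<Longrightarrow>
      (\<integral>\<^sup>+x. ennreal \<bar>T b x\<bar> * indicator (- {2 * u - v..2 * v - u}) x \<partial>lborel)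
        \<le> ennreal (A * (\<integral>y. \<bar>b y\<bar> \<partial>lborel))"
begin

lemma T_zero: "T (\<lambda>_. 0) y = 0"
  using T_add[of "\<lambda>_. 0" "\<lambda>_. 0" y] by simp

definition mass :: "(real \<Rightarrow> real) \<Rightarrow> real \<Rightarrow> real \<Rightarrow> real" where
  "mass f a b = (\<integral>x. \<bar>f x\<bar> * indicator {a..<b} x \<partial>lborel)"

lemma mass_nonneg: "mass f a b \<ge> 0"
  by (auto simp: mass_def intro!: integral_nonneg_AE)

lemma mass_integrable:
  fixes f :: "real \<Rightarrow> real"
  shows "integrable lborel f \<Longrightarrow> integrable lborel (\<lambda>x. \<bar>f x\<bar> * indicator {a..<b} x)"
  using integrable_mult_indicator[of "{a..<b}" lborel "\<lambda>x. \<bar>f x\<bar>"] by (simp add: mult.commute)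

lemma mass_split:
  assumes "integrable lborel f" "a \<le> c" "c \<le> b"
  shows "mass f a c + mass f c b = mass f a b"
  unfolding mass_def
  by (subst Bochner_Integration.integral_add[symmetric], (intro mass_integrable assms(1))+)
     (use assms(2,3) in \<open>intro Bochner_Integration.integral_cong, auto simp: indicator_def\<close>)

lemma mass_le:
  assumes "integrable lborel f"
  shows "mass f a b \<le> (\<integral>x. \<bar>f x\<bar> \<partial>lborel)"
  unfolding mass_def
  by (intro integral_mono mass_integrable integrable_abs assms) (auto simp: indicator_def)

text \<open>Here \<open>g\<close> is the good part, \<open>w\<close> the sum of the atoms on stopped
  intervals, \<open>E\<close> the union of the tripled stopped intervals, and \<open>e\<close> the
  remainder at the finest scale \<open>h\<close>. The bounds concern \<open>T w\<close> and
  \<open>T e\<close> rather than a list of atoms, and each is linear in \<open>mass\<close> or local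
  to the interval, so that adjacent intervals can be joined by addition.\<close>

definition cz_split :: "(real \<Rightarrow> real) \<Rightarrow> real \<Rightarrow> real \<Rightarrow> real \<Rightarrow> real \<Rightarrow> bool" where
  "cz_split f l h a b \<longleftrightarrow> (\<exists>g w e E. L2fun g \<and> L2fun w \<and> L2fun e
     \<and> (\<forall>x. f x * indicator {a..<b} x = g x + w x + e x)
     \<and> (\<forall>x. \<bar>g x\<bar> \<le> 2 * l * indicator {a..<b} x) \<and> (\<integral>x. \<bar>g x\<bar> \<partial>lborel) \<le> mass f a b
     \<and> E \<in> sets borel \<and> emeasure lborel E \<le> ennreal (3 / l * mass f a b)
     \<and> (\<integral>\<^sup>+x. ennreal \<bar>T w x\<bar> * indicator (- E) x \<partial>lborel) \<le> ennreal (2 * A * mass f a b)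
     \<and> (\<forall>x. \<bar>T e x\<bar> \<le> 2 * K * h * mass f a b))"

text \<open>A finest interval on which the average never exceeded \<open>l\<close>. The deviation
  from the mean has mean zero, and \<open>T_small\<close> charges it with the length of the
  interval; this replaces the almost-everywhere bound by \<open>l\<close> off the stopped
  intervals.\<close>

lemma cz_split_small:
  assumes f: "L2fun f" "integrable lborel f" and "a < b" "l > 0" "mass f a b \<le> l * (b - a)"
  shows "cz_split f l (b - a) a b"
proof -
  define m where "m = (\<integral>x. f x * indicator {a..<b} x \<partial>lborel) / (b - a)"
  define w where "w = (\<lambda>x. (f x - m) * indicator {a..<b} x)"
  have w: "atom a b w" "(\<integral>x. \<bar>w x\<bar> \<partial>lborel) \<le> 2 * mass f a b" "\<bar>m\<bar> * (b - a) \<le> mass f a b"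
    unfolding w_def m_def mass_def by (rule atom_mean_deviation[OF f \<open>a < b\<close>])+
  have "\<bar>m\<bar> * (b - a) \<le> l * (b - a)" using w(3) assms by linarith
  then have m: "\<bar>m\<bar> \<le> 2 * l" using assms by simp
  have "\<bar>T w x\<bar> \<le> 2 * K * (b - a) * mass f a b" for x
  proof -
    have "\<bar>T w x\<bar> \<le> K * (b - a) * (\<integral>x. \<bar>w x\<bar> \<partial>lborel)" by (rule T_small[OF w(1)])
    also have "\<dots> \<le> K * (b - a) * (2 * mass f a b)"
      using w(2) K_nonneg assms by (intro mult_left_mono) auto
    finally show ?thesis by (simp only: mult_ac)
  qed
  note Tw = this
  show ?thesis
    unfolding cz_split_def
  \<comment> \<open>The local \<open>w\<close> fills the slot of the remainder \<open>e\<close>; the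
    atomic part and the exceptional set are empty.\<close>
  proof (rule exI[of _ "\<lambda>x. m * indicator {a..<b} x"], rule exI[of _ "\<lambda>_. 0"], rule exI[of _ w],
      rule exI[of _ "{}"], intro conjI allI Tw)
    show "f x * indicator {a..<b} x = m * indicator {a..<b} x + 0 + w x" for x
      by (simp add: w_def algebra_simps)
    show "\<bar>m * indicator {a..<b} x\<bar> \<le> 2 * l * indicator {a..<b} x" for x
      using m by (simp add: indicator_def)
    show "(\<integral>x. \<bar>m * indicator {a..<b} x\<bar> \<partial>lborel) \<le> mass f a b"
      using w(3) assms by (simp add: abs_mult)
  qed (use w(1) in \<open>auto intro!: L2fun_cmult L2fun_interval simp: T_zero atom_def\<close>)
qed

text \<open>A stopped interval. Its average exceeds \<open>l\<close>, so the tripled interval has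
  length at most 3 / l times the mass; its average is at most 2 l, which bounds the mean taken as
  good part.\<close>

lemma cz_split_big:
  assumes f: "L2fun f" "integrable lborel f" and "a < b" "l > 0" "h \<ge> 0"
    and "l * (b - a) < mass f a b" "mass f a b \<le> 2 * l * (b - a)"
  shows "cz_split f l h a b"
proof -
  define m where "m = (\<integral>x. f x * indicator {a..<b} x \<partial>lborel) / (b - a)"
  define w where "w = (\<lambda>x. (f x - m) * indicator {a..<b} x)"
  have w: "atom a b w" "(\<integral>x. \<bar>w x\<bar> \<partial>lborel) \<le> 2 * mass f a b" "\<bar>m\<bar> * (b - a) \<le> mass f a b"
    unfolding w_def m_def mass_def by (rule atom_mean_deviation[OF f \<open>a < b\<close>])+
  have "\<bar>m\<bar> * (b - a) \<le> (2 * l) * (b - a)" using w(3) assms by linarith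
  then have m: "\<bar>m\<bar> \<le> 2 * l" using assms by simp
  have "(\<integral>\<^sup>+x. ennreal \<bar>T w x\<bar> * indicator (- {2 * a - b..2 * b - a}) x \<partial>lborel)
     \<le> ennreal (A * (\<integral>x. \<bar>w x\<bar> \<partial>lborel))" by (rule T_atom[OF w(1)])
  also have "\<dots> \<le> ennreal (2 * A * mass f a b)"
    using mult_left_mono[OF w(2) A_nonneg] by (intro ennreal_leI) (simp add: mult_ac)
  finally have T: "(\<integral>\<^sup>+x. ennreal \<bar>T w x\<bar> * indicator (- {2 * a - b..2 * b - a}) x \<partial>lborel)
     \<le> ennreal (2 * A * mass f a b)" .
  have E: "emeasure lborel {2 * a - b..2 * b - a} \<le> ennreal (3 / l * mass f a b)"
    using assms by (auto simp: field_simps intro!: ennreal_leI)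
  show ?thesis
    unfolding cz_split_def
  proof (rule exI[of _ "\<lambda>x. m * indicator {a..<b} x"], rule exI[of _ w], rule exI[of _ "\<lambda>_. 0"],
      rule exI[of _ "{2 * a - b..2 * b - a}"], intro conjI allI T E)
    show "f x * indicator {a..<b} x = m * indicator {a..<b} x + w x + 0" for x
      by (simp add: w_def algebra_simps)
    show "\<bar>m * indicator {a..<b} x\<bar> \<le> 2 * l * indicator {a..<b} x" for x
      using m by (simp add: indicator_def)
    show "(\<integral>x. \<bar>m * indicator {a..<b} x\<bar> \<partial>lborel) \<le> mass f a b"
      using w(3) assms by (simp add: abs_mult)
    show "\<bar>T (\<lambda>_. 0) x\<bar> \<le> 2 * K * h * mass f a b" for x
      using K_nonneg assms(5) mass_nonneg by (simp add: T_zero)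
  qed (use w(1) in \<open>auto intro!: L2fun_cmult L2fun_interval simp: atom_def\<close>)
qed

text \<open>Masses add over adjacent intervals, exceptional sets are united, and off the union both
  integrals of the bad parts only decrease.\<close>

lemma cz_split_join:
  assumes f: "integrable lborel f" and "a \<le> c" "c \<le> b" "l > 0"
    and "cz_split f l h a c" "cz_split f l h c b"
  shows "cz_split f l h a b"
proof -
  note mass = mass_split[OF f \<open>a \<le> c\<close> \<open>c \<le> b\<close>, symmetric]
  obtain g1 w1 e1 E1 where 1: "L2fun g1" "L2fun w1" "L2fun e1"
    "\<And>x. f x * indicator {a..<c} x = g1 x + w1 x + e1 x"
    "\<And>x. \<bar>g1 x\<bar> \<le> 2 * l * indicator {a..<c} x" "(\<integral>x. \<bar>g1 x\<bar> \<partial>lborel) \<le> mass f a c"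
    "E1 \<in> sets borel" "emeasure lborel E1 \<le> ennreal (3 / l * mass f a c)"
    "(\<integral>\<^sup>+x. ennreal \<bar>T w1 x\<bar> * indicator (- E1) x \<partial>lborel) \<le> ennreal (2 * A * mass f a c)"
    "\<And>x. \<bar>T e1 x\<bar> \<le> 2 * K * h * mass f a c"
    using assms(5) unfolding cz_split_def by auto
  obtain g2 w2 e2 E2 where 2: "L2fun g2" "L2fun w2" "L2fun e2"
    "\<And>x. f x * indicator {c..<b} x = g2 x + w2 x + e2 x"
    "\<And>x. \<bar>g2 x\<bar> \<le> 2 * l * indicator {c..<b} x" "(\<integral>x. \<bar>g2 x\<bar> \<partial>lborel) \<le> mass f c b"
    "E2 \<in> sets borel" "emeasure lborel E2 \<le> ennreal (3 / l * mass f c b)"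
    "(\<integral>\<^sup>+x. ennreal \<bar>T w2 x\<bar> * indicator (- E2) x \<partial>lborel) \<le> ennreal (2 * A * mass f c b)"
    "\<And>x. \<bar>T e2 x\<bar> \<le> 2 * K * h * mass f c b"
    using assms(6) unfolding cz_split_def by auto
  note [measurable] = 1(1-3,7) 2(1-3,7) T_meas[OF 1(2)] T_meas[OF 2(2)]
  have ind: "indicator {a..<b} x = (indicator {a..<c} x + indicator {c..<b} x :: real)" for x
    using assms(2,3) by (auto simp: indicator_def)
  \<comment> \<open>Integrability comes from boundedness with bounded support; \<open>L2fun\<close>
    alone does not give it.\<close>
  have gint: "integrable lborel g1" "integrable lborel g2"
    using 1(1,5) 2(1,5) assms(4)
    by (auto intro!: Bochner_Integration.integrable_bound[of _ "\<lambda>x. 2 * l * indicator {a..<c} x" g1]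
      Bochner_Integration.integrable_bound[of _ "\<lambda>x. 2 * l * indicator {c..<b} x" g2] integrable_mult_right
      integrable_lborel_interval simp: L2fun_def abs_mult)
  have nn: "0 \<le> 3 / l * mass f a c" "0 \<le> 3 / l * mass f c b"
    "0 \<le> 2 * A * mass f a c" "0 \<le> 2 * A * mass f c b"
    using mass_nonneg A_nonneg assms(4) by auto
  show ?thesis
    unfolding cz_split_def
  proof (intro exI conjI allI)
    show "L2fun (\<lambda>x. g1 x + g2 x)" "L2fun (\<lambda>x. w1 x + w2 x)" "L2fun (\<lambda>x. e1 x + e2 x)"
      using 1 2 by (auto intro: L2fun_add)
    show "f x * indicator {a..<b} x = g1 x + g2 x + (w1 x + w2 x) + (e1 x + e2 x)" for x
      using 1(4)[of x] 2(4)[of x] by (simp add: ind distrib_left)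
    show "\<bar>g1 x + g2 x\<bar> \<le> 2 * l * indicator {a..<b} x" for x
      using 1(5)[of x] 2(5)[of x] by (simp add: ind distrib_left)
    have "(\<integral>x. \<bar>g1 x + g2 x\<bar> \<partial>lborel) \<le> (\<integral>x. \<bar>g1 x\<bar> + \<bar>g2 x\<bar> \<partial>lborel)"
      using gint by (intro integral_mono) auto
    also have "\<dots> = (\<integral>x. \<bar>g1 x\<bar> \<partial>lborel) + (\<integral>x. \<bar>g2 x\<bar> \<partial>lborel)"
      using gint by (intro Bochner_Integration.integral_add) auto
    finally show "(\<integral>x. \<bar>g1 x + g2 x\<bar> \<partial>lborel) \<le> mass f a b"
      using 1(6) 2(6) by (simp add: mass)
    show "E1 \<union> E2 \<in> sets borel" by measurable
    have "emeasure lborel (E1 \<union> E2) \<le> emeasure lborel E1 + emeasure lborel E2"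
      by (rule emeasure_subadditive) auto
    also have "\<dots> \<le> ennreal (3 / l * mass f a c) + ennreal (3 / l * mass f c b)"
      using 1(8) 2(8) by (rule add_mono)
    also have "\<dots> = ennreal (3 / l * mass f a b)"
      using nn by (simp add: mass distrib_left ennreal_plus[symmetric] del: ennreal_plus)
    finally show "emeasure lborel (E1 \<union> E2) \<le> ennreal (3 / l * mass f a b)" .
    have "(\<integral>\<^sup>+x. ennreal \<bar>T (\<lambda>x. w1 x + w2 x) x\<bar> * indicator (- (E1 \<union> E2)) x \<partial>lborel)
      \<le> (\<integral>\<^sup>+x. ennreal \<bar>T w1 x\<bar> * indicator (- E1) x + ennreal \<bar>T w2 x\<bar> * indicator (- E2) x \<partial>lborel)"
      using 1(2) 2(2)
      by (intro nn_integral_mono)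
         (auto simp: T_add indicator_def ennreal_plus[symmetric] intro!: ennreal_leI simp del: ennreal_plus)
    also have "\<dots> = (\<integral>\<^sup>+x. ennreal \<bar>T w1 x\<bar> * indicator (- E1) x \<partial>lborel)
        + (\<integral>\<^sup>+x. ennreal \<bar>T w2 x\<bar> * indicator (- E2) x \<partial>lborel)"
      by (intro nn_integral_add) measurable
    also have "\<dots> \<le> ennreal (2 * A * mass f a c) + ennreal (2 * A * mass f c b)"
      using 1(9) 2(9) by (rule add_mono)
    also have "\<dots> = ennreal (2 * A * mass f a b)"
      using nn by (simp add: mass distrib_left ennreal_plus[symmetric] del: ennreal_plus)
    finally show "(\<integral>\<^sup>+x. ennreal \<bar>T (\<lambda>x. w1 x + w2 x) x\<bar> * indicator (- (E1 \<union> E2)) x \<partial>lborel)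
      \<le> ennreal (2 * A * mass f a b)" .
    show "\<bar>T (\<lambda>x. e1 x + e2 x) x\<bar> \<le> 2 * K * h * mass f a b" for x
      using 1(10)[of x] 2(10)[of x] by (simp add: T_add[OF 1(3) 2(3)] mass distrib_left)
  qed
qed

text \<open>The mass premise says that the interval has not been stopped. A half whose average
  exceeds \<open>l\<close> is stopped; since the parent has average at most \<open>l\<close>, the
  average over the half is at most 2 l. After \<open>n\<close> bisections the surviving intervals
  have length \<open>h\<close>.\<close>

lemma cz_split_bisect:
  assumes f: "L2fun f" "integrable lborel f" and l: "l > 0" and h: "h > 0"
  shows "b - a = 2 ^ n * h \<Longrightarrow> mass f a b \<le> l * (b - a) \<Longrightarrow> cz_split f l h a b"
proof (induction n arbitrary: a b)
  case 0
  then show ?case using cz_split_small[OF f, of a b l] l h by simp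
next
  case (Suc n)
  define c where "c = (a + b) / 2"
  have c: "c - a = 2 ^ n * h" "b - c = 2 ^ n * h" using Suc.prems(1) by (auto simp: c_def field_simps)
  have "2 ^ n * h > 0" using h by simp
  with c have ord: "a < c" "c < b" by auto
  have split: "mass f a c + mass f c b = mass f a b" using mass_split[OF f(2)] ord by auto
  have tot: "l * (b - a) = 2 * l * (c - a)" "l * (b - a) = 2 * l * (b - c)"
    by (auto simp: c_def field_simps)
  have "cz_split f l h a c"
  proof (cases "mass f a c \<le> l * (c - a)")
    case True
    then show ?thesis using Suc.IH c by auto
  next
    case False
    then show ?thesis using cz_split_big[OF f ord(1) l, of h] h Suc.prems(2) split tot mass_nonneg[of f c b] by auto
  qed
  moreover have "cz_split f l h c b"
  proof (cases "mass f c b \<le> l * (b - c)")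
    case True
    then show ?thesis using Suc.IH c by auto
  next
    case False
    then show ?thesis using cz_split_big[OF f ord(2) l, of h] h Suc.prems(2) split tot mass_nonneg[of f a c] by auto
  qed
  ultimately show ?case using ord l by (intro cz_split_join[OF f(2), of a c b]) auto
qed

text \<open>The tail \<open>r\<close> and the remainder \<open>e\<close> contribute at most t / 4
  each at every point, so where |T f| > t one of the other two pieces reaches t / 4. With N the L1
  norm of \<open>f\<close>, the good part costs 2 t N / (t^2 / 16) = 32 N / t, the exceptional set 3
  N / t, and the bad part off it 2 A N / (t / 4) = 8 A N / t.\<close>

lemma weak_type:
  assumes f: "L2fun f" "integrable lborel f" and t: "t > 0"
  shows "emeasure lborel {x. t < \<bar>T f x\<bar>} \<le> ennreal ((35 + 8 * A) / t * (\<integral>x. \<bar>f x\<bar> \<partial>lborel))"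
proof -
  define N where "N = (\<integral>x. \<bar>f x\<bar> \<partial>lborel)"
  have N: "N \<ge> 0" by (auto simp: N_def)
  note [measurable] = f(1)
  \<comment> \<open>The truncation radius is chosen after \<open>K\<close>: the L1 mass of the tail
    tends to 0, so \<open>T_sup\<close> makes its image uniformly small.\<close>
  have "(\<lambda>n. \<integral>x. \<bar>f x\<bar> * indicator (- {- real n..<real n}) x \<partial>lborel) \<longlonglongrightarrow> (\<integral>x. 0 \<partial>(lborel :: real measure))"
  proof (rule integral_dominated_convergence[where w = "\<lambda>x. \<bar>f x\<bar>"])
    show "integrable lborel (\<lambda>x. \<bar>f x\<bar>)" using f by auto
    show "AE x in lborel. (\<lambda>n. \<bar>f x\<bar> * indicator (- {- real n..<real n}) x) \<longlonglongrightarrow> 0"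
    proof (rule AE_I2)
      fix x :: real
      obtain n0 where "\<bar>x\<bar> < real n0" using reals_Archimedean2 by blast
      then have "eventually (\<lambda>n. \<bar>f x\<bar> * indicator (- {- real n..<real n}) x = 0) sequentially"
        by (intro eventually_sequentiallyI[of n0]) (auto simp: indicator_def)
      then show "(\<lambda>n. \<bar>f x\<bar> * indicator (- {- real n..<real n}) x) \<longlonglongrightarrow> 0"
        by (rule tendsto_eventually)
    qed
  qed (auto simp: indicator_def)
  then have "(\<lambda>n. K * (\<integral>x. \<bar>f x\<bar> * indicator (- {- real n..<real n}) x \<partial>lborel)) \<longlonglongrightarrow> K * 0"
    by (intro tendsto_intros) simp
  then have "eventually (\<lambda>n. K * (\<integral>x. \<bar>f x\<bar> * indicator (- {- real n..<real n}) x \<partial>lborel) < t / 4) sequentially"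
    using t by (intro order_tendstoD) auto
  \<comment> \<open>This keeps the average of |f| over [-R, R) below \<open>t\<close>, the condition
    under which the bisection may start.\<close>
  moreover have "eventually (\<lambda>n. real n > N / t) sequentially"
    using filterlim_real_sequentially by (auto simp: filterlim_at_top_dense)
  ultimately have "eventually (\<lambda>n. K * (\<integral>x. \<bar>f x\<bar> * indicator (- {- real n..<real n}) x \<partial>lborel) < t / 4
      \<and> real n > N / t \<and> real n > 0) sequentially"
    using eventually_gt_at_top[of 0] by eventually_elim auto
  then obtain n where n: "K * (\<integral>x. \<bar>f x\<bar> * indicator (- {- real n..<real n}) x \<partial>lborel) < t / 4"
    "real n > N / t" "real n > 0" by (auto simp: eventually_sequentially)
  define R where "R = real n"
  note R = n[folded R_def]
  \<comment> \<open>The number of bisections depends on \<open>K\<close>; it brings the finest-scale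
    error 2 K h N down to t / 4 and leaves no trace in the final constant.\<close>
  obtain k where k: "2 * K * (2 * R) * N / (t / 4) < 2 ^ k" using real_arch_pow[of 2] by auto
  define h where "h = 2 * R / 2 ^ k"
  have h: "h > 0" "R - (- R) = 2 ^ k * h" using R by (auto simp: h_def)
  have "2 * K * (2 * R) * N < 2 ^ k * (t / 4)" using k t by (simp add: field_simps)
  then have hN: "2 * K * h * N \<le> t / 4" by (simp add: h_def field_simps)
  have mN: "mass f (- R) R \<le> N" unfolding N_def by (rule mass_le[OF f(2)])
  have "N \<le> t * R" using R(2) t by (simp add: field_simps)
  moreover have "0 < t * R" using R(3) t by simp
  ultimately have "mass f (- R) R \<le> t * (R - (- R))" using mN by (simp add: algebra_simps)
  from cz_split_bisect[OF f t h this] obtain g w e E where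
    split: "L2fun g" "L2fun w" "L2fun e"
    "\<And>x. f x * indicator {- R..<R} x = g x + w x + e x"
    "\<And>x. \<bar>g x\<bar> \<le> 2 * t * indicator {- R..<R} x" "(\<integral>x. \<bar>g x\<bar> \<partial>lborel) \<le> mass f (- R) R"
    "E \<in> sets borel" "emeasure lborel E \<le> ennreal (3 / t * mass f (- R) R)"
    "(\<integral>\<^sup>+x. ennreal \<bar>T w x\<bar> * indicator (- E) x \<partial>lborel) \<le> ennreal (2 * A * mass f (- R) R)"
    "\<And>x. \<bar>T e x\<bar> \<le> 2 * K * h * mass f (- R) R"
    unfolding cz_split_def by auto
  note [measurable] = split(1-3,7) T_meas[OF split(1)] T_meas[OF split(2)]
  define r where "r = (\<lambda>x. f x * indicator (- {- R..<R}) x)"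
  have rL2: "L2fun r" unfolding r_def using f(1) by (intro L2fun_indicator) auto
  have rint: "integrable lborel r"
    unfolding r_def using integrable_mult_indicator[of "- {- R..<R}" lborel f] f(2) by (simp add: mult.commute)
  have Tr: "\<bar>T r x\<bar> \<le> t / 4" for x
  proof -
    have "\<bar>T r x\<bar> \<le> K * (\<integral>x. \<bar>r x\<bar> \<partial>lborel)" by (rule T_sup[OF rL2 rint])
    also have "\<dots> \<le> t / 4" using R(1) by (simp add: r_def abs_mult)
    finally show ?thesis .
  qed
  have Te: "\<bar>T e x\<bar> \<le> t / 4" for x
  proof -
    have "2 * K * h * mass f (- R) R \<le> 2 * K * h * N" using mN K_nonneg h by (intro mult_left_mono) auto
    with split(10)[of x] hN show ?thesis by linarith
  qed
  have "f = (\<lambda>x. (g x + w x + e x) + r x)"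
    unfolding split(4)[symmetric] by (auto simp: r_def indicator_def)
  moreover have "T (\<lambda>x. (g x + w x + e x) + r x) x = T g x + T w x + T e x + T r x" for x
    using split(1-3) rL2 by (simp add: T_add L2fun_add)
  ultimately have Tf: "T f x = T g x + T w x + T e x + T r x" for x by metis
  \<comment> \<open>Markov's inequality is applied to the bad part cut off outside \<open>E\<close>,
    where alone its integral is controlled.\<close>
  define u where "u = (\<lambda>x. T w x * indicator (- E) x)"
  have [measurable]: "u \<in> borel_measurable borel" unfolding u_def by measurable
  have "{x. t < \<bar>T f x\<bar>} \<subseteq> {x. t\<^sup>2 / 16 \<le> \<bar>(T g x)\<^sup>2\<bar>} \<union> (E \<union> {x. t / 4 \<le> \<bar>u x\<bar>})"
  proof (intro subsetI)
    fix x assume x: "x \<in> {x. t < \<bar>T f x\<bar>}"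
    show "x \<in> {x. t\<^sup>2 / 16 \<le> \<bar>(T g x)\<^sup>2\<bar>} \<union> (E \<union> {x. t / 4 \<le> \<bar>u x\<bar>})"
    proof (cases "t / 4 \<le> \<bar>T g x\<bar>")
      case True
      then have "(t / 4)\<^sup>2 \<le> \<bar>T g x\<bar>\<^sup>2" using t by (intro power_mono) auto
      then show ?thesis by (simp add: power_divide)
    next
      case False
      then have "t / 4 \<le> \<bar>T w x\<bar>" using x Te[of x] Tr[of x] by (simp add: Tf)
      then show ?thesis by (auto simp: u_def indicator_def)
    qed
  qed
  then have "emeasure lborel {x. t < \<bar>T f x\<bar>} \<le> emeasure lborel ({x. t\<^sup>2 / 16 \<le> \<bar>(T g x)\<^sup>2\<bar>} \<union> (E \<union> {x. t / 4 \<le> \<bar>u x\<bar>}))"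
    by (intro emeasure_mono) measurable
  also have "\<dots> \<le> emeasure lborel {x. t\<^sup>2 / 16 \<le> \<bar>(T g x)\<^sup>2\<bar>} + emeasure lborel (E \<union> {x. t / 4 \<le> \<bar>u x\<bar>})"
    by (intro emeasure_subadditive) measurable
  also have "\<dots> \<le> emeasure lborel {x. t\<^sup>2 / 16 \<le> \<bar>(T g x)\<^sup>2\<bar>} + (emeasure lborel E + emeasure lborel {x. t / 4 \<le> \<bar>u x\<bar>})"
    by (intro add_left_mono emeasure_subadditive) measurable
  also have "\<dots> \<le> ennreal (32 / t * N) + (ennreal (3 / t * N) + ennreal (8 * A / t * N))"
  proof (intro add_mono)
    have gint: "integrable lborel (\<lambda>x. \<bar>g x\<bar>)"
      using split(1,5) t
      by (intro integrable_abs Bochner_Integration.integrable_bound[of _ "\<lambda>x. 2 * t * indicator {- R..<R} x" g] 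
          integrable_mult_right integrable_lborel_interval) (auto simp: L2fun_def abs_mult)
    have "(\<integral>x. (g x)\<^sup>2 \<partial>lborel) \<le> (\<integral>x. 2 * t * \<bar>g x\<bar> \<partial>lborel)"
    proof (intro integral_mono)
      fix x
      have "\<bar>g x\<bar> \<le> 2 * t"
        using split(5)[of x] t by (cases "x \<in> {- R..<R}") auto
      then have "\<bar>g x\<bar> * \<bar>g x\<bar> \<le> 2 * t * \<bar>g x\<bar>" by (intro mult_right_mono) auto
      then show "(g x)\<^sup>2 \<le> 2 * t * \<bar>g x\<bar>" by (simp add: power2_eq_square)
    qed (use split(1) gint in \<open>auto simp: L2fun_def\<close>)
    also have "\<dots> \<le> 2 * t * N" using split(6) mN t by simp
    finally have "(\<integral>\<^sup>+x. ennreal \<bar>(T g x)\<^sup>2\<bar> \<partial>lborel) \<le> ennreal (2 * t * N)"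
      using order_trans[OF T_L2[OF split(1)]] by (simp add: ennreal_leI)
    from lborel_markov[OF _ _ this, of "t\<^sup>2 / 16"] t
    show "emeasure lborel {x. t\<^sup>2 / 16 \<le> \<bar>(T g x)\<^sup>2\<bar>} \<le> ennreal (32 / t * N)"
      by (simp add: power2_eq_square field_simps)
    show "emeasure lborel E \<le> ennreal (3 / t * N)"
      using split(8) mN t by (elim order_trans) (intro ennreal_leI mult_left_mono, auto)
    have "(\<integral>\<^sup>+x. ennreal \<bar>u x\<bar> \<partial>lborel) = (\<integral>\<^sup>+x. ennreal \<bar>T w x\<bar> * indicator (- E) x \<partial>lborel)"
      by (intro nn_integral_cong) (auto simp: u_def indicator_def)
    also have "\<dots> \<le> ennreal (2 * A * N)"
      using split(9) mN A_nonneg by (elim order_trans) (intro ennreal_leI mult_left_mono, auto)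
    finally have "(\<integral>\<^sup>+x. ennreal \<bar>u x\<bar> \<partial>lborel) \<le> ennreal (2 * A * N)" .
    from lborel_markov[OF _ _ this, of "t / 4"] t
    show "emeasure lborel {x. t / 4 \<le> \<bar>u x\<bar>} \<le> ennreal (8 * A / t * N)"
      by (simp add: field_simps)
  qed
  also have "\<dots> = ennreal ((35 + 8 * A) / t * N)"
    using N A_nonneg t by (simp add: ennreal_plus[symmetric] field_simps del: ennreal_plus)
  finally show ?thesis by (simp add: N_def)
qed

end

subsection \<open>Interpolation and duality\<close>

lemma nn_integral_powr_atMost:
  assumes "s > -1" "y \<ge> 0"
  shows "(\<integral>\<^sup>+t. ennreal (t powr s) * indicator {0..y} t \<partial>lborel) = ennreal (y powr (s + 1) / (s + 1))"
proof -
  have "(\<integral>\<^sup>+t. ennreal (t powr s) * indicator {0..y} t \<partial>lborel)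
      = integral\<^sup>N lborel (\<lambda>t. indicator {0..y} t * t powr s)"
    by (intro nn_integral_cong) (simp add: indicator_def)
  also have "\<dots> = ennreal (y powr (s + 1) / (s + 1))"
    by (rule nn_integral_has_integral_lebesgue[OF _ has_integral_powr_from_0[OF assms]]) auto
  finally show ?thesis .
qed

lemma nn_integral_powr_atLeast:
  assumes "s < -1" "y > 0"
  shows "(\<integral>\<^sup>+t. ennreal (t powr s) * indicator {y..} t \<partial>lborel) = ennreal (y powr (s + 1) / - (s + 1))"
proof -
  have "((\<lambda>t. t powr (s + 1) / (s + 1)) \<longlongrightarrow> 0 / (s + 1)) at_top"
    using assms by (intro tendsto_intros tendsto_neg_powr filterlim_ident) auto
  then have "(\<integral>\<^sup>+t. ennreal (t powr s) * indicator {y..} t \<partial>lborel) = 0 / (s + 1) - y powr (s + 1) / (s + 1)"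
    using assms by (intro nn_integral_FTC_atLeast) (auto intro!: derivative_eq_intros)
  moreover have "0 / (s + 1) - y powr (s + 1) / (s + 1) = y powr (s + 1) / - (s + 1)"
    by (simp only: div_0 diff_0 minus_divide_right)
  ultimately show ?thesis by simp
qed

lemma layer_cake:
  fixes u :: "real \<Rightarrow> real"
  assumes [measurable]: "u \<in> borel_measurable borel" and "p > 0"
  shows "(\<integral>\<^sup>+x. ennreal (\<bar>u x\<bar> powr p) \<partial>lborel)
    = (\<integral>\<^sup>+t. ennreal (p * t powr (p - 1)) * indicator {0..} t * emeasure lborel {x. t \<le> \<bar>u x\<bar>} \<partial>lborel)"
proof -
  have "ennreal (\<bar>u x\<bar> powr p) = (\<integral>\<^sup>+t. ennreal (p * t powr (p - 1)) * indicator {0..\<bar>u x\<bar>} t \<partial>lborel)" for x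
  proof -
    have "(\<integral>\<^sup>+t. ennreal (p * t powr (p - 1)) * indicator {0..\<bar>u x\<bar>} t \<partial>lborel)
      = (\<integral>\<^sup>+t. ennreal p * (ennreal (t powr (p - 1)) * indicator {0..\<bar>u x\<bar>} t) \<partial>lborel)"
      using assms(2) by (simp add: ennreal_mult mult.assoc)
    also have "\<dots> = ennreal p * ennreal (\<bar>u x\<bar> powr (p - 1 + 1) / (p - 1 + 1))"
      using assms(2) nn_integral_powr_atMost[of "p - 1" "\<bar>u x\<bar>"] by (subst nn_integral_cmult) auto
    also have "\<dots> = ennreal (\<bar>u x\<bar> powr p)"
      using assms(2) by (simp add: ennreal_mult[symmetric])
    finally show ?thesis by simp
  qed
  then have "(\<integral>\<^sup>+x. ennreal (\<bar>u x\<bar> powr p) \<partial>lborel)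
    = (\<integral>\<^sup>+x. (\<integral>\<^sup>+t. ennreal (p * t powr (p - 1)) * indicator {0..\<bar>u x\<bar>} t \<partial>lborel) \<partial>lborel)"
    by simp
  \<comment> \<open>The indicator of an interval depending on x becomes a condition in both
    variables, in which joint measurability is visible for Fubini.\<close>
  also have "\<dots> = (\<integral>\<^sup>+x. (\<integral>\<^sup>+t. ennreal (p * t powr (p - 1)) * (if 0 \<le> t \<and> t \<le> \<bar>u x\<bar> then 1 else 0) \<partial>lborel) \<partial>lborel)"
    by (intro nn_integral_cong) (auto simp: indicator_def)
  also have "\<dots> = (\<integral>\<^sup>+t. (\<integral>\<^sup>+x. ennreal (p * t powr (p - 1)) * (if 0 \<le> t \<and> t \<le> \<bar>u x\<bar> then 1 else 0) \<partial>lborel) \<partial>lborel)"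
    by (rule lborel_pair.Fubini') measurable
  also have "\<dots> = (\<integral>\<^sup>+t. ennreal (p * t powr (p - 1)) * indicator {0..} t * emeasure lborel {x. t \<le> \<bar>u x\<bar>} \<partial>lborel)"
  proof (intro nn_integral_cong)
    fix t :: real
    have "(\<integral>\<^sup>+x. ennreal (p * t powr (p - 1)) * (if 0 \<le> t \<and> t \<le> \<bar>u x\<bar> then 1 else 0) \<partial>lborel)
      = (\<integral>\<^sup>+x. (ennreal (p * t powr (p - 1)) * indicator {0..} t) * indicator {x. t \<le> \<bar>u x\<bar>} x \<partial>lborel)"
      by (intro nn_integral_cong) (auto simp: indicator_def)
    also have "\<dots> = (ennreal (p * t powr (p - 1)) * indicator {0..} t) * emeasure lborel {x. t \<le> \<bar>u x\<bar>}"
      by (rule nn_integral_cmult_indicator) measurable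
    finally show "(\<integral>\<^sup>+x. ennreal (p * t powr (p - 1)) * (if 0 \<le> t \<and> t \<le> \<bar>u x\<bar> then 1 else 0) \<partial>lborel)
      = ennreal (p * t powr (p - 1)) * indicator {0..} t * emeasure lborel {x. t \<le> \<bar>u x\<bar>}" .
  qed
  finally show ?thesis .
qed

text \<open>\<open>f\<close> is cut at height \<open>t\<close>, the level being estimated. The high
  part satisfies |f1| \<le> f^2 / t and is therefore integrable even when \<open>f\<close> is not,
  so the weak bound applies to it at t / 4; the low part is treated by Chebyshev's inequality at t /
  2.\<close>

lemma marcinkiewicz_distribution:
  fixes T :: "(real \<Rightarrow> real) \<Rightarrow> real \<Rightarrow> real"
  assumes T_add: "\<And>f g y. L2fun f \<Longrightarrow> L2fun g \<Longrightarrow> T (\<lambda>x. f x + g x) y = T f y + T g y"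
    and T_meas: "\<And>f. L2fun f \<Longrightarrow> T f \<in> borel_measurable borel"
    and T_L2: "\<And>f. L2fun f \<Longrightarrow> (\<integral>\<^sup>+x. ennreal ((T f x)\<^sup>2) \<partial>lborel) \<le> ennreal (\<integral>x. (f x)\<^sup>2 \<partial>lborel)"
    and weak: "\<And>f t. L2fun f \<Longrightarrow> integrable lborel f \<Longrightarrow> t > 0 \<Longrightarrow>
      emeasure lborel {x. t < \<bar>T f x\<bar>} \<le> ennreal (W / t * (\<integral>x. \<bar>f x\<bar> \<partial>lborel))"
    and "W \<ge> 0" and f: "L2fun f" and t: "t > 0"
  shows "emeasure lborel {x. t \<le> \<bar>T f x\<bar>}
    \<le> ennreal (4 * W / t) * (\<integral>\<^sup>+x. ennreal (\<bar>f x\<bar>) * indicator {x. t \<le> \<bar>f x\<bar>} x \<partial>lborel)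
      + ennreal (4 / t\<^sup>2) * (\<integral>\<^sup>+x. ennreal ((f x)\<^sup>2) * indicator {x. \<bar>f x\<bar> < t} x \<partial>lborel)"
proof -
  note [measurable] = f
  define f1 where "f1 = (\<lambda>x. f x * indicator {x. t \<le> \<bar>f x\<bar>} x)"
  define f2 where "f2 = (\<lambda>x. f x * indicator {x. \<bar>f x\<bar> < t} x)"
  have L2: "L2fun f1" "L2fun f2"
    unfolding f1_def f2_def by (intro L2fun_indicator f; measurable)+
  note [measurable] = L2 T_meas[OF L2(1)] T_meas[OF L2(2)]
  have "\<bar>f1 x\<bar> \<le> (f x)\<^sup>2 / t" for x
  proof (cases "t \<le> \<bar>f x\<bar>")
    case True
    then have "\<bar>f x\<bar> * t \<le> \<bar>f x\<bar> * \<bar>f x\<bar>" by (intro mult_left_mono) auto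
    then show ?thesis using t True by (simp add: f1_def field_simps power2_eq_square)
  qed (use t in \<open>simp add: f1_def\<close>)
  then have int: "integrable lborel f1"
    using f t by (intro Bochner_Integration.integrable_bound[of _ "\<lambda>x. (f x)\<^sup>2 / t" f1]) (auto simp: L2fun_def)
  have "f = (\<lambda>x. f1 x + f2 x)" by (auto simp: f1_def f2_def indicator_def)
  then have Tf: "T f x = T f1 x + T f2 x" for x
    using T_add[OF L2] by metis
  have "{x. t \<le> \<bar>T f x\<bar>} \<subseteq> {x. t / 4 < \<bar>T f1 x\<bar>} \<union> {x. t\<^sup>2 / 4 \<le> \<bar>(T f2 x)\<^sup>2\<bar>}"
  proof
    fix x assume x: "x \<in> {x. t \<le> \<bar>T f x\<bar>}"
    show "x \<in> {x. t / 4 < \<bar>T f1 x\<bar>} \<union> {x. t\<^sup>2 / 4 \<le> \<bar>(T f2 x)\<^sup>2\<bar>}"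
    proof (cases "t / 4 < \<bar>T f1 x\<bar>")
      case False
      then have "t / 2 \<le> \<bar>T f2 x\<bar>" using x t by (simp add: Tf)
      then have "(t / 2)\<^sup>2 \<le> \<bar>T f2 x\<bar>\<^sup>2" using t by (intro power_mono) auto
      then show ?thesis by (simp add: power_divide)
    qed simp
  qed
  then have "emeasure lborel {x. t \<le> \<bar>T f x\<bar>} \<le> emeasure lborel ({x. t / 4 < \<bar>T f1 x\<bar>} \<union> {x. t\<^sup>2 / 4 \<le> \<bar>(T f2 x)\<^sup>2\<bar>})"
    by (intro emeasure_mono) measurable
  also have "\<dots> \<le> emeasure lborel {x. t / 4 < \<bar>T f1 x\<bar>} + emeasure lborel {x. t\<^sup>2 / 4 \<le> \<bar>(T f2 x)\<^sup>2\<bar>}"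
    by (intro emeasure_subadditive) measurable
  also have "\<dots> \<le> ennreal (4 * W / t * (\<integral>x. \<bar>f1 x\<bar> \<partial>lborel)) + ennreal (4 / t\<^sup>2 * (\<integral>x. (f2 x)\<^sup>2 \<partial>lborel))"
  proof (intro add_mono)
    show "emeasure lborel {x. t / 4 < \<bar>T f1 x\<bar>} \<le> ennreal (4 * W / t * (\<integral>x. \<bar>f1 x\<bar> \<partial>lborel))"
      using weak[OF L2(1) int, of "t / 4"] t by (simp add: mult.commute)
    have "(\<integral>\<^sup>+x. ennreal \<bar>(T f2 x)\<^sup>2\<bar> \<partial>lborel) \<le> ennreal (\<integral>x. (f2 x)\<^sup>2 \<partial>lborel)"
      using T_L2[OF L2(2)] by simp
    from lborel_markov[OF _ _ this, of "t\<^sup>2 / 4"] t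
    show "emeasure lborel {x. t\<^sup>2 / 4 \<le> \<bar>(T f2 x)\<^sup>2\<bar>} \<le> ennreal (4 / t\<^sup>2 * (\<integral>x. (f2 x)\<^sup>2 \<partial>lborel))"
      by (simp add: mult.commute)
  qed
  also have "ennreal (4 * W / t * (\<integral>x. \<bar>f1 x\<bar> \<partial>lborel))
      = ennreal (4 * W / t) * (\<integral>\<^sup>+x. ennreal (\<bar>f x\<bar>) * indicator {x. t \<le> \<bar>f x\<bar>} x \<partial>lborel)"
  proof -
    have "(\<integral>\<^sup>+x. ennreal (\<bar>f x\<bar>) * indicator {x. t \<le> \<bar>f x\<bar>} x \<partial>lborel) = (\<integral>\<^sup>+x. ennreal \<bar>f1 x\<bar> \<partial>lborel)"
      by (intro nn_integral_cong) (auto simp: f1_def indicator_def)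
    also have "\<dots> = ennreal (\<integral>x. \<bar>f1 x\<bar> \<partial>lborel)"
      using int by (intro nn_integral_eq_integral) auto
    finally show ?thesis using t \<open>W \<ge> 0\<close> by (subst ennreal_mult) auto
  qed
  also have "ennreal (4 / t\<^sup>2 * (\<integral>x. (f2 x)\<^sup>2 \<partial>lborel))
      = ennreal (4 / t\<^sup>2) * (\<integral>\<^sup>+x. ennreal ((f x)\<^sup>2) * indicator {x. \<bar>f x\<bar> < t} x \<partial>lborel)"
  proof -
    have "(\<integral>\<^sup>+x. ennreal ((f x)\<^sup>2) * indicator {x. \<bar>f x\<bar> < t} x \<partial>lborel) = (\<integral>\<^sup>+x. ennreal ((f2 x)\<^sup>2) \<partial>lborel)"
      by (intro nn_integral_cong) (auto simp: f2_def indicator_def)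
    also have "\<dots> = ennreal (\<integral>x. (f2 x)\<^sup>2 \<partial>lborel)"
      using L2 by (intro nn_integral_eq_integral) (auto simp: L2fun_def)
    finally show ?thesis by (subst ennreal_mult) auto
  qed
  finally show ?thesis .
qed

text \<open>The distribution estimate is integrated against p t^(p-1). After Tonelli the inner
  integrals are those of t^(p-2) over [0, |f x|] and of t^(p-3) beyond |f x|; they converge because
  1 < p and p < 2 and give the factors 1 / (p - 1) and 1 / (2 - p).\<close>

lemma marcinkiewicz:
  fixes T :: "(real \<Rightarrow> real) \<Rightarrow> real \<Rightarrow> real"
  assumes T_add: "\<And>f g y. L2fun f \<Longrightarrow> L2fun g \<Longrightarrow> T (\<lambda>x. f x + g x) y = T f y + T g y"
    and T_meas: "\<And>f. L2fun f \<Longrightarrow> T f \<in> borel_measurable borel"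
    and T_L2: "\<And>f. L2fun f \<Longrightarrow> (\<integral>\<^sup>+x. ennreal ((T f x)\<^sup>2) \<partial>lborel) \<le> ennreal (\<integral>x. (f x)\<^sup>2 \<partial>lborel)"
    and weak: "\<And>f t. L2fun f \<Longrightarrow> integrable lborel f \<Longrightarrow> t > 0 \<Longrightarrow>
      emeasure lborel {x. t < \<bar>T f x\<bar>} \<le> ennreal (W / t * (\<integral>x. \<bar>f x\<bar> \<partial>lborel))"
    and W: "W \<ge> 0" and p: "1 < p" "p < 2" and f: "L2fun f"
  shows "(\<integral>\<^sup>+x. ennreal (\<bar>T f x\<bar> powr p) \<partial>lborel)
    \<le> ennreal (4 * W * p / (p - 1) + 4 * p / (2 - p)) * (\<integral>\<^sup>+x. ennreal (\<bar>f x\<bar> powr p) \<partial>lborel)"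
proof -
  note [measurable] = L2fun_measurable[OF f] T_meas[OF f]
  define k1 where "k1 x t = ennreal (4 * W * p * t powr (p - 2)) * ennreal \<bar>f x\<bar> * (if 0 \<le> t \<and> t \<le> \<bar>f x\<bar> then 1 else 0)" for x t
  define k2 where "k2 x t = ennreal (4 * p * t powr (p - 3)) * ennreal ((f x)\<^sup>2) * (if 0 \<le> t \<and> \<bar>f x\<bar> < t then 1 else 0)" for x t
  have [measurable]: "case_prod k1 \<in> borel_measurable (lborel \<Otimes>\<^sub>M lborel)"
    "case_prod k2 \<in> borel_measurable (lborel \<Otimes>\<^sub>M lborel)"
    unfolding k1_def k2_def by measurable
  have [measurable]: "k1 x \<in> borel_measurable borel" "k2 x \<in> borel_measurable borel"
    "(\<lambda>x. k1 x t) \<in> borel_measurable borel" "(\<lambda>x. k2 x t) \<in> borel_measurable borel" for x t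
    unfolding k1_def k2_def by measurable
  have "(\<integral>\<^sup>+x. ennreal (\<bar>T f x\<bar> powr p) \<partial>lborel)
    = (\<integral>\<^sup>+t. ennreal (p * t powr (p - 1)) * indicator {0..} t * emeasure lborel {x. t \<le> \<bar>T f x\<bar>} \<partial>lborel)"
    using p by (intro layer_cake) auto
  also have "\<dots> \<le> (\<integral>\<^sup>+t. (\<integral>\<^sup>+x. k1 x t \<partial>lborel) + (\<integral>\<^sup>+x. k2 x t \<partial>lborel) \<partial>lborel)"
  proof (intro nn_integral_mono)
    fix t :: real
    show "ennreal (p * t powr (p - 1)) * indicator {0..} t * emeasure lborel {x. t \<le> \<bar>T f x\<bar>}
      \<le> (\<integral>\<^sup>+x. k1 x t \<partial>lborel) + (\<integral>\<^sup>+x. k2 x t \<partial>lborel)"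
    proof (cases "t > 0")
      case True
      have dist: "emeasure lborel {x. t \<le> \<bar>T f x\<bar>}
        \<le> ennreal (4 * W / t) * (\<integral>\<^sup>+x. ennreal (\<bar>f x\<bar>) * indicator {x. t \<le> \<bar>f x\<bar>} x \<partial>lborel)
          + ennreal (4 / t\<^sup>2) * (\<integral>\<^sup>+x. ennreal ((f x)\<^sup>2) * indicator {x. \<bar>f x\<bar> < t} x \<partial>lborel)"
        using T_add T_meas T_L2 weak W f True by (rule marcinkiewicz_distribution)
      have eq: "p * t powr (p - 1) * (4 * W / t) = 4 * W * p * t powr (p - 2)"
        "p * t powr (p - 1) * (4 / t\<^sup>2) = 4 * p * t powr (p - 3)"
      proof -
        have e: "t powr (p - 1) = t powr (p - 2) * t" "t powr (p - 1) = t powr (p - 3) * t\<^sup>2"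
          using True powr_add[of t "p - 2" 1] powr_add[of t "p - 3" 2] by simp_all
        show "p * t powr (p - 1) * (4 * W / t) = 4 * W * p * t powr (p - 2)"
          unfolding e(1) using True by simp
        show "p * t powr (p - 1) * (4 / t\<^sup>2) = 4 * p * t powr (p - 3)"
          unfolding e(2) using True by simp
      qed
      have "ennreal (p * t powr (p - 1)) * indicator {0..} t * emeasure lborel {x. t \<le> \<bar>T f x\<bar>}
        \<le> ennreal (p * t powr (p - 1)) * (ennreal (4 * W / t) * (\<integral>\<^sup>+x. ennreal (\<bar>f x\<bar>) * indicator {x. t \<le> \<bar>f x\<bar>} x \<partial>lborel)
      + ennreal (4 / t\<^sup>2) * (\<integral>\<^sup>+x. ennreal ((f x)\<^sup>2) * indicator {x. \<bar>f x\<bar> < t} x \<partial>lborel))"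
        using True dist by (intro mult_mono) auto
      also have "\<dots> = ennreal (p * t powr (p - 1) * (4 * W / t)) * (\<integral>\<^sup>+x. ennreal (\<bar>f x\<bar>) * indicator {x. t \<le> \<bar>f x\<bar>} x \<partial>lborel)
        + ennreal (p * t powr (p - 1) * (4 / t\<^sup>2)) * (\<integral>\<^sup>+x. ennreal ((f x)\<^sup>2) * indicator {x. \<bar>f x\<bar> < t} x \<partial>lborel)"
      proof -
        have "ennreal a * (ennreal b * X + ennreal c * Y) = ennreal (a * b) * X + ennreal (a * c) * Y"
          if "0 \<le> a" "0 \<le> b" "0 \<le> c" for a b c X Y
          using that by (simp add: ennreal_mult distrib_left mult.assoc)
        then show ?thesis using True p W by simp
      qed
      also have "\<dots> = (\<integral>\<^sup>+x. ennreal (4 * W * p * t powr (p - 2)) * (ennreal (\<bar>f x\<bar>) * indicator {x. t \<le> \<bar>f x\<bar>} x) \<partial>lborel)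
        + (\<integral>\<^sup>+x. ennreal (4 * p * t powr (p - 3)) * (ennreal ((f x)\<^sup>2) * indicator {x. \<bar>f x\<bar> < t} x) \<partial>lborel)"
        unfolding eq by (simp add: nn_integral_cmult)
      also have "\<dots> = (\<integral>\<^sup>+x. k1 x t \<partial>lborel) + (\<integral>\<^sup>+x. k2 x t \<partial>lborel)"
        using True by (intro arg_cong2[where f = "(+)"] nn_integral_cong) (auto simp: k1_def k2_def indicator_def)
      finally show ?thesis .
    next
      case False
      \<comment> \<open>For negative t the indicator vanishes; at t = 0 the convention that
        \<open>0 powr s\<close> is 0 applies.\<close>
      then have z: "ennreal (p * t powr (p - 1)) * indicator {0..} t = 0"
        by (cases "t = 0") auto
      show ?thesis unfolding z by simp
    qed
  qed
  also have "\<dots> = (\<integral>\<^sup>+t. (\<integral>\<^sup>+x. k1 x t \<partial>lborel) \<partial>lborel) + (\<integral>\<^sup>+t. (\<integral>\<^sup>+x. k2 x t \<partial>lborel) \<partial>lborel)"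
    by (intro nn_integral_add) measurable
  also have "\<dots> = (\<integral>\<^sup>+x. (\<integral>\<^sup>+t. k1 x t \<partial>lborel) \<partial>lborel) + (\<integral>\<^sup>+x. (\<integral>\<^sup>+t. k2 x t \<partial>lborel) \<partial>lborel)"
    by (subst (1 2) lborel_pair.Fubini') auto
  also have "\<dots> = (\<integral>\<^sup>+x. (\<integral>\<^sup>+t. k1 x t \<partial>lborel) + (\<integral>\<^sup>+t. k2 x t \<partial>lborel) \<partial>lborel)"
    by (intro nn_integral_add[symmetric]) measurable
  also have "\<dots> \<le> (\<integral>\<^sup>+x. ennreal (4 * W * p / (p - 1) + 4 * p / (2 - p)) * ennreal (\<bar>f x\<bar> powr p) \<partial>lborel)"
  proof (intro nn_integral_mono)
    fix x
    show "(\<integral>\<^sup>+t. k1 x t \<partial>lborel) + (\<integral>\<^sup>+t. k2 x t \<partial>lborel)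
      \<le> ennreal (4 * W * p / (p - 1) + 4 * p / (2 - p)) * ennreal (\<bar>f x\<bar> powr p)"
    proof (cases "f x = 0")
      case True
      then have "k1 x = (\<lambda>_. 0)" "k2 x = (\<lambda>_. 0)" by (auto simp: k1_def k2_def)
      then show ?thesis by simp
    next
      case False
      define y where "y = \<bar>f x\<bar>"
      have y: "y > 0" using False by (simp add: y_def)
      have "(\<integral>\<^sup>+t. k1 x t \<partial>lborel) = (\<integral>\<^sup>+t. ennreal (4 * W * p * y) * (ennreal (t powr (p - 2)) * indicator {0..y} t) \<partial>lborel)"
        using W p y by (intro nn_integral_cong) (auto simp: k1_def y_def indicator_def ennreal_mult[symmetric] mult_ac)
      also have "\<dots> = ennreal (4 * W * p * y) * ennreal (y powr (p - 2 + 1) / (p - 2 + 1))"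
        using nn_integral_powr_atMost[of "p - 2" y] p y by (subst nn_integral_cmult) auto
      also have "\<dots> = ennreal (4 * W * p / (p - 1) * (y * y powr (p - 1)))"
        using W p y by (simp add: ennreal_mult[symmetric] field_simps)
      also have "y * y powr (p - 1) = y powr p"
        using y by (simp add: powr_mult_base)
      finally have 1: "(\<integral>\<^sup>+t. k1 x t \<partial>lborel) = ennreal (4 * W * p / (p - 1) * y powr p)" .
      have "(\<integral>\<^sup>+t. k2 x t \<partial>lborel) \<le> (\<integral>\<^sup>+t. ennreal (4 * p * y\<^sup>2) * (ennreal (t powr (p - 3)) * indicator {y..} t) \<partial>lborel)"
        using p y by (intro nn_integral_mono) (auto simp: k2_def y_def indicator_def ennreal_mult[symmetric] mult_ac)
      also have "\<dots> = ennreal (4 * p * y\<^sup>2) * ennreal (y powr (p - 3 + 1) / - (p - 3 + 1))"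
        using nn_integral_powr_atLeast[of "p - 3" y] p y by (subst nn_integral_cmult) auto
      also have "\<dots> = ennreal (4 * p / (2 - p) * (y\<^sup>2 * y powr (p - 2)))"
        using p y by (simp add: ennreal_mult[symmetric] field_simps)
      also have "y\<^sup>2 * y powr (p - 2) = y powr p"
        using y powr_add[of y 2 "p - 2"] by simp
      finally have 2: "(\<integral>\<^sup>+t. k2 x t \<partial>lborel) \<le> ennreal (4 * p / (2 - p) * y powr p)" .
      have "(\<integral>\<^sup>+t. k1 x t \<partial>lborel) + (\<integral>\<^sup>+t. k2 x t \<partial>lborel)
        \<le> ennreal (4 * W * p / (p - 1) * y powr p) + ennreal (4 * p / (2 - p) * y powr p)"
        using 1 2 by (intro add_mono) auto
      also have "\<dots> = ennreal (4 * W * p / (p - 1) + 4 * p / (2 - p)) * ennreal (y powr p)"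
        using W p y by (simp add: ennreal_plus[symmetric] ennreal_mult[symmetric] distrib_right del: ennreal_plus)
      finally show ?thesis by (simp add: y_def)
    qed
  qed
  also have "\<dots> = ennreal (4 * W * p / (p - 1) + 4 * p / (2 - p)) * (\<integral>\<^sup>+x. ennreal (\<bar>f x\<bar> powr p) \<partial>lborel)"
    by (intro nn_integral_cmult) measurable
  finally show ?thesis .
qed

text \<open>Self-adjointness gives the exponents above 2: \<open>T\<close> is tested against
  \<open>sgn (T f) * \<bar>T f\<bar> powr (p - 1)\<close>, and Young's inequality with a free parameter \<open>\<eta>\<close> replaces
  Hoelder's inequality.\<close>

lemma self_adjoint_duality:
  fixes T :: "(real \<Rightarrow> real) \<Rightarrow> real \<Rightarrow> real"
  assumes T_L2fun: "\<And>f. L2fun f \<Longrightarrow> L2fun (T f)"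
    and T_sym: "\<And>f g. L2fun f \<Longrightarrow> L2fun g \<Longrightarrow> (\<integral>x. T f x * g x \<partial>lborel) = (\<integral>x. f x * T g x \<partial>lborel)"
    and T_bdd: "\<And>f. L2fun f \<Longrightarrow> \<exists>B. \<forall>x. \<bar>T f x\<bar> \<le> B"
    and T_q: "\<And>g. L2fun g \<Longrightarrow> (\<integral>\<^sup>+x. ennreal (\<bar>T g x\<bar> powr q) \<partial>lborel)
      \<le> ennreal D * (\<integral>\<^sup>+x. ennreal (\<bar>g x\<bar> powr q) \<partial>lborel)"
    and D: "D > 0" and p: "p > 2" and q: "1 / p + 1 / q = 1" "q > 1"
    and f: "L2fun f" "integrable lborel (\<lambda>x. \<bar>f x\<bar> powr p)"
  shows "(\<integral>\<^sup>+x. ennreal (\<bar>T f x\<bar> powr p) \<partial>lborel)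
    \<le> ennreal (2 / p * (2 * D / q) powr (p / q) * (\<integral>x. \<bar>f x\<bar> powr p \<partial>lborel))"
proof -
  note [measurable] = f(1) T_L2fun[OF f(1)]
  obtain B where B: "\<And>x. \<bar>T f x\<bar> \<le> B" using T_bdd[OF f(1)] by blast
  have B0: "B \<ge> 0" using B[of 0] by linarith
  have pq: "(p - 1) * q = p" using q p by (simp add: field_simps)
  define g where "g = (\<lambda>x. sgn (T f x) * \<bar>T f x\<bar> powr (p - 1))"
  have gabs: "\<bar>g x\<bar> = \<bar>T f x\<bar> powr (p - 1)" for x
    by (auto simp: g_def abs_mult sgn_if)
  have bound: "\<bar>T f x\<bar> powr (s + r) \<le> B powr s * \<bar>T f x\<bar> powr r" if "s \<ge> 0" for s r x
    using that B[of x] by (simp add: powr_add mult_right_mono powr_mono2)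
  \<comment> \<open>Boundedness of \<open>T f\<close> puts the test function into L2: for p > 2 it
    is dominated by B^(p-2) |T f|.\<close>
  have gL2: "L2fun g"
  proof (rule L2fun_bound)
    show "L2fun (\<lambda>x. B powr (p - 2) * T f x)" by (intro L2fun_cmult T_L2fun f)
    show "g \<in> borel_measurable borel" unfolding g_def by measurable
    show "\<bar>g x\<bar> \<le> \<bar>B powr (p - 2) * T f x\<bar>" for x
      using bound[of "p - 2" x 1] p unfolding gabs by (simp add: abs_mult)
  qed
  note [measurable] = gL2 T_L2fun[OF gL2]
  have Tfg: "T f x * g x = \<bar>T f x\<bar> powr p" for x
  proof -
    have "T f x * g x = \<bar>T f x\<bar> * \<bar>T f x\<bar> powr (p - 1)" by (simp add: g_def abs_sgn mult.assoc mult.left_commute)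
    also have "\<dots> = \<bar>T f x\<bar> powr p" by (simp add: powr_mult_base)
    finally show ?thesis .
  qed
  have gq: "\<bar>g x\<bar> powr q = \<bar>T f x\<bar> powr p" for x
    unfolding gabs by (simp add: powr_powr pq)
  \<comment> \<open>The integral Z of |T f|^p is finite a priori, since the integrand is a product
    of two L2 functions. Without this, Z / 2 could not be absorbed at the end.\<close>
  have Zint: "integrable lborel (\<lambda>x. \<bar>T f x\<bar> powr p)"
    using L2fun_mult_integrable[OF T_L2fun[OF f(1)] gL2] by (simp add: Tfg)
  define Z where "Z = (\<integral>x. \<bar>T f x\<bar> powr p \<partial>lborel)"
  define P where "P = (\<integral>x. \<bar>f x\<bar> powr p \<partial>lborel)"
  have Z0: "Z \<ge> 0" and P0: "P \<ge> 0" by (auto simp: Z_def P_def)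
  have Zn: "(\<integral>\<^sup>+x. ennreal (\<bar>T f x\<bar> powr p) \<partial>lborel) = ennreal Z"
    unfolding Z_def using Zint by (intro nn_integral_eq_integral) auto
  have Tgn: "(\<integral>\<^sup>+x. ennreal (\<bar>T g x\<bar> powr q) \<partial>lborel) \<le> ennreal (D * Z)"
    using T_q[OF gL2] D Z0 by (simp add: gq Zn ennreal_mult)
  have Tgint: "integrable lborel (\<lambda>x. \<bar>T g x\<bar> powr q)"
    using Tgn by (intro integrableI_bounded) (auto simp: le_less_trans)
  have Tg: "(\<integral>x. \<bar>T g x\<bar> powr q \<partial>lborel) \<le> D * Z"
    using Tgn D Z0 by (subst (asm) nn_integral_eq_integral[OF Tgint]) auto
  \<comment> \<open>Chosen so that the Young term with exponent \<open>q\<close> is exactly Z /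
    2.\<close>
  define \<eta> where "\<eta> = (2 * D / q) powr (1 / q)"
  have \<eta>: "\<eta> > 0" using D q by (simp add: \<eta>_def)
  have \<eta>q: "\<eta> powr q = 2 * D / q" using D q by (simp add: \<eta>_def powr_powr)
  have "Z = (\<integral>x. f x * T g x \<partial>lborel)"
    unfolding Z_def Tfg[symmetric] by (rule T_sym[OF f(1) gL2])
  also have "\<dots> \<le> (\<integral>x. \<eta> powr p / p * \<bar>f x\<bar> powr p + (1 / \<eta>) powr q / q * \<bar>T g x\<bar> powr q \<partial>lborel)"
  proof (intro integral_mono Bochner_Integration.integrable_add integrable_mult_right f(2) Tgint
      L2fun_mult_integrable f(1) T_L2fun gL2)
    fix x
    have "f x * T g x \<le> (\<eta> * \<bar>f x\<bar>) * (1 / \<eta> * \<bar>T g x\<bar>)"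
      using \<eta> abs_ge_self[of "f x * T g x"] by (simp add: abs_mult)
    also have "\<dots> \<le> (\<eta> * \<bar>f x\<bar>) powr p / p + (1 / \<eta> * \<bar>T g x\<bar>) powr q / q"
      using p q \<eta> by (intro Youngs_inequality) auto
    also have "\<dots> = \<eta> powr p / p * \<bar>f x\<bar> powr p + (1 / \<eta>) powr q / q * \<bar>T g x\<bar> powr q"
      using \<eta> by (subst (1 2) powr_mult) auto
    finally show "f x * T g x \<le> \<eta> powr p / p * \<bar>f x\<bar> powr p + (1 / \<eta>) powr q / q * \<bar>T g x\<bar> powr q" .
  qed
  also have "\<dots> = \<eta> powr p / p * P + (1 / \<eta>) powr q / q * (\<integral>x. \<bar>T g x\<bar> powr q \<partial>lborel)"
    using f(2) Tgint by (simp add: P_def)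
  also have "\<dots> \<le> \<eta> powr p / p * P + (1 / \<eta>) powr q / q * (D * Z)"
    using Tg q by (intro add_left_mono mult_left_mono) auto
  also have "(1 / \<eta>) powr q / q * (D * Z) = Z / 2"
    using \<eta> \<eta>q D q by (simp add: powr_divide field_simps)
  finally have "Z \<le> 2 / p * \<eta> powr p * P" by (simp add: field_simps)
  also have "\<eta> powr p = (2 * D / q) powr (p / q)" by (simp add: \<eta>_def powr_powr)
  finally show ?thesis unfolding Zn P_def by (rule ennreal_leI)
qed

subsection \<open>Decay of the wavelet kernel\<close>

text \<open>Each distance to \<open>n0\<close> occurs at most twice, once on either side, and on
  each side the distance determines the integer.\<close>

lemma sum_dist_int_le_suminf:
  fixes g :: "nat \<Rightarrow> real"
  assumes "finite S" "summable g" "\<And>n. g n \<ge> 0"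
  shows "(\<Sum>m\<in>S. g (nat \<bar>m - n0\<bar>)) \<le> 2 * suminf g"
proof -
  have half: "(\<Sum>m\<in>S'. g (nat \<bar>m - n0\<bar>)) \<le> suminf g"
    if "finite S'" "inj_on (\<lambda>m. nat \<bar>m - n0\<bar>) S'" for S'
  proof -
    have "(\<Sum>m\<in>S'. g (nat \<bar>m - n0\<bar>)) = sum g ((\<lambda>m. nat \<bar>m - n0\<bar>) ` S')"
      using that(2) by (simp add: sum.reindex)
    also have "\<dots> \<le> suminf g"
      using that(1) assms by (intro sum_le_suminf) auto
    finally show ?thesis .
  qed
  have "S = {m \<in> S. n0 \<le> m} \<union> {m \<in> S. m < n0}" by auto
  then have "(\<Sum>m\<in>S. g (nat \<bar>m - n0\<bar>))
      = (\<Sum>m | m \<in> S \<and> n0 \<le> m. g (nat \<bar>m - n0\<bar>)) + (\<Sum>m | m \<in> S \<and> m < n0. g (nat \<bar>m - n0\<bar>))"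
    using assms(1) by (subst sum.union_disjoint[symmetric]) auto
  also have "\<dots> \<le> suminf g + suminf g"
    using assms(1) by (intro add_mono half) (auto simp: inj_on_def)
  finally show ?thesis by simp
qed

definition weight :: "real \<Rightarrow> real \<Rightarrow> real" where
  "weight s x = (1 + \<bar>x\<bar>) powr (- s)"

lemma weight_nonneg [simp]: "weight s x \<ge> 0"
  by (simp add: weight_def)

lemma weight_measurable [measurable]: "weight s \<in> borel_measurable borel"
  unfolding weight_def by measurable

lemma weight_antimono: "s \<le> r \<Longrightarrow> weight r x \<le> weight s x"
  unfolding weight_def by (intro powr_mono) auto

lemma weight_shift:
  assumes "\<bar>x - y\<bar> \<le> 1" "s \<ge> 0"
  shows "weight s x \<le> 2 powr s * weight s y"
proof -
  have "(1 + \<bar>y\<bar>) \<le> 2 * (1 + \<bar>x\<bar>)" using assms(1) abs_triangle_ineq2[of y x] abs_ge_zero[of x] by (simp add: abs_minus_commute)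
  then have "(2 * (1 + \<bar>x\<bar>)) powr (- s) \<le> (1 + \<bar>y\<bar>) powr (- s)"
    using assms(2) by (intro powr_mono2') auto
  then have "2 powr s * (2 powr (- s) * (1 + \<bar>x\<bar>) powr (- s)) \<le> 2 powr s * (1 + \<bar>y\<bar>) powr (- s)"
    by (intro mult_left_mono) (simp_all only: powr_mult powr_ge_zero)
  then show ?thesis by (simp add: weight_def mult.assoc[symmetric] powr_add[symmetric])
qed

text \<open>Replacing Y by its floor moves the argument by less than 1, which costs
  \<open>2 powr s\<close> and leaves a sum over distances of integers. The bound is therefore
  uniform in Y.\<close>

lemma weight_lattice_sum:
  assumes "s > 1"
  obtains B where "B > 0" "\<And>S Y. finite S \<Longrightarrow> (\<Sum>k\<in>S. weight s (Y - real_of_int k)) \<le> B"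
proof -
  define g where "g n = 2 powr s * real (Suc n) powr (- s)" for n
  have sg: "summable g"
    unfolding g_def using assms summable_Suc_iff[of "\<lambda>n. real n powr (- s)"]
    by (intro summable_mult) (auto simp: summable_real_powr_iff)
  have g0: "g n \<ge> 0" for n by (simp add: g_def)
  show ?thesis
  proof (rule that)
    show "2 * suminf g + 1 > 0" using suminf_nonneg[OF sg g0] by linarith
    fix S :: "int set" and Y :: real assume S: "finite S"
    have "(\<Sum>k\<in>S. weight s (Y - real_of_int k)) \<le> (\<Sum>k\<in>S. g (nat \<bar>k - \<lfloor>Y\<rfloor>\<bar>))"
    proof (intro sum_mono)
      fix k
      have "weight s (Y - real_of_int k) \<le> 2 powr s * weight s (real_of_int (k - \<lfloor>Y\<rfloor>))"
      proof -
        have "weight s (Y - real_of_int k) \<le> 2 powr s * weight s (real_of_int (\<lfloor>Y\<rfloor> - k))"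
          using assms by (intro weight_shift) (simp_all, linarith)
        then show ?thesis by (simp add: weight_def abs_minus_commute)
      qed
      also have "\<dots> = g (nat \<bar>k - \<lfloor>Y\<rfloor>\<bar>)"
        by (simp add: weight_def g_def add.commute)
      finally show "weight s (Y - real_of_int k) \<le> g (nat \<bar>k - \<lfloor>Y\<rfloor>\<bar>)" .
    qed
    also have "\<dots> \<le> 2 * suminf g" by (rule sum_dist_int_le_suminf[OF S sg g0])
    finally show "(\<Sum>k\<in>S. weight s (Y - real_of_int k)) \<le> 2 * suminf g + 1" by simp
  qed
qed

lemma nn_integral_weight:
  assumes "s > 1"
  shows "(\<integral>\<^sup>+x. ennreal (weight s x) \<partial>lborel) \<le> ennreal (2 / (s - 1))"
proof -
  define f where "f t = ennreal (t powr (- s)) * indicator {1..} t" for t :: real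
  have [measurable]: "f \<in> borel_measurable borel" unfolding f_def by measurable
  have f: "(\<integral>\<^sup>+t. f t \<partial>lborel) = ennreal (1 / (s - 1))"
    unfolding f_def using assms nn_integral_powr_atLeast[of "- s" 1] by simp
  have "(\<integral>\<^sup>+x. ennreal (weight s x) \<partial>lborel) \<le> (\<integral>\<^sup>+x. f (1 + x) + f (1 - x) \<partial>lborel)"
  proof (intro nn_integral_mono)
    show "ennreal (weight s x) \<le> f (1 + x) + f (1 - x)" for x
      by (cases "x \<ge> 0") (auto simp: f_def weight_def indicator_def)
  qed
  also have "\<dots> = (\<integral>\<^sup>+x. f (1 + x) \<partial>lborel) + (\<integral>\<^sup>+x. f (1 - x) \<partial>lborel)"
    by (intro nn_integral_add) measurable
  also have "\<dots> = ennreal (1 / (s - 1)) + ennreal (1 / (s - 1))"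
    using nn_integral_real_affine[of f 1 1] nn_integral_real_affine[of f "-1" 1] f by simp
  also have "\<dots> = ennreal (2 / (s - 1))"
    using assms by (simp add: ennreal_plus[symmetric] del: ennreal_plus)
  finally show ?thesis .
qed

text \<open>The argument is the length of the atom's interval measured in units of the wavelet's
  scale. For a wavelet wide compared with the interval smoothness gives a linear gain, for a narrow
  one decay gives the power -e; the profile is summable over dyadic scales.\<close>

definition scale_decay :: "real \<Rightarrow> real \<Rightarrow> real" where
  "scale_decay e d = (if d \<le> 1 then d else d powr (- e))"

text \<open>The terms decay geometrically on both sides of the critical scale where 2^j h is
  comparable to 1. A change of \<open>h\<close> only moves that scale, hence the uniformity.\<close>

lemma scale_decay_sum:
  assumes "e > 0"
  obtains M where "M > 0" "\<And>S h. finite S \<Longrightarrow> h > 0 \<Longrightarrow> (\<Sum>j\<in>S. scale_decay e (2 powr real_of_int j * h)) \<le> M"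
proof -
  define g where "g n = (1 / 2) ^ n + 2 powr e * (2 powr (- e)) ^ n" for n :: nat
  have "2 powr (- e) < 1" using assms powr_less_mono[of "- e" 0 2] by simp
  then have sg: "summable g"
    unfolding g_def by (intro summable_add summable_mult summable_geometric) auto
  have g0: "g n \<ge> 0" for n by (simp add: g_def)
  show ?thesis
  proof (rule that)
    show "2 * suminf g + 1 > 0" using suminf_nonneg[OF sg g0] by linarith
    fix S :: "int set" and h :: real assume S: "finite S" and h: "h > 0"
    \<comment> \<open>The critical scale rounded down; the rounding loses at most one step for j >
      j0, which is the factor \<open>2 powr e\<close> in \<open>g\<close>.\<close>
    define j0 where "j0 = \<lfloor>- log 2 h\<rfloor>"
    have hlog: "h = 2 powr (log 2 h)" using h by simp
    have "(\<Sum>j\<in>S. scale_decay e (2 powr real_of_int j * h)) \<le> (\<Sum>j\<in>S. g (nat \<bar>j - j0\<bar>))"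
    proof (intro sum_mono)
      fix j
      have eq: "2 powr real_of_int j * h = 2 powr (real_of_int j + log 2 h)"
        using h by (simp add: powr_add)
      show "scale_decay e (2 powr real_of_int j * h) \<le> g (nat \<bar>j - j0\<bar>)"
      proof (cases "j \<le> j0")
        case True
        then have le: "real_of_int j + log 2 h \<le> real_of_int j - real_of_int j0" "real_of_int j + log 2 h \<le> 0"
          unfolding j0_def by linarith+
        have "2 powr (real_of_int j + log 2 h) \<le> 2 powr (real_of_int j - real_of_int j0)"
          using le by (intro powr_mono) auto
        also have "\<dots> = 2 powr (- real (nat \<bar>j - j0\<bar>))" using True by simp
        also have "\<dots> = (1 / 2) ^ nat \<bar>j - j0\<bar>" by (simp only: powr_minus powr_realpow zero_less_numeral power_one_over inverse_eq_divide)
        finally have 1: "2 powr (real_of_int j + log 2 h) \<le> (1 / 2) ^ nat \<bar>j - j0\<bar>" .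
        have "2 powr (real_of_int j + log 2 h) \<le> 2 powr 0" using le by (intro powr_mono) auto
        then have "scale_decay e (2 powr real_of_int j * h) = 2 powr (real_of_int j + log 2 h)"
          by (simp add: scale_decay_def eq)
        also have "\<dots> \<le> g (nat \<bar>j - j0\<bar>)" unfolding g_def using 1 by (intro add_increasing2) auto
        finally show ?thesis .
      next
        case False
        then have "real_of_int j \<ge> real_of_int j0 + 1" by linarith
        then have le: "real_of_int j + log 2 h \<ge> real_of_int j - real_of_int j0 - 1" "real_of_int j + log 2 h > 0"
          unfolding j0_def by linarith+
        have "2 powr (real_of_int j + log 2 h) > 2 powr 0" using le by (intro powr_less_mono) auto
        then have "scale_decay e (2 powr real_of_int j * h) = 2 powr (- e * (real_of_int j + log 2 h))"
          unfolding scale_decay_def eq by (simp add: powr_powr mult.commute)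
        also have "\<dots> \<le> 2 powr (- e * (real_of_int j - real_of_int j0 - 1))"
          using le assms by (intro powr_mono) auto
        also have "\<dots> = 2 powr (e + (- e) * real (nat \<bar>j - j0\<bar>))" using False by (simp add: algebra_simps)
        also have "\<dots> = 2 powr e * (2 powr (- e)) ^ nat \<bar>j - j0\<bar>"
          by (simp only: powr_add powr_powr[symmetric] powr_realpow powr_gt_zero zero_less_numeral)
        also have "\<dots> \<le> g (nat \<bar>j - j0\<bar>)" by (simp add: g_def)
        finally show ?thesis .
      qed
    qed
    also have "\<dots> \<le> 2 * suminf g" by (rule sum_dist_int_le_suminf[OF S sg g0])
    finally show "(\<Sum>j\<in>S. scale_decay e (2 powr real_of_int j * h)) \<le> 2 * suminf g + 1" by simp
  qed
qed

text \<open>The two cases are the small and the large scales relative to the interval carrying the atom: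
  the mean value theorem gives the factor \<open>\<delta>\<close>, and for \<open>\<delta> > 1\<close> one of the two arguments of the
  product is at distance at least \<open>\<delta> / 2\<close> from the origin.\<close>

lemma wavelet_kernel_term:
  fixes \<psi> \<psi>' :: "real \<Rightarrow> real"
  assumes deriv: "\<And>x. (\<psi> has_real_derivative \<psi>' x) (at x)"
    and decay: "\<And>x. \<bar>\<psi> x\<bar> + \<bar>\<psi>' x\<bar> \<le> C * weight (1 + 2 * e) x"
    and C: "C > 0" and e: "e > 0" and YZ: "\<bar>Y - Z\<bar> \<le> \<delta> / 2" and d: "\<delta> > 0"
  shows "ennreal \<bar>\<psi> (Y - k) - \<psi> (Z - k)\<bar> * (\<integral>\<^sup>+z. ennreal \<bar>\<psi> z\<bar> * indicator {z. 3 / 2 * \<delta> < \<bar>z + k - Z\<bar>} z \<partial>lborel)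
    \<le> ennreal (C\<^sup>2 * 2 powr (1 + e) * (2 / e) * scale_decay e \<delta> * (weight (1 + e) (Y - k) + weight (1 + e) (Z - k)))"
proof -
  have cont: "continuous_on UNIV \<psi>"
    using deriv by (intro continuous_at_imp_continuous_on) (auto intro: DERIV_isCont)
  have [measurable]: "\<psi> \<in> borel_measurable borel" using cont by (rule borel_measurable_continuous_onI)
  \<comment> \<open>The factor of exponent 1 + e is kept for the later sum over k and for the
    integral over z; the factor of exponent e supplies the gain when \<open>\<delta>\<close> >
    1.\<close>
  have w_split: "weight (1 + 2 * e) x = weight (1 + e) x * (1 + \<bar>x\<bar>) powr (- e)" for x
    by (simp add: weight_def powr_add[symmetric] algebra_simps)
  have \<psi>le: "\<bar>\<psi> x\<bar> \<le> C * weight (1 + 2 * e) x" "\<bar>\<psi>' x\<bar> \<le> C * weight (1 + 2 * e) x" for x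
    using decay[of x] by linarith+
  have w_le: "weight (1 + 2 * e) x \<le> weight (1 + e) x" for x
    using e by (intro weight_antimono) auto
  have \<psi>le': "\<bar>\<psi> x\<bar> \<le> C * weight (1 + e) x" "\<bar>\<psi>' x\<bar> \<le> C * weight (1 + e) x" for x
    using \<psi>le[of x] mult_left_mono[OF w_le[of x], of C] C by linarith+
  have J: "(\<integral>\<^sup>+x. ennreal (weight (1 + e) x) \<partial>lborel) \<le> ennreal (2 / e)"
    using nn_integral_weight[of "1 + e"] e by simp
  show ?thesis
  proof (cases "\<delta> \<le> 1")
    case True
    have small: "\<bar>\<psi> (Y - k) - \<psi> (Z - k)\<bar> \<le> C * \<delta> * 2 powr (1 + e) * weight (1 + e) (Z - k)"
    proof (cases "Y = Z")
      case False
      have "\<exists>\<xi>. \<bar>\<xi> - Z\<bar> \<le> \<bar>Y - Z\<bar> \<and> \<bar>\<psi> (Y - k) - \<psi> (Z - k)\<bar> = \<bar>Y - Z\<bar> * \<bar>\<psi>' (\<xi> - k)\<bar>"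
      proof (cases "Y < Z")
        case True
        then obtain z where "Y - k < z" "z < Z - k" "\<psi> (Z - k) - \<psi> (Y - k) = (Z - k - (Y - k)) * \<psi>' z"
          using MVT2[of "Y - k" "Z - k" \<psi> \<psi>'] deriv by auto
        then show ?thesis
          by (intro exI[of _ "z + k"], subst abs_minus_commute[of "\<psi> (Y - k)"]) (auto simp: abs_mult)
      next
        case False
        then have "Z < Y" using \<open>Y \<noteq> Z\<close> by simp
        then obtain z where "Z - k < z" "z < Y - k" "\<psi> (Y - k) - \<psi> (Z - k) = (Y - k - (Z - k)) * \<psi>' z"
          using MVT2[of "Z - k" "Y - k" \<psi> \<psi>'] deriv by auto
        then show ?thesis by (intro exI[of _ "z + k"]) (auto simp: abs_mult)
      qed
      then obtain \<xi> where \<xi>: "\<bar>\<xi> - Z\<bar> \<le> \<bar>Y - Z\<bar>" "\<bar>\<psi> (Y - k) - \<psi> (Z - k)\<bar> = \<bar>Y - Z\<bar> * \<bar>\<psi>' (\<xi> - k)\<bar>" by blast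
      have "weight (1 + e) (\<xi> - k) \<le> 2 powr (1 + e) * weight (1 + e) (Z - k)"
        using \<xi>(1) YZ True e by (intro weight_shift) auto
      then have "\<bar>\<psi>' (\<xi> - k)\<bar> \<le> C * (2 powr (1 + e) * weight (1 + e) (Z - k))"
        using \<psi>le'(2)[of "\<xi> - k"] C by (meson mult_left_mono less_imp_le order_trans)
      then have "\<bar>\<psi> (Y - k) - \<psi> (Z - k)\<bar> \<le> \<delta> * (C * (2 powr (1 + e) * weight (1 + e) (Z - k)))"
        unfolding \<xi>(2) using YZ d by (intro mult_mono) auto
      then show ?thesis by (simp add: mult_ac)
    qed (use C d in simp)
    have "(\<integral>\<^sup>+z. ennreal \<bar>\<psi> z\<bar> * indicator {z. 3 / 2 * \<delta> < \<bar>z + k - Z\<bar>} z \<partial>lborel)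
       \<le> (\<integral>\<^sup>+z. ennreal C * ennreal (weight (1 + e) z) \<partial>lborel)"
      using \<psi>le'(1) C by (intro nn_integral_mono) (auto simp: indicator_def ennreal_mult[symmetric] intro!: ennreal_leI)
    also have "\<dots> \<le> ennreal C * ennreal (2 / e)"
      using J by (subst nn_integral_cmult) (auto intro: mult_left_mono)
    finally have "ennreal \<bar>\<psi> (Y - k) - \<psi> (Z - k)\<bar> * (\<integral>\<^sup>+z. ennreal \<bar>\<psi> z\<bar> * indicator {z. 3 / 2 * \<delta> < \<bar>z + k - Z\<bar>} z \<partial>lborel)
      \<le> ennreal (C * \<delta> * 2 powr (1 + e) * weight (1 + e) (Z - k)) * (ennreal C * ennreal (2 / e))"
      using small by (intro mult_mono ennreal_leI) auto
    also have "\<dots> = ennreal (C\<^sup>2 * 2 powr (1 + e) * (2 / e) * \<delta> * weight (1 + e) (Z - k))"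
      using C e d by (simp add: ennreal_mult[symmetric] power2_eq_square mult_ac)
    also have "\<dots> \<le> ennreal (C\<^sup>2 * 2 powr (1 + e) * (2 / e) * \<delta> * (weight (1 + e) (Y - k) + weight (1 + e) (Z - k)))"
      using C e d by (intro ennreal_leI mult_left_mono) auto
    finally show ?thesis using True by (simp add: scale_decay_def)
  next
    case False
    define q where "q = (1 + \<delta> / 2) powr (- e)"
    define S where "S = weight (1 + e) (Y - k) + weight (1 + e) (Z - k)"
    have far: "(1 + \<bar>x\<bar>) powr (- e) \<le> q" if "\<delta> / 2 \<le> \<bar>x\<bar>" for x
      unfolding q_def using that d e by (intro powr_mono2') auto
    have le1: "(1 + \<bar>x\<bar>) powr (- e) \<le> 1" for x
      using powr_mono[of "- e" 0 "1 + \<bar>x\<bar>"] e by (simp add: abs_if split: if_splits)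
    have pair: "weight (1 + 2 * e) x * weight (1 + 2 * e) z \<le> q * weight (1 + e) x * weight (1 + e) z"
      if "\<delta> / 2 \<le> \<bar>x\<bar> \<or> \<delta> / 2 \<le> \<bar>z\<bar>" for x z
    proof -
      have q0: "q \<ge> 0" by (simp add: q_def)
      have "(1 + \<bar>x\<bar>) powr (- e) * (1 + \<bar>z\<bar>) powr (- e) \<le> q"
        using that
      proof
        assume "\<delta> / 2 \<le> \<bar>x\<bar>"
        then show ?thesis using mult_mono[OF far le1[of z]] q0 by fastforce
      next
        assume "\<delta> / 2 \<le> \<bar>z\<bar>"
        then show ?thesis using mult_mono[OF le1[of x] far] by fastforce
      qed
      then have "weight (1 + e) x * weight (1 + e) z * ((1 + \<bar>x\<bar>) powr (- e) * (1 + \<bar>z\<bar>) powr (- e))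
        \<le> weight (1 + e) x * weight (1 + e) z * q" by (intro mult_left_mono) auto
      then show ?thesis unfolding w_split by (simp only: mult_ac)
    qed
    have "ennreal \<bar>\<psi> (Y - k) - \<psi> (Z - k)\<bar> * (\<integral>\<^sup>+z. ennreal \<bar>\<psi> z\<bar> * indicator {z. 3 / 2 * \<delta> < \<bar>z + k - Z\<bar>} z \<partial>lborel)
      = (\<integral>\<^sup>+z. ennreal \<bar>\<psi> (Y - k) - \<psi> (Z - k)\<bar> * (ennreal \<bar>\<psi> z\<bar> * indicator {z. 3 / 2 * \<delta> < \<bar>z + k - Z\<bar>} z) \<partial>lborel)"
      by (subst nn_integral_cmult) auto
    also have "\<dots> \<le> (\<integral>\<^sup>+z. ennreal (C\<^sup>2 * q * S) * ennreal (weight (1 + e) z) \<partial>lborel)"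
    proof (intro nn_integral_mono)
      fix z
      show "ennreal \<bar>\<psi> (Y - k) - \<psi> (Z - k)\<bar> * (ennreal \<bar>\<psi> z\<bar> * indicator {z. 3 / 2 * \<delta> < \<bar>z + k - Z\<bar>} z)
        \<le> ennreal (C\<^sup>2 * q * S) * ennreal (weight (1 + e) z)"
      proof (cases "3 / 2 * \<delta> < \<bar>z + k - Z\<bar>")
        case True
        \<comment> \<open>If |Y - k| and |z| were both below \<delta> / 2, then |z + k - Z| would be
          below 3/2 \<delta>, by |Y - Z| \<le> \<delta> / 2. The case of Z is similar.\<close>
        then have cond: "\<delta> / 2 \<le> \<bar>Y - k\<bar> \<or> \<delta> / 2 \<le> \<bar>z\<bar>" "\<delta> / 2 \<le> \<bar>Z - k\<bar> \<or> \<delta> / 2 \<le> \<bar>z\<bar>"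
          using YZ by linarith+
        have "\<bar>\<psi> (Y - k) - \<psi> (Z - k)\<bar> * \<bar>\<psi> z\<bar>
          \<le> (C * weight (1 + 2 * e) (Y - k) + C * weight (1 + 2 * e) (Z - k)) * (C * weight (1 + 2 * e) z)"
          using \<psi>le(1)[of "Y - k"] \<psi>le(1)[of "Z - k"] \<psi>le(1)[of z] by (intro mult_mono) auto
        also have "\<dots> = C\<^sup>2 * (weight (1 + 2 * e) (Y - k) * weight (1 + 2 * e) z
             + weight (1 + 2 * e) (Z - k) * weight (1 + 2 * e) z)"
          by (simp add: power2_eq_square algebra_simps)
        also have "\<dots> \<le> C\<^sup>2 * (q * weight (1 + e) (Y - k) * weight (1 + e) z + q * weight (1 + e) (Z - k) * weight (1 + e) z)"
          using pair[OF cond(1)] pair[OF cond(2)] by (intro mult_left_mono add_mono) auto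
        also have "\<dots> = C\<^sup>2 * q * S * weight (1 + e) z" by (simp add: S_def algebra_simps)
        finally have "\<bar>\<psi> (Y - k) - \<psi> (Z - k)\<bar> * \<bar>\<psi> z\<bar> \<le> C\<^sup>2 * q * S * weight (1 + e) z" .
        then show ?thesis using True by (simp add: ennreal_mult'[symmetric] ennreal_mult''[symmetric] ennreal_leI)
      qed simp
    qed
    also have "\<dots> \<le> ennreal (C\<^sup>2 * q * S) * ennreal (2 / e)"
      using J by (subst nn_integral_cmult) (auto intro: mult_left_mono)
    also have "\<dots> = ennreal (C\<^sup>2 * q * S * (2 / e))" using e by (simp add: ennreal_mult''[symmetric])
    also have "\<dots> \<le> ennreal (C\<^sup>2 * 2 powr (1 + e) * (2 / e) * scale_decay e \<delta> * S)"
    proof (intro ennreal_leI)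
      have "q \<le> (\<delta> / 2) powr (- e)" unfolding q_def using d e by (intro powr_mono2') auto
      also have "\<dots> = 2 powr e * \<delta> powr (- e)" using d by (simp add: powr_divide powr_minus field_simps)
      also have "\<dots> \<le> 2 powr (1 + e) * scale_decay e \<delta>" using False by (auto simp: scale_decay_def intro!: mult_right_mono powr_mono)
      finally have "C\<^sup>2 * (2 / e) * S * q \<le> C\<^sup>2 * (2 / e) * S * (2 powr (1 + e) * scale_decay e \<delta>)"
        using e by (intro mult_left_mono) (auto simp: S_def)
      then show "C\<^sup>2 * q * S * (2 / e) \<le> C\<^sup>2 * 2 powr (1 + e) * (2 / e) * scale_decay e \<delta> * S"
        by (simp only: mult_ac)
    qed
    finally show ?thesis by (simp add: S_def)
  qed
qed
subsection \<open>Signed orthonormal expansions\<close>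

lemma L2fun_sum:
  assumes "finite F" "\<And>i. i \<in> F \<Longrightarrow> L2fun (g i)"
  shows "L2fun (\<lambda>x. \<Sum>i\<in>F. g i x)"
  using assms by (induction F rule: finite_induct) (auto intro: L2fun_add)

definition signed_sum ::
  "('i \<Rightarrow> real \<Rightarrow> real) \<Rightarrow> 'i set \<Rightarrow> ('i \<Rightarrow> real) \<Rightarrow> (real \<Rightarrow> real) \<Rightarrow> real \<Rightarrow> real" where
  "signed_sum \<phi> F s f x = (\<Sum>i\<in>F. s i * (\<integral>y. f y * \<phi> i y \<partial>lborel) * \<phi> i x)"

locale orthonormal_family =
  fixes \<phi> :: "'i \<Rightarrow> real \<Rightarrow> real" and F :: "'i set"
  assumes fin: "finite F"
    and L2: "i \<in> F \<Longrightarrow> L2fun (\<phi> i)"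
    and orth: "i \<in> F \<Longrightarrow> j \<in> F \<Longrightarrow> (\<integral>x. \<phi> i x * \<phi> j x \<partial>lborel) = (if i = j then 1 else 0)"
begin

lemma combination_L2fun: "L2fun (\<lambda>x. \<Sum>i\<in>F. d i * \<phi> i x)"
  by (intro L2fun_sum L2fun_cmult L2 fin)

lemma integral_mult_combination:
  assumes "L2fun f"
  shows "(\<integral>x. f x * (\<Sum>i\<in>F. d i * \<phi> i x) \<partial>lborel) = (\<Sum>i\<in>F. d i * (\<integral>x. f x * \<phi> i x \<partial>lborel))"
proof -
  have "(\<integral>x. f x * (\<Sum>i\<in>F. d i * \<phi> i x) \<partial>lborel) = (\<integral>x. (\<Sum>i\<in>F. d i * (f x * \<phi> i x)) \<partial>lborel)"
    by (simp add: sum_distrib_left mult_ac)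
  also have "\<dots> = (\<Sum>i\<in>F. \<integral>x. d i * (f x * \<phi> i x) \<partial>lborel)"
    by (intro Bochner_Integration.integral_sum integrable_mult_right L2fun_mult_integrable assms L2)
  finally show ?thesis by simp
qed

lemma integral_combination_sq: "(\<integral>x. (\<Sum>i\<in>F. d i * \<phi> i x)\<^sup>2 \<partial>lborel) = (\<Sum>i\<in>F. (d i)\<^sup>2)"
proof -
  have "(\<integral>x. (\<Sum>i\<in>F. d i * \<phi> i x)\<^sup>2 \<partial>lborel)
      = (\<Sum>i\<in>F. d i * (\<integral>x. (\<Sum>i\<in>F. d i * \<phi> i x) * \<phi> i x \<partial>lborel))"
    unfolding power2_eq_square by (rule integral_mult_combination[OF combination_L2fun])
  also have "\<dots> = (\<Sum>i\<in>F. d i * (\<Sum>j\<in>F. d j * (\<integral>x. \<phi> i x * \<phi> j x \<partial>lborel)))"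
    using integral_mult_combination[OF L2] by (simp add: mult.commute)
  also have "\<dots> = (\<Sum>i\<in>F. (d i)\<^sup>2)"
    using fin by (intro sum.cong) (simp_all add: orth power2_eq_square if_distrib cong: if_cong)
  finally show ?thesis .
qed

text \<open>Expansion of the nonnegative integral of (f - g)^2, with \<open>g\<close> the orthogonal
  projection of \<open>f\<close> onto the span of the family.\<close>

lemma bessel:
  assumes "L2fun f"
  shows "(\<Sum>i\<in>F. (\<integral>x. f x * \<phi> i x \<partial>lborel)\<^sup>2) \<le> (\<integral>x. (f x)\<^sup>2 \<partial>lborel)"
proof -
  define c where "c i = (\<integral>x. f x * \<phi> i x \<partial>lborel)" for i
  define g where "g x = (\<Sum>i\<in>F. c i * \<phi> i x)" for x
  have g: "L2fun g" unfolding g_def by (rule combination_L2fun)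
  have "0 \<le> (\<integral>x. (f x)\<^sup>2 - 2 * (f x * g x) + (g x)\<^sup>2 \<partial>lborel)"
  proof (rule integral_nonneg_AE, rule AE_I2)
    fix x
    have "0 \<le> (f x - g x)\<^sup>2" by simp
    then show "0 \<le> (f x)\<^sup>2 - 2 * (f x * g x) + (g x)\<^sup>2" by (simp add: power2_diff)
  qed
  also have "\<dots> = (\<integral>x. (f x)\<^sup>2 \<partial>lborel) - 2 * (\<integral>x. f x * g x \<partial>lborel) + (\<integral>x. (g x)\<^sup>2 \<partial>lborel)"
    using assms g L2fun_mult_integrable[OF assms g] by (simp add: L2fun_def)
  also have "(\<integral>x. f x * g x \<partial>lborel) = (\<Sum>i\<in>F. (c i)\<^sup>2)"
    unfolding g_def integral_mult_combination[OF assms] c_def power2_eq_square ..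
  also have "(\<integral>x. (g x)\<^sup>2 \<partial>lborel) = (\<Sum>i\<in>F. (c i)\<^sup>2)"
    unfolding g_def by (rule integral_combination_sq)
  finally show ?thesis by (simp add: c_def)
qed

lemma signed_sum_L2fun: "L2fun (signed_sum \<phi> F s f)"
  unfolding signed_sum_def using combination_L2fun[of "\<lambda>i. s i * (\<integral>y. f y * \<phi> i y \<partial>lborel)"] .

lemma signed_sum_add:
  assumes "L2fun f" "L2fun g"
  shows "signed_sum \<phi> F s (\<lambda>x. f x + g x) y = signed_sum \<phi> F s f y + signed_sum \<phi> F s g y"
  unfolding signed_sum_def sum.distrib[symmetric]
  by (intro sum.cong)
     (auto simp: L2 assms L2fun_mult_integrable distrib_right distrib_left)

text \<open>Orthonormality turns the squared norm of the output into a sum of squared coefficients;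
  the multipliers are at most 1 in modulus, and Bessel's inequality remains.\<close>

lemma signed_sum_contraction:
  assumes "L2fun f" "\<And>i. \<bar>s i\<bar> \<le> 1"
  shows "(\<integral>\<^sup>+x. ennreal ((signed_sum \<phi> F s f x)\<^sup>2) \<partial>lborel) \<le> ennreal (\<integral>x. (f x)\<^sup>2 \<partial>lborel)"
proof -
  have "(\<integral>\<^sup>+x. ennreal ((signed_sum \<phi> F s f x)\<^sup>2) \<partial>lborel) = ennreal (\<integral>x. (signed_sum \<phi> F s f x)\<^sup>2 \<partial>lborel)"
    using signed_sum_L2fun[of s f] by (intro nn_integral_eq_integral) (auto simp: L2fun_def)
  also have "(\<integral>x. (signed_sum \<phi> F s f x)\<^sup>2 \<partial>lborel) = (\<Sum>i\<in>F. (s i * (\<integral>y. f y * \<phi> i y \<partial>lborel))\<^sup>2)"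
    unfolding signed_sum_def by (rule integral_combination_sq)
  also have "\<dots> \<le> (\<Sum>i\<in>F. (\<integral>y. f y * \<phi> i y \<partial>lborel)\<^sup>2)"
  proof (intro sum_mono)
    fix i
    have "(s i)\<^sup>2 \<le> 1" using assms(2)[of i] by (simp add: abs_square_le_1)
    then show "(s i * (\<integral>y. f y * \<phi> i y \<partial>lborel))\<^sup>2 \<le> (\<integral>y. f y * \<phi> i y \<partial>lborel)\<^sup>2"
      by (simp add: power_mult_distrib mult_left_le_one_le)
  qed
  also have "\<dots> \<le> (\<integral>x. (f x)\<^sup>2 \<partial>lborel)" by (rule bessel[OF assms(1)])
  finally show ?thesis by (simp add: ennreal_leI)
qed

lemma signed_sum_symmetric:
  assumes "L2fun f" "L2fun g"
  shows "(\<integral>x. signed_sum \<phi> F s f x * g x \<partial>lborel) = (\<integral>x. f x * signed_sum \<phi> F s g x \<partial>lborel)"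
proof -
  have "(\<integral>x. signed_sum \<phi> F s f x * g x \<partial>lborel) = (\<integral>x. g x * signed_sum \<phi> F s f x \<partial>lborel)"
    by (simp add: mult.commute)
  then show ?thesis
    unfolding signed_sum_def integral_mult_combination[OF assms(1)] integral_mult_combination[OF assms(2)]
    by (simp add: mult_ac)
qed

lemma signed_sum_bounded:
  assumes "\<And>i x. i \<in> F \<Longrightarrow> \<bar>\<phi> i x\<bar> \<le> B i"
  shows "\<exists>M. \<forall>x. \<bar>signed_sum \<phi> F s f x\<bar> \<le> M"
proof (intro exI allI)
  fix x
  have "\<bar>signed_sum \<phi> F s f x\<bar> \<le> (\<Sum>i\<in>F. \<bar>s i * (\<integral>y. f y * \<phi> i y \<partial>lborel) * \<phi> i x\<bar>)"
    unfolding signed_sum_def by (rule sum_abs)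
  also have "\<dots> \<le> (\<Sum>i\<in>F. \<bar>s i * (\<integral>y. f y * \<phi> i y \<partial>lborel)\<bar> * B i)"
    unfolding abs_mult by (intro sum_mono mult_left_mono assms) auto
  finally show "\<bar>signed_sum \<phi> F s f x\<bar> \<le> (\<Sum>i\<in>F. \<bar>s i * (\<integral>y. f y * \<phi> i y \<partial>lborel)\<bar> * B i)" .
qed

text \<open>The hypothesis \<open>kernel\<close> is Hoermander's condition with absolute values
  inside the sum, so it does not see \<open>s\<close>. Mean zero of an atom allows each coefficient
  to be computed with the oscillation of \<open>\<phi> i\<close> in place of
  \<open>\<phi> i\<close>.\<close>

lemma cz_operator_signed_sum:
  assumes s: "\<And>i. \<bar>s i\<bar> \<le> 1" and A: "A \<ge> 0"
    and bound: "\<And>i x. i \<in> F \<Longrightarrow> \<bar>\<phi> i x\<bar> \<le> B i"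
    and lip: "\<And>i x y. i \<in> F \<Longrightarrow> \<bar>\<phi> i x - \<phi> i y\<bar> \<le> L i * \<bar>x - y\<bar>"
    and kernel: "\<And>u v y. u < v \<Longrightarrow> y \<in> {u..<v} \<Longrightarrow>
      (\<Sum>i\<in>F. ennreal \<bar>\<phi> i y - \<phi> i ((u + v) / 2)\<bar>
        * (\<integral>\<^sup>+x. ennreal \<bar>\<phi> i x\<bar> * indicator (- {2 * u - v..2 * v - u}) x \<partial>lborel)) \<le> ennreal A"
  shows "\<exists>K. cz_operator (signed_sum \<phi> F s) A K"
proof -
  define c where "c f i = (\<integral>y. f y * \<phi> i y \<partial>lborel)" for f i
  \<comment> \<open>One constant serves two purposes: B i + |L i| bounds the coefficient both for
    integrable functions (through B i) and for atoms (through L i), and the second factor B i bounds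
    the value of \<open>\<phi> i\<close>.\<close>
  define K where "K = (\<Sum>i\<in>F. (B i + \<bar>L i\<bar>) * B i)"
  have B0: "B i \<ge> 0" if "i \<in> F" for i using bound[OF that, of 0] by linarith
  have sum_le: "\<bar>signed_sum \<phi> F s f x\<bar> \<le> (\<Sum>i\<in>F. \<bar>c f i\<bar> * \<bar>\<phi> i x\<bar>)" for f x
  proof -
    have "\<bar>signed_sum \<phi> F s f x\<bar> \<le> (\<Sum>i\<in>F. \<bar>s i * c f i * \<phi> i x\<bar>)"
      unfolding signed_sum_def c_def by (rule sum_abs)
    also have "\<dots> \<le> (\<Sum>i\<in>F. \<bar>c f i\<bar> * \<bar>\<phi> i x\<bar>)"
      unfolding abs_mult using s by (intro sum_mono mult_right_mono) (auto simp: mult_left_le_one_le)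
    finally show ?thesis .
  qed
  have small: "\<bar>signed_sum \<phi> F s f x\<bar> \<le> K * m"
    if "m \<ge> 0" "\<And>i. i \<in> F \<Longrightarrow> \<bar>c f i\<bar> \<le> (B i + \<bar>L i\<bar>) * m" for f x m
  proof -
    have "\<bar>signed_sum \<phi> F s f x\<bar> \<le> (\<Sum>i\<in>F. \<bar>c f i\<bar> * \<bar>\<phi> i x\<bar>)" by (rule sum_le)
    also have "\<dots> \<le> (\<Sum>i\<in>F. ((B i + \<bar>L i\<bar>) * m) * B i)"
      using that bound B0 by (intro sum_mono mult_mono) auto
    also have "\<dots> = K * m" unfolding K_def sum_distrib_right by (simp only: mult_ac)
    finally show ?thesis .
  qed
  have center: "c b i = (\<integral>y. b y * (\<phi> i y - \<phi> i z) \<partial>lborel)" if "atom u v b" "i \<in> F" for u v b i z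
  proof -
    have "(\<integral>y. b y * (\<phi> i y - \<phi> i z) \<partial>lborel) = (\<integral>y. b y * \<phi> i y - b y * \<phi> i z \<partial>lborel)"
      by (simp add: right_diff_distrib)
    also have "\<dots> = (\<integral>y. b y * \<phi> i y \<partial>lborel) - (\<integral>y. b y * \<phi> i z \<partial>lborel)"
      using that L2 by (intro Bochner_Integration.integral_diff) (auto simp: atom_def intro: L2fun_mult_integrable)
    finally show ?thesis using that by (simp add: c_def atom_def)
  qed
  have "cz_operator (signed_sum \<phi> F s) A K"
  proof
    show "A \<ge> 0" by fact
    show "K \<ge> 0" unfolding K_def using B0 by (intro sum_nonneg) auto
    show "signed_sum \<phi> F s (\<lambda>x. f x + g x) y = signed_sum \<phi> F s f y + signed_sum \<phi> F s g y"
      if "L2fun f" "L2fun g" for f g y using that by (rule signed_sum_add)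
    show "signed_sum \<phi> F s f \<in> borel_measurable borel" for f
      using signed_sum_L2fun by (rule L2fun_measurable)
    show "(\<integral>\<^sup>+x. ennreal ((signed_sum \<phi> F s f x)\<^sup>2) \<partial>lborel) \<le> ennreal (\<integral>x. (f x)\<^sup>2 \<partial>lborel)"
      if "L2fun f" for f using that s by (rule signed_sum_contraction)
    show "\<bar>signed_sum \<phi> F s f x\<bar> \<le> K * (\<integral>y. \<bar>f y\<bar> \<partial>lborel)" if f: "L2fun f" "integrable lborel f" for f x
    proof (rule small)
      fix i assume i: "i \<in> F"
      have "\<bar>c f i\<bar> \<le> (\<integral>y. \<bar>f y * \<phi> i y\<bar> \<partial>lborel)" unfolding c_def by (rule integral_abs_bound)
      also have "\<dots> \<le> (\<integral>y. B i * \<bar>f y\<bar> \<partial>lborel)"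
      proof (intro integral_mono integrable_abs integrable_mult_right f L2fun_mult_integrable[OF f(1) L2[OF i]])
        show "\<bar>f y * \<phi> i y\<bar> \<le> B i * \<bar>f y\<bar>" for y
          unfolding abs_mult by (subst mult.commute) (intro mult_right_mono bound[OF i] abs_ge_zero)
      qed
      also have "\<dots> \<le> (B i + \<bar>L i\<bar>) * (\<integral>y. \<bar>f y\<bar> \<partial>lborel)"
        by (simp add: mult_right_mono)
      finally show "\<bar>c f i\<bar> \<le> (B i + \<bar>L i\<bar>) * (\<integral>y. \<bar>f y\<bar> \<partial>lborel)" .
    qed simp
    show "\<bar>signed_sum \<phi> F s b x\<bar> \<le> K * (v - u) * (\<integral>y. \<bar>b y\<bar> \<partial>lborel)" if b: "atom u v b" for u v b x
    proof -
      have bi: "integrable lborel b" "L2fun b" "u < v" "\<And>x. x \<notin> {u..<v} \<Longrightarrow> b x = 0"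
        using b by (auto simp: atom_def)
      have "\<bar>signed_sum \<phi> F s b x\<bar> \<le> K * ((v - u) * (\<integral>y. \<bar>b y\<bar> \<partial>lborel))"
      proof (rule small)
        show "(v - u) * (\<integral>y. \<bar>b y\<bar> \<partial>lborel) \<ge> 0" using bi by simp
        fix i assume i: "i \<in> F"
        have int: "integrable lborel (\<lambda>y. b y * (\<phi> i y - \<phi> i u))"
          using bi L2fun_mult_integrable[OF bi(2) L2[OF i]] by (auto simp: right_diff_distrib)
        have "\<bar>c b i\<bar> \<le> (\<integral>y. \<bar>b y * (\<phi> i y - \<phi> i u)\<bar> \<partial>lborel)"
          unfolding center[OF b i, of u] by (rule integral_abs_bound)
        also have "\<dots> \<le> (\<integral>y. \<bar>L i\<bar> * (v - u) * \<bar>b y\<bar> \<partial>lborel)"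
        proof (intro integral_mono integrable_abs int)
          fix y
          show "\<bar>b y * (\<phi> i y - \<phi> i u)\<bar> \<le> \<bar>L i\<bar> * (v - u) * \<bar>b y\<bar>"
          proof (cases "y \<in> {u..<v}")
            case True
            have "\<bar>\<phi> i y - \<phi> i u\<bar> \<le> \<bar>L i\<bar> * \<bar>y - u\<bar>"
              using lip[OF i, of y u] by (meson abs_ge_self abs_ge_zero mult_right_mono order_trans)
            also have "\<dots> \<le> \<bar>L i\<bar> * (v - u)" using True by (intro mult_left_mono) auto
            finally show ?thesis unfolding abs_mult mult.commute[of "\<bar>b y\<bar>"] by (intro mult_right_mono) auto
          qed (simp add: bi(4))
        qed (use bi in auto)
        also have "\<dots> \<le> (B i + \<bar>L i\<bar>) * ((v - u) * (\<integral>y. \<bar>b y\<bar> \<partial>lborel))"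
          using B0[OF i] bi by (simp add: mult.assoc mult_right_mono)
        finally show "\<bar>c b i\<bar> \<le> (B i + \<bar>L i\<bar>) * ((v - u) * (\<integral>y. \<bar>b y\<bar> \<partial>lborel))" .
      qed
      then show ?thesis by (simp add: mult.assoc)
    qed
    show "(\<integral>\<^sup>+x. ennreal \<bar>signed_sum \<phi> F s b x\<bar> * indicator (- {2 * u - v..2 * v - u}) x \<partial>lborel)
        \<le> ennreal (A * (\<integral>y. \<bar>b y\<bar> \<partial>lborel))" if b: "atom u v b" for u v b
    proof -
      define E where "E = - {2 * u - v..2 * v - u}"
      have [measurable]: "E \<in> sets borel" by (simp add: E_def)
      define z where "z = (u + v) / 2"
      define G where "G i = (\<integral>\<^sup>+x. ennreal \<bar>\<phi> i x\<bar> * indicator E x \<partial>lborel)" for i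
      have bi: "integrable lborel b" "L2fun b" "u < v" "\<And>x. x \<notin> {u..<v} \<Longrightarrow> b x = 0"
        using b by (auto simp: atom_def)
      have [measurable]: "b \<in> borel_measurable borel" using bi(2) by (rule L2fun_measurable)
      have \<phi>m: "\<phi> i \<in> borel_measurable borel" if "i \<in> F" for i
        using L2[OF that] by (rule L2fun_measurable)
      have "(\<integral>\<^sup>+x. ennreal \<bar>signed_sum \<phi> F s b x\<bar> * indicator E x \<partial>lborel)
        \<le> (\<integral>\<^sup>+x. (\<Sum>i\<in>F. ennreal \<bar>c b i\<bar> * (ennreal \<bar>\<phi> i x\<bar> * indicator E x)) \<partial>lborel)"
      proof (intro nn_integral_mono)
        fix x
        have "ennreal \<bar>signed_sum \<phi> F s b x\<bar> * indicator E x \<le> ennreal (\<Sum>i\<in>F. \<bar>c b i\<bar> * \<bar>\<phi> i x\<bar>) * indicator E x"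
          by (intro mult_right_mono ennreal_leI sum_le) simp
        also have "\<dots> = (\<Sum>i\<in>F. ennreal \<bar>c b i\<bar> * (ennreal \<bar>\<phi> i x\<bar> * indicator E x))"
          by (simp add: sum_ennreal[symmetric] ennreal_mult sum_distrib_right mult.assoc del: sum_ennreal)
        finally show "ennreal \<bar>signed_sum \<phi> F s b x\<bar> * indicator E x
          \<le> (\<Sum>i\<in>F. ennreal \<bar>c b i\<bar> * (ennreal \<bar>\<phi> i x\<bar> * indicator E x))" .
      qed
      also have "\<dots> = (\<Sum>i\<in>F. ennreal \<bar>c b i\<bar> * G i)"
        unfolding G_def using \<phi>m by (subst nn_integral_sum) (auto intro!: sum.cong nn_integral_cmult)
      also have "\<dots> \<le> (\<Sum>i\<in>F. (\<integral>\<^sup>+y. ennreal \<bar>b y\<bar> * ennreal \<bar>\<phi> i y - \<phi> i z\<bar> \<partial>lborel) * G i)"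
      proof (intro sum_mono mult_right_mono)
        fix i assume i: "i \<in> F"
        have int: "integrable lborel (\<lambda>y. b y * (\<phi> i y - \<phi> i z))"
          using bi L2fun_mult_integrable[OF bi(2) L2[OF i]] by (auto simp: right_diff_distrib)
        have "ennreal \<bar>c b i\<bar> \<le> ennreal (\<integral>y. \<bar>b y * (\<phi> i y - \<phi> i z)\<bar> \<partial>lborel)"
          unfolding center[OF b i, of z] by (intro ennreal_leI integral_abs_bound)
        also have "\<dots> = (\<integral>\<^sup>+y. ennreal \<bar>b y * (\<phi> i y - \<phi> i z)\<bar> \<partial>lborel)"
          using int by (intro nn_integral_eq_integral[symmetric]) auto
        finally show "ennreal \<bar>c b i\<bar> \<le> (\<integral>\<^sup>+y. ennreal \<bar>b y\<bar> * ennreal \<bar>\<phi> i y - \<phi> i z\<bar> \<partial>lborel)"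
          by (simp add: abs_mult ennreal_mult)
      qed simp
      \<comment> \<open>With the sum inside the integral, \<open>kernel\<close> applies at each
        point y of the support of the atom, with a bound independent of y.\<close>
      also have "\<dots> = (\<integral>\<^sup>+y. ennreal \<bar>b y\<bar> * (\<Sum>i\<in>F. ennreal \<bar>\<phi> i y - \<phi> i z\<bar> * G i) \<partial>lborel)"
        using \<phi>m by (simp add: sum_distrib_left nn_integral_sum nn_integral_multc[symmetric] mult.assoc)
      also have "\<dots> \<le> (\<integral>\<^sup>+y. ennreal \<bar>b y\<bar> * ennreal A \<partial>lborel)"
      proof (intro nn_integral_mono)
        fix y
        show "ennreal \<bar>b y\<bar> * (\<Sum>i\<in>F. ennreal \<bar>\<phi> i y - \<phi> i z\<bar> * G i) \<le> ennreal \<bar>b y\<bar> * ennreal A"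
        proof (cases "y \<in> {u..<v}")
          case True
          then show ?thesis
            unfolding G_def E_def z_def by (intro mult_left_mono kernel[OF bi(3)]) auto
        qed (simp add: bi(4))
      qed
      also have "\<dots> = ennreal (A * (\<integral>y. \<bar>b y\<bar> \<partial>lborel))"
        using bi A by (subst nn_integral_multc) (auto simp: nn_integral_eq_integral ennreal_mult mult.commute)
      finally show ?thesis by (simp add: E_def)
    qed
  qed
  then show ?thesis by blast
qed

end

subsection \<open>Signed wavelet expansions\<close>

text \<open>The substitution z = 2^j x - k. Lying outside the tripled interval means distance more
  than 3/2 (v - u) from its midpoint, and normalisation and Jacobian combine to 2^(j/2) 2^(-j) =
  2^(-j/2).\<close>

lemma dyadic_fn_tail:
  fixes \<psi> :: "real \<Rightarrow> real"
  assumes [measurable]: "\<psi> \<in> borel_measurable borel"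
  shows "(\<integral>\<^sup>+x. ennreal \<bar>dyadic_fn \<psi> (j, k) x\<bar> * indicator (- {2 * u - v..2 * v - u}) x \<partial>lborel)
    = ennreal (2 powr (- real_of_int j / 2)) * (\<integral>\<^sup>+z. ennreal \<bar>\<psi> z\<bar>
        * indicator {z. 3 / 2 * (2 powr real_of_int j * (v - u)) < \<bar>z + real_of_int k - 2 powr real_of_int j * ((u + v) / 2)\<bar>} z \<partial>lborel)"
    (is "?L = _ * (\<integral>\<^sup>+z. ?g z \<partial>lborel)")
proof -
  define a where "a = 2 powr real_of_int j"
  have a: "a > 0" by (simp add: a_def)
  have am: "2 powr (- real_of_int j) = 1 / a" by (simp add: a_def powr_minus field_simps)
  have af: "2 powr (- real_of_int j / 2) = 1 / a * 2 powr (real_of_int j / 2)"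
    unfolding am[symmetric] by (simp add: powr_add[symmetric])
  have "?L = ennreal \<bar>1 / a\<bar> * (\<integral>\<^sup>+z. ennreal \<bar>dyadic_fn \<psi> (j, k) (real_of_int k / a + 1 / a * z)\<bar>
      * indicator (- {2 * u - v..2 * v - u}) (real_of_int k / a + 1 / a * z) \<partial>lborel)"
    using a by (intro nn_integral_real_affine) (auto simp: dyadic_fn_def)
  also have "(\<integral>\<^sup>+z. ennreal \<bar>dyadic_fn \<psi> (j, k) (real_of_int k / a + 1 / a * z)\<bar>
      * indicator (- {2 * u - v..2 * v - u}) (real_of_int k / a + 1 / a * z) \<partial>lborel)
      = (\<integral>\<^sup>+z. ennreal (2 powr (real_of_int j / 2)) * ?g z \<partial>lborel)"
  proof (intro nn_integral_cong)
    fix z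
    have "dyadic_fn \<psi> (j, k) (real_of_int k / a + 1 / a * z) = 2 powr (real_of_int j / 2) * \<psi> z"
    proof -
      have "a * (real_of_int k / a + 1 / a * z) - real_of_int k = z" using a by (simp add: distrib_left)
      then show ?thesis by (simp add: dyadic_fn_def a_def)
    qed
    moreover have "real_of_int k / a + 1 / a * z \<in> - {2 * u - v..2 * v - u}
        \<longleftrightarrow> 3 / 2 * (a * (v - u)) < \<bar>z + real_of_int k - a * ((u + v) / 2)\<bar>"
    proof -
      have "real_of_int k / a + 1 / a * z = (z + real_of_int k) / a" using a by (simp add: field_simps)
      moreover have "w / a \<in> {2 * u - v..2 * v - u} \<longleftrightarrow> \<bar>w - a * ((u + v) / 2)\<bar> \<le> 3 / 2 * (a * (v - u))" for w
        using a by (auto simp: abs_le_iff field_simps)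
      ultimately show ?thesis by (metis Compl_iff not_le)
    qed
    ultimately show "ennreal \<bar>dyadic_fn \<psi> (j, k) (real_of_int k / a + 1 / a * z)\<bar>
      * indicator (- {2 * u - v..2 * v - u}) (real_of_int k / a + 1 / a * z)
      = ennreal (2 powr (real_of_int j / 2)) * ?g z"
      by (simp add: abs_mult ennreal_mult indicator_def a_def mult.assoc)
  qed
  also have "\<dots> = ennreal (2 powr (real_of_int j / 2)) * (\<integral>\<^sup>+z. ?g z \<partial>lborel)"
    by (intro nn_integral_cmult) measurable
  also have "ennreal \<bar>1 / a\<bar> * (ennreal (2 powr (real_of_int j / 2)) * (\<integral>\<^sup>+z. ?g z \<partial>lborel))
      = ennreal (2 powr (- real_of_int j / 2)) * (\<integral>\<^sup>+z. ?g z \<partial>lborel)"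
    using a unfolding af by (subst ennreal_mult) (auto simp: mult.assoc)
  finally show ?thesis .
qed

text \<open>In each product the factor 2^(j/2) of the oscillation cancels the factor 2^(-j/2) of the
  tail, which leaves \<open>wavelet_kernel_term\<close> with \<delta> = 2^j (v - u). The sum over k
  is then bounded uniformly in j, and the sum over j uniformly in v - u.\<close>

lemma wavelet_kernel_sum:
  fixes \<psi> \<psi>' :: "real \<Rightarrow> real"
  assumes deriv: "\<And>x. (\<psi> has_real_derivative \<psi>' x) (at x)"
    and decay: "\<And>x. \<bar>\<psi> x\<bar> + \<bar>\<psi>' x\<bar> \<le> C * weight (1 + 2 * e) x"
    and C: "C > 0" and e: "e > 0"
  obtains A where "A \<ge> 0" "\<And>F u v y. finite F \<Longrightarrow> u < v \<Longrightarrow> y \<in> {u..<v} \<Longrightarrow>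
    (\<Sum>I\<in>F. ennreal \<bar>dyadic_fn \<psi> I y - dyadic_fn \<psi> I ((u + v) / 2)\<bar>
      * (\<integral>\<^sup>+x. ennreal \<bar>dyadic_fn \<psi> I x\<bar> * indicator (- {2 * u - v..2 * v - u}) x \<partial>lborel)) \<le> ennreal A"
proof -
  have "continuous_on UNIV \<psi>"
    using deriv by (intro continuous_at_imp_continuous_on) (auto intro: DERIV_isCont)
  then have [measurable]: "\<psi> \<in> borel_measurable borel" by (rule borel_measurable_continuous_onI)
  obtain B where B: "B > 0" "\<And>S Y. finite S \<Longrightarrow> (\<Sum>k\<in>S. weight (1 + e) (Y - real_of_int k)) \<le> B"
    using weight_lattice_sum[of "1 + e"] e by auto
  obtain M where M: "M > 0"
    "\<And>S h. finite S \<Longrightarrow> h > 0 \<Longrightarrow> (\<Sum>j\<in>S. scale_decay e (2 powr real_of_int j * h)) \<le> M"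
    using scale_decay_sum[OF e] by auto
  define D where "D = C\<^sup>2 * 2 powr (1 + e) * (2 / e)"
  have D: "D > 0" using C e by (simp add: D_def)
  have sd: "scale_decay e d \<ge> 0" if "d > 0" for d using that by (simp add: scale_decay_def)
  show ?thesis
  proof (rule that)
    show "D * (2 * B) * M \<ge> 0" using D B M by simp
    fix F :: "(int \<times> int) set" and u v y :: real
    assume F: "finite F" and uv: "u < v" and y: "y \<in> {u..<v}"
    define h where "h = v - u"
    define Y where "Y j = 2 powr real_of_int j * y" for j
    define Z where "Z j = 2 powr real_of_int j * ((u + v) / 2)" for j
    define trm where "trm I = D * scale_decay e (2 powr real_of_int (fst I) * h)
      * (weight (1 + e) (Y (fst I) - real_of_int (snd I)) + weight (1 + e) (Z (fst I) - real_of_int (snd I)))" for I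
    have h: "h > 0" using uv by (simp add: h_def)
    have trm0: "trm I \<ge> 0" for I using D sd h by (simp add: trm_def)
    have "(\<Sum>I\<in>F. ennreal \<bar>dyadic_fn \<psi> I y - dyadic_fn \<psi> I ((u + v) / 2)\<bar>
      * (\<integral>\<^sup>+x. ennreal \<bar>dyadic_fn \<psi> I x\<bar> * indicator (- {2 * u - v..2 * v - u}) x \<partial>lborel))
      \<le> (\<Sum>I\<in>F. ennreal (trm I))"
    proof (intro sum_mono)
      fix I :: "int \<times> int"
      obtain j k where I: "I = (j, k)" by (cases I)
      define H where "H = (\<integral>\<^sup>+z. ennreal \<bar>\<psi> z\<bar>
        * indicator {z. 3 / 2 * (2 powr real_of_int j * h) < \<bar>z + real_of_int k - Z j\<bar>} z \<partial>lborel)"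
      have "ennreal \<bar>dyadic_fn \<psi> I y - dyadic_fn \<psi> I ((u + v) / 2)\<bar>
          = ennreal (2 powr (real_of_int j / 2)) * ennreal \<bar>\<psi> (Y j - real_of_int k) - \<psi> (Z j - real_of_int k)\<bar>"
        by (simp add: I dyadic_fn_def Y_def Z_def right_diff_distrib[symmetric] abs_mult ennreal_mult)
      then have "ennreal \<bar>dyadic_fn \<psi> I y - dyadic_fn \<psi> I ((u + v) / 2)\<bar>
        * (\<integral>\<^sup>+x. ennreal \<bar>dyadic_fn \<psi> I x\<bar> * indicator (- {2 * u - v..2 * v - u}) x \<partial>lborel)
        = (ennreal (2 powr (real_of_int j / 2)) * ennreal (2 powr (- real_of_int j / 2)))
          * (ennreal \<bar>\<psi> (Y j - real_of_int k) - \<psi> (Z j - real_of_int k)\<bar> * H)"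
        unfolding I dyadic_fn_tail[OF \<open>\<psi> \<in> borel_measurable borel\<close>] H_def h_def Z_def by (simp only: mult_ac)
      also have "ennreal (2 powr (real_of_int j / 2)) * ennreal (2 powr (- real_of_int j / 2)) = 1"
        by (simp add: ennreal_mult[symmetric] powr_add[symmetric])
      also have "1 * (ennreal \<bar>\<psi> (Y j - real_of_int k) - \<psi> (Z j - real_of_int k)\<bar> * H) \<le> ennreal (trm I)"
        unfolding mult_1_left H_def trm_def I fst_conv snd_conv D_def
      proof (rule wavelet_kernel_term[OF deriv decay C e])
        show "0 < 2 powr real_of_int j * h" using h by simp
        have "\<bar>y - (u + v) / 2\<bar> \<le> h / 2" using y by (auto simp: h_def abs_le_iff field_simps)
        then have le: "2 powr real_of_int j * \<bar>y - (u + v) / 2\<bar> \<le> 2 powr real_of_int j * (h / 2)"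
          by (intro mult_left_mono) auto
        have "Y j - Z j = 2 powr real_of_int j * (y - (u + v) / 2)"
          unfolding Y_def Z_def by (rule right_diff_distrib[symmetric])
        then have "\<bar>Y j - Z j\<bar> = 2 powr real_of_int j * \<bar>y - (u + v) / 2\<bar>"
          by (simp only: abs_mult abs_of_nonneg powr_ge_zero)
        with le show "\<bar>Y j - Z j\<bar> \<le> 2 powr real_of_int j * h / 2" by linarith
      qed
      finally show "ennreal \<bar>dyadic_fn \<psi> I y - dyadic_fn \<psi> I ((u + v) / 2)\<bar>
        * (\<integral>\<^sup>+x. ennreal \<bar>dyadic_fn \<psi> I x\<bar> * indicator (- {2 * u - v..2 * v - u}) x \<partial>lborel) \<le> ennreal (trm I)" .
    qed
    also have "\<dots> = ennreal (\<Sum>I\<in>F. trm I)" using trm0 by (intro sum_ennreal) auto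
    also have "\<dots> \<le> ennreal (D * (2 * B) * M)"
    proof (intro ennreal_leI)
      \<comment> \<open>The terms are nonnegative, so \<open>F\<close> may be enlarged to a product
        set, where the sums over k and j separate.\<close>
      have "(\<Sum>I\<in>F. trm I) \<le> (\<Sum>I\<in>fst ` F \<times> snd ` F. trm I)"
        using F trm0 by (intro sum_mono2) (auto simp: image_iff, force+)
      also have "\<dots> = (\<Sum>j\<in>fst ` F. D * scale_decay e (2 powr real_of_int j * h)
         * ((\<Sum>k\<in>snd ` F. weight (1 + e) (Y j - real_of_int k)) + (\<Sum>k\<in>snd ` F. weight (1 + e) (Z j - real_of_int k))))"
        by (simp add: sum.cartesian_product trm_def sum_distrib_left sum.distrib case_prod_unfold distrib_left)
      also have "\<dots> \<le> (\<Sum>j\<in>fst ` F. D * scale_decay e (2 powr real_of_int j * h) * (B + B))"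
        using D sd h F B(2) by (intro sum_mono mult_left_mono add_mono) auto
      also have "\<dots> = D * (2 * B) * (\<Sum>j\<in>fst ` F. scale_decay e (2 powr real_of_int j * h))"
        by (simp add: sum_distrib_left mult_ac)
      also have "\<dots> \<le> D * (2 * B) * M"
        using D B M(2)[OF _ h, of "fst ` F"] F by (intro mult_left_mono) auto
      finally show "(\<Sum>I\<in>F. trm I) \<le> D * (2 * B) * M" .
    qed
    finally show "(\<Sum>I\<in>F. ennreal \<bar>dyadic_fn \<psi> I y - dyadic_fn \<psi> I ((u + v) / 2)\<bar>
      * (\<integral>\<^sup>+x. ennreal \<bar>dyadic_fn \<psi> I x\<bar> * indicator (- {2 * u - v..2 * v - u}) x \<partial>lborel)) \<le> ennreal (D * (2 * B) * M)" .
  qed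
qed

lemma dyadic_fn_bound:
  assumes "\<And>x. \<bar>\<psi> x\<bar> \<le> C"
  shows "\<bar>dyadic_fn \<psi> I x\<bar> \<le> 2 powr (real_of_int (fst I) / 2) * C"
  using assms by (auto simp: dyadic_fn_def case_prod_unfold abs_mult intro: mult_left_mono)

lemma dyadic_fn_lipschitz:
  fixes \<psi> :: "real \<Rightarrow> real"
  assumes deriv: "\<And>x. (\<psi> has_real_derivative \<psi>' x) (at x)" and "\<And>x. \<bar>\<psi>' x\<bar> \<le> C"
  shows "\<bar>dyadic_fn \<psi> I x - dyadic_fn \<psi> I y\<bar>
    \<le> 2 powr (real_of_int (fst I) / 2) * C * 2 powr real_of_int (fst I) * \<bar>x - y\<bar>"
proof -
  have lip: "\<bar>\<psi> a - \<psi> b\<bar> \<le> C * \<bar>a - b\<bar>" for a b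
    using field_differentiable_bound[of UNIV \<psi> \<psi>' C a b] deriv assms(2) by simp
  obtain j k where I: "I = (j, k)" by (cases I)
  have "\<bar>dyadic_fn \<psi> I x - dyadic_fn \<psi> I y\<bar> = 2 powr (real_of_int j / 2)
      * \<bar>\<psi> (2 powr real_of_int j * x - real_of_int k) - \<psi> (2 powr real_of_int j * y - real_of_int k)\<bar>"
    by (simp add: I dyadic_fn_def right_diff_distrib[symmetric] abs_mult)
  also have "\<dots> \<le> 2 powr (real_of_int j / 2)
      * (C * \<bar>2 powr real_of_int j * x - real_of_int k - (2 powr real_of_int j * y - real_of_int k)\<bar>)"
    by (intro mult_left_mono lip) auto
  also have "\<dots> = 2 powr (real_of_int j / 2) * C * 2 powr real_of_int j * \<bar>x - y\<bar>"
    by (simp add: right_diff_distrib[symmetric] abs_mult)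
  finally show ?thesis by (simp add: I)
qed

lemma wavelet_onb_orthonormal_family:
  assumes "wavelet_onb \<psi>" "finite F"
  shows "orthonormal_family (dyadic_fn \<psi>) F"
  by standard (use assms in \<open>auto simp: wavelet_onb_def L2fun_def simp del: split_paired_All\<close>)

text \<open>Both constants precede the quantifiers over \<open>F\<close> and \<open>s\<close>. At p
  = 2 the contraction property suffices; the other exponents rest on the weak bound.\<close>

lemma wavelet_signed_sum_bounds:
  fixes \<psi> \<psi>' :: "real \<Rightarrow> real"
  assumes deriv: "\<And>x. (\<psi> has_real_derivative \<psi>' x) (at x)"
    and onb: "wavelet_onb \<psi>"
    and C: "C > 0" and eps: "\<epsilon> > 0"
    and decay: "\<And>x. \<bar>\<psi> x\<bar> + \<bar>\<psi>' x\<bar> \<le> C * (1 + \<bar>x\<bar>) powr (- 1 - \<epsilon>)"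
  shows wavelet_signed_sum_weak: "\<exists>W>0. \<forall>F s f t. finite F \<longrightarrow> (\<forall>I. \<bar>s I\<bar> \<le> 1) \<longrightarrow> L2fun f \<longrightarrow> integrable lborel f \<longrightarrow> t > 0 \<longrightarrow>
        emeasure lborel {x. t < \<bar>signed_sum (dyadic_fn \<psi>) F s f x\<bar>} \<le> ennreal (W / t * (\<integral>x. \<bar>f x\<bar> \<partial>lborel))"
    and wavelet_signed_sum_strong: "p > 1 \<Longrightarrow> \<exists>D>0. \<forall>F s f. finite F \<longrightarrow> (\<forall>I. \<bar>s I\<bar> \<le> 1) \<longrightarrow> L2fun f
      \<longrightarrow> integrable lborel (\<lambda>x. \<bar>f x\<bar> powr p) \<longrightarrow>
        (\<integral>\<^sup>+x. ennreal (\<bar>signed_sum (dyadic_fn \<psi>) F s f x\<bar> powr p) \<partial>lborel)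
          \<le> ennreal (D * (\<integral>x. \<bar>f x\<bar> powr p \<partial>lborel))"
proof -
  \<comment> \<open>Half of the excess decay, so that 1 + 2 e is the given exponent 1 +
    \<epsilon>.\<close>
  define e where "e = \<epsilon> / 2"
  have e: "e > 0" using eps by (simp add: e_def)
  have decay': "\<bar>\<psi> x\<bar> + \<bar>\<psi>' x\<bar> \<le> C * weight (1 + 2 * e) x" for x
    using decay[of x] by (simp add: weight_def e_def)
  have bdd: "\<bar>\<psi> x\<bar> + \<bar>\<psi>' x\<bar> \<le> C" for x
  proof -
    have "weight (1 + 2 * e) x \<le> weight 0 x" using e by (intro weight_antimono) auto
    also have "weight 0 x = 1" using abs_ge_zero[of x] by (simp add: weight_def)
    finally have "C * weight (1 + 2 * e) x \<le> C * 1" using C by (intro mult_left_mono) auto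
    then show ?thesis using decay'[of x] by linarith
  qed
  have \<psi>C: "\<bar>\<psi> x\<bar> \<le> C" "\<bar>\<psi>' x\<bar> \<le> C" for x using bdd[of x] by linarith+
  obtain A where A: "A \<ge> 0" and kernel: "\<And>F u v y. finite F \<Longrightarrow> u < v \<Longrightarrow> y \<in> {u..<v} \<Longrightarrow>
    (\<Sum>I\<in>F. ennreal \<bar>dyadic_fn \<psi> I y - dyadic_fn \<psi> I ((u + v) / 2)\<bar>
      * (\<integral>\<^sup>+x. ennreal \<bar>dyadic_fn \<psi> I x\<bar> * indicator (- {2 * u - v..2 * v - u}) x \<partial>lborel)) \<le> ennreal A"
    using wavelet_kernel_sum[OF deriv decay' C e] by blast
  define W where "W = 35 + 8 * A"
  have W: "W > 0" using A by (simp add: W_def)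
  have weak: "emeasure lborel {x. t < \<bar>signed_sum (dyadic_fn \<psi>) F s f x\<bar>} \<le> ennreal (W / t * (\<integral>x. \<bar>f x\<bar> \<partial>lborel))"
    if *: "finite F" "\<forall>I. \<bar>s I\<bar> \<le> 1" "L2fun f" "integrable lborel f" "t > 0" for F s f t
  proof -
    interpret orthonormal_family "dyadic_fn \<psi>" F using onb \<open>finite F\<close> by (rule wavelet_onb_orthonormal_family)
    obtain K where "cz_operator (signed_sum (dyadic_fn \<psi>) F s) A K"
      using cz_operator_signed_sum[OF _ A dyadic_fn_bound[OF \<psi>C(1)] dyadic_fn_lipschitz[OF deriv \<psi>C(2)] kernel[OF \<open>finite F\<close>]] *(2)
      by blast
    then show ?thesis unfolding W_def using * by (intro cz_operator.weak_type)
  qed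
  show "\<exists>W>0. \<forall>F s f t. finite F \<longrightarrow> (\<forall>I. \<bar>s I\<bar> \<le> 1) \<longrightarrow> L2fun f \<longrightarrow> integrable lborel f \<longrightarrow> t > 0 \<longrightarrow>
        emeasure lborel {x. t < \<bar>signed_sum (dyadic_fn \<psi>) F s f x\<bar>} \<le> ennreal (W / t * (\<integral>x. \<bar>f x\<bar> \<partial>lborel))"
    using weak W by blast
  \<comment> \<open>Stated without integrability of |f|^p, with a possibly infinite right-hand side:
    this is the form in which duality takes the estimate for its test functions.\<close>
  have low: "(\<integral>\<^sup>+x. ennreal (\<bar>signed_sum (dyadic_fn \<psi>) F s f x\<bar> powr p) \<partial>lborel)
    \<le> ennreal (4 * W * p / (p - 1) + 4 * p / (2 - p)) * (\<integral>\<^sup>+x. ennreal (\<bar>f x\<bar> powr p) \<partial>lborel)"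
    if "finite F" "\<forall>I. \<bar>s I\<bar> \<le> 1" "L2fun f" "1 < p" "p < 2" for F s f p
  proof -
    interpret orthonormal_family "dyadic_fn \<psi>" F using onb \<open>finite F\<close> by (rule wavelet_onb_orthonormal_family)
    show ?thesis
    proof (rule marcinkiewicz)
      show "signed_sum (dyadic_fn \<psi>) F s f \<in> borel_measurable borel" if "L2fun f" for f
        using signed_sum_L2fun by (rule L2fun_measurable)
      show "(\<integral>\<^sup>+x. ennreal ((signed_sum (dyadic_fn \<psi>) F s f x)\<^sup>2) \<partial>lborel) \<le> ennreal (\<integral>x. (f x)\<^sup>2 \<partial>lborel)"
        if "L2fun f" for f using signed_sum_contraction that \<open>\<forall>I. \<bar>s I\<bar> \<le> 1\<close> by blast
    qed (use that W weak signed_sum_add in auto)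
  qed
  assume p: "p > 1"
  consider "p < 2" | "p = 2" | "p > 2" by linarith
  then show "\<exists>D>0. \<forall>F s f. finite F \<longrightarrow> (\<forall>I. \<bar>s I\<bar> \<le> 1) \<longrightarrow> L2fun f
      \<longrightarrow> integrable lborel (\<lambda>x. \<bar>f x\<bar> powr p) \<longrightarrow>
        (\<integral>\<^sup>+x. ennreal (\<bar>signed_sum (dyadic_fn \<psi>) F s f x\<bar> powr p) \<partial>lborel)
          \<le> ennreal (D * (\<integral>x. \<bar>f x\<bar> powr p \<partial>lborel))"
  proof cases
    case 1
    define D where "D = 4 * W * p / (p - 1) + 4 * p / (2 - p)"
    have D: "D > 0" using W p 1 by (simp add: D_def add_pos_pos)
    show ?thesis
    proof (intro exI[of _ D] conjI D allI impI)
      fix F :: "(int \<times> int) set" and s :: "int \<times> int \<Rightarrow> real" and f :: "real \<Rightarrow> real"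
      assume *: "finite F" "\<forall>I. \<bar>s I\<bar> \<le> 1" "L2fun f" "integrable lborel (\<lambda>x. \<bar>f x\<bar> powr p)"
      have "(\<integral>\<^sup>+x. ennreal (\<bar>f x\<bar> powr p) \<partial>lborel) = ennreal (\<integral>x. \<bar>f x\<bar> powr p \<partial>lborel)"
        using * by (intro nn_integral_eq_integral) auto
      then show "(\<integral>\<^sup>+x. ennreal (\<bar>signed_sum (dyadic_fn \<psi>) F s f x\<bar> powr p) \<partial>lborel)
          \<le> ennreal (D * (\<integral>x. \<bar>f x\<bar> powr p \<partial>lborel))"
        using low[OF *(1-3) p 1] D by (simp add: D_def[symmetric] ennreal_mult)
    qed
  next
    case 2
    show ?thesis
    proof (intro exI[of _ 1] conjI allI impI)
      fix F :: "(int \<times> int) set" and s :: "int \<times> int \<Rightarrow> real" and f :: "real \<Rightarrow> real"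
      assume *: "finite F" "\<forall>I. \<bar>s I\<bar> \<le> 1" "L2fun f"
      interpret orthonormal_family "dyadic_fn \<psi>" F using onb \<open>finite F\<close> by (rule wavelet_onb_orthonormal_family)
      show "(\<integral>\<^sup>+x. ennreal (\<bar>signed_sum (dyadic_fn \<psi>) F s f x\<bar> powr p) \<partial>lborel)
          \<le> ennreal (1 * (\<integral>x. \<bar>f x\<bar> powr p \<partial>lborel))"
        using signed_sum_contraction[OF *(3), of s] * by (simp add: 2)
    qed simp
  next
    case 3
    \<comment> \<open>The conjugate exponent lies strictly between 1 and 2, so \<open>low\<close>
      applies to it.\<close>
    define q where "q = p / (p - 1)"
    have q: "1 < q" "q < 2" "1 / p + 1 / q = 1" using 3 by (auto simp: q_def field_simps)
    define D where "D = 4 * W * q / (q - 1) + 4 * q / (2 - q)"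
    have D: "D > 0" using W q by (simp add: D_def add_pos_pos)
    show ?thesis
    proof (intro exI[of _ "2 / p * (2 * D / q) powr (p / q)"] conjI allI impI)
      show "2 / p * (2 * D / q) powr (p / q) > 0" using 3 D q by simp
      fix F :: "(int \<times> int) set" and s :: "int \<times> int \<Rightarrow> real" and f :: "real \<Rightarrow> real"
      assume *: "finite F" "\<forall>I. \<bar>s I\<bar> \<le> 1" "L2fun f" "integrable lborel (\<lambda>x. \<bar>f x\<bar> powr p)"
      interpret orthonormal_family "dyadic_fn \<psi>" F using onb \<open>finite F\<close> by (rule wavelet_onb_orthonormal_family)
      show "(\<integral>\<^sup>+x. ennreal (\<bar>signed_sum (dyadic_fn \<psi>) F s f x\<bar> powr p) \<partial>lborel)
          \<le> ennreal (2 / p * (2 * D / q) powr (p / q) * (\<integral>x. \<bar>f x\<bar> powr p \<partial>lborel))"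
      proof (rule self_adjoint_duality[where T = "signed_sum (dyadic_fn \<psi>) F s"])
        show "(\<integral>\<^sup>+x. ennreal (\<bar>signed_sum (dyadic_fn \<psi>) F s g x\<bar> powr q) \<partial>lborel)
          \<le> ennreal D * (\<integral>\<^sup>+x. ennreal (\<bar>g x\<bar> powr q) \<partial>lborel)" if "L2fun g" for g
          unfolding D_def using low[OF *(1,2) that q(1,2)] .
        show "\<exists>B. \<forall>x. \<bar>signed_sum (dyadic_fn \<psi>) F s f x\<bar> \<le> B" for f
          by (rule signed_sum_bounded[OF dyadic_fn_bound[OF \<psi>C(1)]])
      qed (use * 3 q D signed_sum_L2fun signed_sum_symmetric in auto)
    qed
  qed
qed

subsection \<open>Square function and random series\<close>

text \<open>Fatou's lemma with an arbitrary function \<open>v\<close> below the limit inferior: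
  monotonicity of the nonnegative integral asks for no measurability, so \<open>v\<close> may be a
  random norm as a function of x.\<close>

lemma nn_integral_liminf_le:
  assumes "\<And>n. u n \<in> borel_measurable M" "\<And>n. (\<integral>\<^sup>+x. u n x \<partial>M) \<le> K"
    and "AE x in M. v x \<le> liminf (\<lambda>n. u n x)"
  shows "(\<integral>\<^sup>+x. v x \<partial>M) \<le> (K :: ennreal)"
proof -
  have "(\<integral>\<^sup>+x. v x \<partial>M) \<le> (\<integral>\<^sup>+x. liminf (\<lambda>n. u n x) \<partial>M)"
    using assms(3) by (rule nn_integral_mono_AE)
  also have "\<dots> \<le> liminf (\<lambda>n. \<integral>\<^sup>+x. u n x \<partial>M)"
    by (rule nn_integral_liminf) (rule assms(1))
  also have "\<dots> \<le> K" using assms(2) by (intro Liminf_le) auto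
  finally show ?thesis .
qed

text \<open>Both bounds arise by averaging the uniform bounds for signed sums over the 2^card F sign
  patterns. Passing from t to t / 2 in the weak case accounts for the factor 2 next to
  \<open>W\<close>.\<close>

lemma wavelet_square_function_bounds:
  fixes \<psi> \<psi>' :: "real \<Rightarrow> real"
  assumes deriv: "\<And>x. (\<psi> has_real_derivative \<psi>' x) (at x)"
    and onb: "wavelet_onb \<psi>"
    and C: "C > 0" and eps: "\<epsilon> > 0"
    and decay: "\<And>x. \<bar>\<psi> x\<bar> + \<bar>\<psi>' x\<bar> \<le> C * (1 + \<bar>x\<bar>) powr (- 1 - \<epsilon>)"
  shows wavelet_square_function_weak: "\<exists>W>0. \<forall>F f t. finite F \<longrightarrow> L2fun f \<longrightarrow> integrable lborel f \<longrightarrow> t > 0 \<longrightarrow>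
        emeasure lborel {x. t < sqrt (\<Sum>I\<in>F. (wavelet_coeff \<psi> f I * dyadic_fn \<psi> I x)\<^sup>2)}
          \<le> ennreal (W / t * (\<integral>x. \<bar>f x\<bar> \<partial>lborel))"
    and wavelet_square_function_strong: "p > 1 \<Longrightarrow> \<exists>D>0. \<forall>F f. finite F \<longrightarrow> L2fun f
      \<longrightarrow> integrable lborel (\<lambda>x. \<bar>f x\<bar> powr p) \<longrightarrow>
        (\<integral>\<^sup>+x. ennreal (sqrt (\<Sum>I\<in>F. (wavelet_coeff \<psi> f I * dyadic_fn \<psi> I x)\<^sup>2) powr p) \<partial>lborel)
          \<le> ennreal (D * (\<integral>x. \<bar>f x\<bar> powr p \<partial>lborel))"
proof -
  define X where "X F A f x = signed_sum (dyadic_fn \<psi>) F (sgn_set A) f x" for F A f x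
  have X_eq: "X F A f x = (\<Sum>I\<in>F. sgn_set A I * (wavelet_coeff \<psi> f I * dyadic_fn \<psi> I x))" for F A f x
    by (simp add: X_def signed_sum_def wavelet_coeff_def mult.assoc)
  have sgn1: "\<forall>I. \<bar>sgn_set A I\<bar> \<le> 1" for A :: "(int \<times> int) set"
    by (simp add: sgn_set_def)
  have Xm: "X F A f \<in> borel_measurable borel" if "finite F" for F A f
    unfolding X_def using orthonormal_family.signed_sum_L2fun[OF wavelet_onb_orthonormal_family[OF onb that]]
    by (rule L2fun_measurable)
  obtain W where W: "W > 0" and weak: "\<And>F s f t. finite F \<Longrightarrow> (\<forall>I. \<bar>s I\<bar> \<le> 1) \<Longrightarrow> L2fun f
    \<Longrightarrow> integrable lborel f \<Longrightarrow> t > 0 \<Longrightarrow>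
        emeasure lborel {x. t < \<bar>signed_sum (dyadic_fn \<psi>) F s f x\<bar>} \<le> ennreal (W / t * (\<integral>x. \<bar>f x\<bar> \<partial>lborel))"
    using wavelet_signed_sum_weak[OF deriv onb C eps decay] by blast
  show "\<exists>W>0. \<forall>F f t. finite F \<longrightarrow> L2fun f \<longrightarrow> integrable lborel f \<longrightarrow> t > 0 \<longrightarrow>
        emeasure lborel {x. t < sqrt (\<Sum>I\<in>F. (wavelet_coeff \<psi> f I * dyadic_fn \<psi> I x)\<^sup>2)}
          \<le> ennreal (W / t * (\<integral>x. \<bar>f x\<bar> \<partial>lborel))"
  proof (intro exI[of _ "16 / 3 * (2 * W)"] conjI allI impI)
    show "16 / 3 * (2 * W) > 0" using W by simp
    fix F :: "(int \<times> int) set" and f :: "real \<Rightarrow> real" and t :: real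
    assume *: "finite F" "L2fun f" "integrable lborel f" "t > 0"
    define N where "N = (\<integral>x. \<bar>f x\<bar> \<partial>lborel)"
    have N: "N \<ge> 0" by (simp add: N_def)
    define S where "S x = (\<Sum>I\<in>F. (wavelet_coeff \<psi> f I * dyadic_fn \<psi> I x)\<^sup>2)" for x
    define G where "G A = {x. t / 2 < \<bar>X F A f x\<bar>}" for A
    note [measurable] = Xm[OF *(1)]
    have [measurable]: "G A \<in> sets borel" for A unfolding G_def by measurable
    have [measurable]: "dyadic_fn \<psi> I \<in> borel_measurable borel" for I
      using onb by (auto simp: wavelet_onb_def simp del: split_paired_All)
    have [measurable]: "S \<in> borel_measurable borel" unfolding S_def by measurable
    define m where "m = (2::real) ^ card F"
    have m: "m > 0" by (simp add: m_def)
    \<comment> \<open>Averaging happens at the level of superlevel sets: where the square function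
      exceeds t, at least 3/16 of the signed sums exceed t / 2. Integrating this pointwise
      inequality needs no triangle inequality for weak L1.\<close>
    have pw: "indicator {x. t < sqrt (S x)} x \<le> 16 / (3 * m) * (\<Sum>A\<in>Pow F. indicator (G A) x :: real)" for x
    proof (cases "t < sqrt (S x)")
      case True
      define Q where "Q = {A \<in> Pow F. S x \<le> 4 * (X F A f x)\<^sup>2}"
      have Q: "finite (Pow F)" "Q \<subseteq> Pow F" using * by (auto simp: Q_def)
      have "3 / 16 * m \<le> real (card Q)"
        using rademacher_paley_zygmund[OF *(1), of "\<lambda>I. wavelet_coeff \<psi> f I * dyadic_fn \<psi> I x"]
        by (simp add: Q_def S_def X_eq m_def)
      also have "\<dots> = (\<Sum>A\<in>Q. 1)" by simp
      also have "\<dots> \<le> (\<Sum>A\<in>Q. indicator (G A) x)"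
      proof (intro sum_mono)
        fix A assume "A \<in> Q"
        then have "sqrt (S x) \<le> sqrt ((2 * X F A f x)\<^sup>2)" by (intro real_sqrt_le_mono) (simp add: Q_def power_mult_distrib)
        then have "t < 2 * \<bar>X F A f x\<bar>" using True unfolding real_sqrt_abs by (simp add: abs_mult)
        then show "1 \<le> (indicator (G A) x :: real)" by (simp add: G_def)
      qed
      also have "\<dots> \<le> (\<Sum>A\<in>Pow F. indicator (G A) x)"
        using Q by (intro sum_mono2) auto
      finally show ?thesis using True m by (simp add: field_simps)
    qed (use m in \<open>simp add: sum_nonneg\<close>)
    have "emeasure lborel {x. t < sqrt (S x)} = (\<integral>\<^sup>+x. indicator {x. t < sqrt (S x)} x \<partial>lborel)"
      by (simp add: nn_integral_indicator)
    also have "\<dots> \<le> (\<integral>\<^sup>+x. ennreal (16 / (3 * m)) * (\<Sum>A\<in>Pow F. indicator (G A) x) \<partial>lborel)"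
    proof (intro nn_integral_mono)
      fix x
      have "(indicator {x. t < sqrt (S x)} x :: ennreal) = ennreal (indicator {x. t < sqrt (S x)} x)"
        by (simp add: indicator_def)
      also have "\<dots> \<le> ennreal (16 / (3 * m) * (\<Sum>A\<in>Pow F. indicator (G A) x))" by (intro ennreal_leI pw)
      also have "\<dots> = ennreal (16 / (3 * m)) * (\<Sum>A\<in>Pow F. ennreal (indicator (G A) x))"
        using m by (subst ennreal_mult) (auto simp: sum_nonneg)
      also have "(\<Sum>A\<in>Pow F. ennreal (indicator (G A) x)) = (\<Sum>A\<in>Pow F. indicator (G A) x)"
        by (intro sum.cong) (auto simp: indicator_def)
      finally show "indicator {x. t < sqrt (S x)} x \<le> ennreal (16 / (3 * m)) * (\<Sum>A\<in>Pow F. indicator (G A) x :: ennreal)" .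
    qed
    also have "\<dots> = ennreal (16 / (3 * m)) * (\<Sum>A\<in>Pow F. emeasure lborel (G A))"
      by (subst nn_integral_cmult, measurable) (subst nn_integral_sum, auto)
    also have "\<dots> \<le> ennreal (16 / (3 * m)) * (\<Sum>A\<in>Pow F. ennreal (W / (t / 2) * N))"
      unfolding G_def X_def N_def using * by (intro mult_left_mono sum_mono weak sgn1) auto
    also have "\<dots> = ennreal (16 / 3 * (2 * W) / t * N)"
    proof -
      have "(\<Sum>A\<in>Pow F. ennreal (W / (t / 2) * N)) = ennreal (m * (W / (t / 2) * N))"
        using *(1,4) W N by (simp add: sum_ennreal m_def card_Pow del: sum_constant) (simp add: card_Pow)
      then show ?thesis using m W N *(4) by (simp add: ennreal_mult[symmetric])
    qed
    finally show "emeasure lborel {x. t < sqrt (\<Sum>I\<in>F. (wavelet_coeff \<psi> f I * dyadic_fn \<psi> I x)\<^sup>2)}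
          \<le> ennreal (16 / 3 * (2 * W) / t * (\<integral>x. \<bar>f x\<bar> \<partial>lborel))"
      by (simp add: S_def N_def)
  qed
  assume p: "p > 1"
  obtain D where D: "D > 0" and strong: "\<And>F s f. finite F \<Longrightarrow> (\<forall>I. \<bar>s I\<bar> \<le> 1) \<Longrightarrow> L2fun f
      \<Longrightarrow> integrable lborel (\<lambda>x. \<bar>f x\<bar> powr p) \<Longrightarrow>
        (\<integral>\<^sup>+x. ennreal (\<bar>signed_sum (dyadic_fn \<psi>) F s f x\<bar> powr p) \<partial>lborel)
          \<le> ennreal (D * (\<integral>x. \<bar>f x\<bar> powr p \<partial>lborel))"
    using wavelet_signed_sum_strong[OF deriv onb C eps decay p] by blast
  show "\<exists>D>0. \<forall>F f. finite F \<longrightarrow> L2fun f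
      \<longrightarrow> integrable lborel (\<lambda>x. \<bar>f x\<bar> powr p) \<longrightarrow>
        (\<integral>\<^sup>+x. ennreal (sqrt (\<Sum>I\<in>F. (wavelet_coeff \<psi> f I * dyadic_fn \<psi> I x)\<^sup>2) powr p) \<partial>lborel)
          \<le> ennreal (D * (\<integral>x. \<bar>f x\<bar> powr p \<partial>lborel))"
  proof (intro exI[of _ "16 / 3 * 2 powr p * D"] conjI allI impI)
    show "16 / 3 * 2 powr p * D > 0" using D by simp
    fix F :: "(int \<times> int) set" and f :: "real \<Rightarrow> real"
    assume *: "finite F" "L2fun f" "integrable lborel (\<lambda>x. \<bar>f x\<bar> powr p)"
    define N where "N = (\<integral>x. \<bar>f x\<bar> powr p \<partial>lborel)"
    have N: "N \<ge> 0" by (simp add: N_def)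
    note [measurable] = Xm[OF *(1)]
    define m where "m = (2::real) ^ card F"
    have m: "m > 0" by (simp add: m_def)
    define k where "k = 16 / 3 * 2 powr p / m"
    have k: "k \<ge> 0" using m by (simp add: k_def)
    have "(\<integral>\<^sup>+x. ennreal (sqrt (\<Sum>I\<in>F. (wavelet_coeff \<psi> f I * dyadic_fn \<psi> I x)\<^sup>2) powr p) \<partial>lborel)
      \<le> (\<integral>\<^sup>+x. ennreal k * (\<Sum>A\<in>Pow F. ennreal (\<bar>X F A f x\<bar> powr p)) \<partial>lborel)"
    proof (intro nn_integral_mono)
      fix x
      have "m * sqrt (\<Sum>I\<in>F. (wavelet_coeff \<psi> f I * dyadic_fn \<psi> I x)\<^sup>2) powr p
        \<le> 16 / 3 * 2 powr p * (\<Sum>A\<in>Pow F. \<bar>X F A f x\<bar> powr p)"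
        using rademacher_khinchine[OF *(1), of p] p by (simp add: X_eq m_def)
      then have "sqrt (\<Sum>I\<in>F. (wavelet_coeff \<psi> f I * dyadic_fn \<psi> I x)\<^sup>2) powr p
        \<le> k * (\<Sum>A\<in>Pow F. \<bar>X F A f x\<bar> powr p)"
        using m by (simp add: k_def field_simps)
      then have "ennreal (sqrt (\<Sum>I\<in>F. (wavelet_coeff \<psi> f I * dyadic_fn \<psi> I x)\<^sup>2) powr p)
        \<le> ennreal (k * (\<Sum>A\<in>Pow F. \<bar>X F A f x\<bar> powr p))" by (rule ennreal_leI)
      also have "\<dots> = ennreal k * (\<Sum>A\<in>Pow F. ennreal (\<bar>X F A f x\<bar> powr p))"
        using k by (subst ennreal_mult) (auto simp: sum_nonneg)
      finally show "ennreal (sqrt (\<Sum>I\<in>F. (wavelet_coeff \<psi> f I * dyadic_fn \<psi> I x)\<^sup>2) powr p)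
        \<le> ennreal k * (\<Sum>A\<in>Pow F. ennreal (\<bar>X F A f x\<bar> powr p))" .
    qed
    also have "\<dots> = ennreal k * (\<Sum>A\<in>Pow F. \<integral>\<^sup>+x. ennreal (\<bar>X F A f x\<bar> powr p) \<partial>lborel)"
      by (subst nn_integral_cmult, measurable) (subst nn_integral_sum, auto)
    also have "\<dots> \<le> ennreal k * (\<Sum>A\<in>Pow F. ennreal (D * N))"
      unfolding X_def N_def using * by (intro mult_left_mono sum_mono strong sgn1) auto
    also have "\<dots> = ennreal (16 / 3 * 2 powr p * D * N)"
    proof -
      have "(\<Sum>A\<in>Pow F. ennreal (D * N)) = ennreal (m * (D * N))"
        using *(1) D N by (simp add: sum_ennreal m_def card_Pow del: sum_constant) (simp add: card_Pow)
      then show ?thesis using m D N k by (simp add: ennreal_mult[symmetric] k_def)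
    qed
    finally show "(\<integral>\<^sup>+x. ennreal (sqrt (\<Sum>I\<in>F. (wavelet_coeff \<psi> f I * dyadic_fn \<psi> I x)\<^sup>2) powr p) \<partial>lborel)
          \<le> ennreal (16 / 3 * 2 powr p * D * (\<integral>x. \<bar>f x\<bar> powr p \<partial>lborel))" by (simp add: N_def)
  qed
qed

section \<open>Second moments of random series with subgaussian coefficients\<close>

context prob_space
begin

text \<open>From y^2 / 2 \<le> exp |y| \<le> exp y + exp (-y), two values of the moment generating
  function, at 1 and -1, control the variance; each is at most exp (\<nu> / 2).\<close>

lemma subgaussian_variance:
  assumes "subgaussian M X \<nu>"
  shows "integrable M (\<lambda>\<omega>. (X \<omega> - expectation X)\<^sup>2)"
    and "expectation (\<lambda>\<omega>. (X \<omega> - expectation X)\<^sup>2) \<le> 4 * exp (\<nu> / 2)"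
proof -
  define Y where "Y \<omega> = X \<omega> - expectation X" for \<omega>
  have [measurable]: "X \<in> borel_measurable M" using assms by (auto simp: subgaussian_def)
  have mgf: "integrable M (\<lambda>\<omega>. exp (l * Y \<omega>))" "expectation (\<lambda>\<omega>. exp (l * Y \<omega>)) \<le> exp (l\<^sup>2 * \<nu> / 2)" for l
  proof -
    show "integrable M (\<lambda>\<omega>. exp (l * Y \<omega>))" using assms by (simp add: subgaussian_def Y_def)
    have ln: "ln (expectation (\<lambda>\<omega>. exp (l * Y \<omega>))) \<le> l\<^sup>2 * \<nu> / 2"
      using assms by (simp add: subgaussian_def Y_def)
    show "expectation (\<lambda>\<omega>. exp (l * Y \<omega>)) \<le> exp (l\<^sup>2 * \<nu> / 2)"
    \<comment> \<open>Exponentiating the logarithmic bound requires a positive argument of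
      \<open>ln\<close>; otherwise the claim is immediate.\<close>
    proof (cases "expectation (\<lambda>\<omega>. exp (l * Y \<omega>)) > 0")
      case True
      then have "expectation (\<lambda>\<omega>. exp (l * Y \<omega>)) = exp (ln (expectation (\<lambda>\<omega>. exp (l * Y \<omega>))))" by simp
      also have "\<dots> \<le> exp (l\<^sup>2 * \<nu> / 2)" using ln by simp
      finally show ?thesis .
    next
      case False
      then show ?thesis using exp_gt_zero[of "l\<^sup>2 * \<nu> / 2"] by linarith
    qed
  qed
  have le: "y\<^sup>2 \<le> 2 * (exp (1 * y) + exp (- 1 * y))" for y :: real
  proof -
    have "1 + \<bar>y\<bar> + \<bar>y\<bar>\<^sup>2 / 2 \<le> exp \<bar>y\<bar>" by (rule exp_lower_Taylor_quadratic) simp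
    moreover have "exp \<bar>y\<bar> \<le> exp (1 * y) + exp (- 1 * y)" by (simp add: abs_if)
    ultimately show ?thesis by simp
  qed
  have int: "integrable M (\<lambda>\<omega>. 2 * (exp (1 * Y \<omega>) + exp (- 1 * Y \<omega>)))"
    using mgf(1) by (intro integrable_mult_right Bochner_Integration.integrable_add)
  show 1: "integrable M (\<lambda>\<omega>. (X \<omega> - expectation X)\<^sup>2)"
    unfolding Y_def[symmetric]
  proof (rule Bochner_Integration.integrable_bound[OF int])
    show "(\<lambda>\<omega>. (Y \<omega>)\<^sup>2) \<in> borel_measurable M" unfolding Y_def by measurable
    have "norm ((Y \<omega>)\<^sup>2) \<le> norm (2 * (exp (1 * Y \<omega>) + exp (- 1 * Y \<omega>)))" for \<omega>
      using le[of "Y \<omega>"] by simp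
    then show "AE \<omega> in M. norm ((Y \<omega>)\<^sup>2) \<le> norm (2 * (exp (1 * Y \<omega>) + exp (- 1 * Y \<omega>)))" by auto
  qed
  have "expectation (\<lambda>\<omega>. (Y \<omega>)\<^sup>2) \<le> expectation (\<lambda>\<omega>. 2 * (exp (1 * Y \<omega>) + exp (- 1 * Y \<omega>)))"
    using 1 int le unfolding Y_def[symmetric] by (intro integral_mono) auto
  also have "\<dots> = 2 * (expectation (\<lambda>\<omega>. exp (1 * Y \<omega>)) + expectation (\<lambda>\<omega>. exp (- 1 * Y \<omega>)))"
    using mgf(1)[of 1] mgf(1)[of "- 1"] by simp
  also have "\<dots> \<le> 2 * (exp (\<nu> / 2) + exp (\<nu> / 2))"
    using mgf(2)[of 1] mgf(2)[of "- 1"] by simp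
  finally show "expectation (\<lambda>\<omega>. (X \<omega> - expectation X)\<^sup>2) \<le> 4 * exp (\<nu> / 2)"
    by (simp add: Y_def)
qed

text \<open>Centred part and means are separated by (y + w)^2 \<le> 2 y^2 + 2 w^2. The centred terms
  are pairwise uncorrelated with variance at most 4 exp (\<nu> / 2), and the squared means sum to at
  most R^2; doubling gives the constant.\<close>

lemma random_series_second_moment:
  fixes a :: "'i \<Rightarrow> 'a \<Rightarrow> real"
  assumes indep: "indep_vars (\<lambda>_. borel) a UNIV" and subg: "\<And>i. subgaussian M (a i) \<nu>"
    and R: "\<And>S. finite S \<Longrightarrow> (\<Sum>i\<in>S. expectation (\<lambda>\<omega>. \<bar>a i \<omega>\<bar>)) \<le> R" and F: "finite F"
  shows "(\<integral>\<^sup>+\<omega>. ennreal ((\<Sum>i\<in>F. a i \<omega> * v i)\<^sup>2) \<partial>M) \<le> ennreal ((8 * exp (\<nu> / 2) + 2 * R\<^sup>2) * (\<Sum>i\<in>F. (v i)\<^sup>2))"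
proof -
  define m where "m i = expectation (a i)" for i
  define Y where "Y i \<omega> = a i \<omega> - m i" for i \<omega>
  have ai: "integrable M (a i)" for i using subg by (auto simp: subgaussian_def)
  have [measurable]: "a i \<in> borel_measurable M" for i using ai by auto
  have [measurable]: "Y i \<in> borel_measurable M" for i unfolding Y_def by measurable
  have Ysq: "integrable M (\<lambda>\<omega>. (Y i \<omega>)\<^sup>2)" "expectation (\<lambda>\<omega>. (Y i \<omega>)\<^sup>2) \<le> 4 * exp (\<nu> / 2)" for i
    using subgaussian_variance[OF subg[of i]] by (simp_all add: Y_def m_def)
  have YY: "integrable M (\<lambda>\<omega>. Y i \<omega> * Y j \<omega>)" for i j
  proof (rule Bochner_Integration.integrable_bound)
    show "integrable M (\<lambda>\<omega>. (Y i \<omega>)\<^sup>2 + (Y j \<omega>)\<^sup>2)" using Ysq by auto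
    have "norm (Y i \<omega> * Y j \<omega>) \<le> norm ((Y i \<omega>)\<^sup>2 + (Y j \<omega>)\<^sup>2)" for \<omega>
    proof -
      have "2 * \<bar>Y i \<omega>\<bar> * \<bar>Y j \<omega>\<bar> \<le> (Y i \<omega>)\<^sup>2 + (Y j \<omega>)\<^sup>2"
        using sum_squares_bound[of "\<bar>Y i \<omega>\<bar>" "\<bar>Y j \<omega>\<bar>"] by simp
      moreover have "0 \<le> \<bar>Y i \<omega>\<bar> * \<bar>Y j \<omega>\<bar>" by simp
      ultimately show ?thesis unfolding real_norm_def abs_mult by linarith
    qed
    then show "AE \<omega> in M. norm (Y i \<omega> * Y j \<omega>) \<le> norm ((Y i \<omega>)\<^sup>2 + (Y j \<omega>)\<^sup>2)" by auto
  qed measurable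
  \<comment> \<open>Independence is given for \<open>a\<close>, so the centred product is expanded
    and only the expectation of a i times a j uses it.\<close>
  have uncorr: "expectation (\<lambda>\<omega>. Y i \<omega> * Y j \<omega>) = 0" if "i \<noteq> j" for i j
  proof -
    have ind: "indep_vars (\<lambda>_. borel) a {i, j}" using indep by (rule indep_vars_subset) simp
    have "expectation (\<lambda>\<omega>. \<Prod>k\<in>{i, j}. a k \<omega>) = (\<Prod>k\<in>{i, j}. expectation (a k))"
      using ind ai by (intro indep_vars_lebesgue_integral) auto
    then have 1: "expectation (\<lambda>\<omega>. a i \<omega> * a j \<omega>) = m i * m j" using that by (simp add: m_def)
    have "integrable M (\<lambda>\<omega>. \<Prod>k\<in>{i, j}. a k \<omega>)"
      using ind ai by (intro indep_vars_integrable) auto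
    then have 2: "integrable M (\<lambda>\<omega>. a i \<omega> * a j \<omega>)" using that by simp
    have "expectation (\<lambda>\<omega>. Y i \<omega> * Y j \<omega>) = expectation (\<lambda>\<omega>. a i \<omega> * a j \<omega> - m j * a i \<omega> - m i * a j \<omega> + m i * m j)"
      by (simp add: Y_def algebra_simps)
    also have "\<dots> = m i * m j - m j * m i - m i * m j + m i * m j"
      using 1 2 ai by (simp add: prob_space m_def)
    finally show ?thesis by simp
  qed
  define y where "y \<omega> = (\<Sum>i\<in>F. Y i \<omega> * v i)" for \<omega>
  have y_sq: "(y \<omega>)\<^sup>2 = (\<Sum>i\<in>F. \<Sum>j\<in>F. v i * v j * (Y i \<omega> * Y j \<omega>))" for \<omega>
    unfolding y_def power2_eq_square sum_product by (simp add: mult_ac)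
  have y_int: "integrable M (\<lambda>\<omega>. (y \<omega>)\<^sup>2)" unfolding y_sq using YY by auto
  have "expectation (\<lambda>\<omega>. (y \<omega>)\<^sup>2) = (\<Sum>i\<in>F. \<Sum>j\<in>F. v i * v j * expectation (\<lambda>\<omega>. Y i \<omega> * Y j \<omega>))"
    unfolding y_sq using YY by simp
  also have "\<dots> = (\<Sum>i\<in>F. (v i)\<^sup>2 * expectation (\<lambda>\<omega>. (Y i \<omega>)\<^sup>2))"
  proof (intro sum.cong refl)
    fix i assume i: "i \<in> F"
    have "(\<Sum>j\<in>F. v i * v j * expectation (\<lambda>\<omega>. Y i \<omega> * Y j \<omega>))
      = (\<Sum>j\<in>F. if j = i then (v i)\<^sup>2 * expectation (\<lambda>\<omega>. (Y i \<omega>)\<^sup>2) else 0)"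
      by (intro sum.cong) (auto simp: uncorr power2_eq_square)
    then show "(\<Sum>j\<in>F. v i * v j * expectation (\<lambda>\<omega>. Y i \<omega> * Y j \<omega>)) = (v i)\<^sup>2 * expectation (\<lambda>\<omega>. (Y i \<omega>)\<^sup>2)"
      using F i by simp
  qed
  also have "\<dots> \<le> (\<Sum>i\<in>F. (v i)\<^sup>2 * (4 * exp (\<nu> / 2)))"
    using Ysq by (intro sum_mono mult_left_mono) auto
  finally have y_le: "expectation (\<lambda>\<omega>. (y \<omega>)\<^sup>2) \<le> 4 * exp (\<nu> / 2) * (\<Sum>i\<in>F. (v i)\<^sup>2)"
    by (simp add: sum_distrib_left sum_distrib_right mult_ac)
  define w where "w = (\<Sum>i\<in>F. m i * v i)"
  have abs_m: "\<bar>m i\<bar> \<le> expectation (\<lambda>\<omega>. \<bar>a i \<omega>\<bar>)" for i unfolding m_def by (rule integral_abs_bound)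
  have m_le: "\<bar>m i\<bar> \<le> R" for i using R[of "{i}"] abs_m[of i] by simp
  have "R \<ge> 0" using m_le order_trans abs_ge_zero by blast
  \<comment> \<open>The step from summable to square-summable means: each is at most
    \<open>R\<close>, and so is the sum of their absolute values.\<close>
  have "(\<Sum>i\<in>F. (m i)\<^sup>2) \<le> (\<Sum>i\<in>F. R * \<bar>m i\<bar>)"
  proof (intro sum_mono)
    fix i
    have "\<bar>m i\<bar> * \<bar>m i\<bar> \<le> R * \<bar>m i\<bar>" by (intro mult_right_mono m_le) auto
    then show "(m i)\<^sup>2 \<le> R * \<bar>m i\<bar>" by (simp add: power2_eq_square)
  qed
  also have "\<dots> = R * (\<Sum>i\<in>F. \<bar>m i\<bar>)" by (simp add: sum_distrib_left)
  also have "\<dots> \<le> R * R"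
    using sum_mono[of F "\<lambda>i. \<bar>m i\<bar>" "\<lambda>i. expectation (\<lambda>\<omega>. \<bar>a i \<omega>\<bar>)"] abs_m R[OF F] \<open>R \<ge> 0\<close>
    by (intro mult_left_mono) auto
  finally have m2: "(\<Sum>i\<in>F. (m i)\<^sup>2) \<le> R\<^sup>2" by (simp add: power2_eq_square)
  have "w\<^sup>2 \<le> (\<Sum>i\<in>F. (m i)\<^sup>2) * (\<Sum>i\<in>F. (v i)\<^sup>2)" unfolding w_def by (rule Cauchy_Schwarz_ineq_sum)
  also have "\<dots> \<le> R\<^sup>2 * (\<Sum>i\<in>F. (v i)\<^sup>2)" by (intro mult_right_mono m2 sum_nonneg) auto
  finally have w_le: "w\<^sup>2 \<le> R\<^sup>2 * (\<Sum>i\<in>F. (v i)\<^sup>2)" .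
  have "(\<integral>\<^sup>+\<omega>. ennreal ((\<Sum>i\<in>F. a i \<omega> * v i)\<^sup>2) \<partial>M) \<le> (\<integral>\<^sup>+\<omega>. ennreal (2 * (y \<omega>)\<^sup>2 + 2 * w\<^sup>2) \<partial>M)"
  proof (intro nn_integral_mono ennreal_leI)
    fix \<omega>
    have "(\<Sum>i\<in>F. a i \<omega> * v i) = y \<omega> + w"
      by (simp add: y_def w_def Y_def sum.distrib[symmetric] algebra_simps)
    moreover have "(y \<omega> + w)\<^sup>2 \<le> 2 * (y \<omega>)\<^sup>2 + 2 * w\<^sup>2"
      using sum_squares_bound[of "y \<omega>" w] by (simp add: power2_sum)
    ultimately show "(\<Sum>i\<in>F. a i \<omega> * v i)\<^sup>2 \<le> 2 * (y \<omega>)\<^sup>2 + 2 * w\<^sup>2" by simp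
  qed
  also have "\<dots> = ennreal (expectation (\<lambda>\<omega>. 2 * (y \<omega>)\<^sup>2 + 2 * w\<^sup>2))"
    using y_int by (intro nn_integral_eq_integral) auto
  also have "expectation (\<lambda>\<omega>. 2 * (y \<omega>)\<^sup>2 + 2 * w\<^sup>2) = 2 * expectation (\<lambda>\<omega>. (y \<omega>)\<^sup>2) + 2 * w\<^sup>2"
    using y_int by (simp add: prob_space)
  also have "ennreal \<dots> \<le> ennreal ((8 * exp (\<nu> / 2) + 2 * R\<^sup>2) * (\<Sum>i\<in>F. (v i)\<^sup>2))"
    using y_le w_le by (intro ennreal_leI) (simp add: distrib_right)
  finally show ?thesis .
qed

text \<open>No zero-one law is needed: where the unconditional sum does not exist, \<open>infsum\<close> is 0.\<close>

lemma random_infsum_second_moment: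
  fixes a :: "'i \<Rightarrow> 'a \<Rightarrow> real" and \<iota> :: "nat \<Rightarrow> 'i"
  assumes indep: "indep_vars (\<lambda>_. borel) a UNIV" and subg: "\<And>i. subgaussian M (a i) \<nu>"
    and R: "\<And>S. finite S \<Longrightarrow> (\<Sum>i\<in>S. expectation (\<lambda>\<omega>. \<bar>a i \<omega>\<bar>)) \<le> R" and \<iota>: "bij \<iota>"
  shows "L2sq M (\<lambda>\<omega>. infsum (\<lambda>i. a i \<omega> * v i) UNIV)
    \<le> (SUP n. ennreal ((8 * exp (\<nu> / 2) + 2 * R\<^sup>2) * (\<Sum>i\<in>\<iota> ` {..<n}. (v i)\<^sup>2)))"
  unfolding L2sq_def
proof (rule nn_integral_liminf_le)
  have [measurable]: "a i \<in> borel_measurable M" for i using subg by (auto simp: subgaussian_def)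
  show "(\<lambda>\<omega>. ennreal ((\<Sum>i\<in>\<iota> ` {..<n}. a i \<omega> * v i)\<^sup>2)) \<in> borel_measurable M" for n by measurable
  show "(\<integral>\<^sup>+\<omega>. ennreal ((\<Sum>i\<in>\<iota> ` {..<n}. a i \<omega> * v i)\<^sup>2) \<partial>M)
    \<le> (SUP n. ennreal ((8 * exp (\<nu> / 2) + 2 * R\<^sup>2) * (\<Sum>i\<in>\<iota> ` {..<n}. (v i)\<^sup>2)))" for n
    by (rule SUP_upper2[of n]) (use random_series_second_moment[OF indep subg R] in auto)
  \<comment> \<open>An unconditional sum, where it exists, is the limit of partial sums along any
    enumeration; \<open>\<iota>\<close> supplies one with nested finite sets.\<close>
  have "ennreal ((infsum (\<lambda>i. a i \<omega> * v i) UNIV)\<^sup>2) \<le> liminf (\<lambda>n. ennreal ((\<Sum>i\<in>\<iota> ` {..<n}. a i \<omega> * v i)\<^sup>2))" for \<omega>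
  proof (cases "(\<lambda>i. a i \<omega> * v i) summable_on UNIV")
    case True
    then have "((\<lambda>i. a i \<omega> * v i) has_sum infsum (\<lambda>i. a i \<omega> * v i) UNIV) UNIV" by simp
    then have "((\<lambda>n. a (\<iota> n) \<omega> * v (\<iota> n)) has_sum infsum (\<lambda>i. a i \<omega> * v i) UNIV) UNIV"
      using has_sum_reindex_bij_betw[OF \<iota>, of "\<lambda>i. a i \<omega> * v i"] by simp
    then have "(\<lambda>n. \<Sum>k<n. a (\<iota> k) \<omega> * v (\<iota> k)) \<longlonglongrightarrow> infsum (\<lambda>i. a i \<omega> * v i) UNIV"
      using has_sum_imp_sums unfolding sums_def by blast
    moreover have "(\<Sum>k<n. a (\<iota> k) \<omega> * v (\<iota> k)) = (\<Sum>i\<in>\<iota> ` {..<n}. a i \<omega> * v i)" for n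
      using \<iota> by (subst sum.reindex) (auto simp: bij_def intro: inj_on_subset)
    ultimately have "(\<lambda>n. ennreal ((\<Sum>i\<in>\<iota> ` {..<n}. a i \<omega> * v i)\<^sup>2)) \<longlonglongrightarrow> ennreal ((infsum (\<lambda>i. a i \<omega> * v i) UNIV)\<^sup>2)"
      by (intro tendsto_ennrealI tendsto_power) simp
    from lim_imp_Liminf[OF _ this] show ?thesis by simp
  qed (simp add: infsum_not_exists)
  then show "AE \<omega> in M. ennreal ((infsum (\<lambda>i. a i \<omega> * v i) UNIV)\<^sup>2)
    \<le> liminf (\<lambda>n. ennreal ((\<Sum>i\<in>\<iota> ` {..<n}. a i \<omega> * v i)\<^sup>2))" by simp
qed

end

theorem theorem4p3:
  fixes \<psi> \<psi>' :: "real \<Rightarrow> real" and M :: "'a measure"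
    and a :: "int \<times> int \<Rightarrow> 'a \<Rightarrow> real" and C \<epsilon> \<nu> :: real
  assumes deriv: "\<And>x. (\<psi> has_real_derivative \<psi>' x) (at x)"
    and cont_deriv: "continuous_on UNIV \<psi>'"
    and onb: "wavelet_onb \<psi>"
    and C_pos: "C > 0" and eps_pos: "\<epsilon> > 0"
    and decay: "\<And>x. \<bar>\<psi> x\<bar> + \<bar>\<psi>' x\<bar> \<le> C * (1 + \<bar>x\<bar>) powr (- 1 - \<epsilon>)"
    and prob: "prob_space M"
    and indep: "prob_space.indep_vars M (\<lambda>_. borel) a UNIV"
    and summ: "(\<lambda>I. \<integral>\<omega>. \<bar>a I \<omega>\<bar> \<partial>M) summable_on UNIV"
    and nu_pos: "\<nu> > 0"
    and subg: "\<And>I. subgaussian M (a I) \<nu>"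
  shows "(\<forall>p::real. 1 < p \<longrightarrow> (\<exists>Cp>0. \<forall>f::real \<Rightarrow> real.
            f \<in> borel_measurable lborel \<and> integrable lborel (\<lambda>x. (f x)\<^sup>2)
            \<and> integrable lborel (\<lambda>x. \<bar>f x\<bar> powr p) \<longrightarrow>
              (AE x in lborel. L2sq M (wavelet_T a \<psi> f x) < \<infinity>) \<and>
              (\<integral>\<^sup>+x. ennreal ((sqrt (enn2real (L2sq M (wavelet_T a \<psi> f x)))) powr p) \<partial>lborel)
                \<le> ennreal (Cp powr p * (\<integral>x. \<bar>f x\<bar> powr p \<partial>lborel))))
       \<and> (\<exists>C'. \<forall>t>0. \<forall>f::real \<Rightarrow> real.
            f \<in> borel_measurable lborel \<and> integrable lborel (\<lambda>x. (f x)\<^sup>2)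
            \<and> integrable lborel f \<longrightarrow>
              emeasure lborel {x. L2sq M (wavelet_T a \<psi> f x) > ennreal (t\<^sup>2)}
                \<le> ennreal (C' / t * (\<integral>x. \<bar>f x\<bar> \<partial>lborel)))"
proof -
  interpret prob_space M by (rule prob)
  define \<phi> where "\<phi> = dyadic_fn \<psi>"
  define c where "c = wavelet_coeff \<psi>"
  \<comment> \<open>Any enumeration serves: along the nested sets \<open>F n\<close> the partial
    square functions increase, so their limit always exists in the extended sense.\<close>
  obtain \<iota> :: "nat \<Rightarrow> int \<times> int" where \<iota>: "bij \<iota>"
    using bij_betw_from_nat_into[of "UNIV :: (int \<times> int) set"] by (auto simp: finite_prod)
  define F where "F n = \<iota> ` {..<n}" for n
  have F: "finite (F n)" for n by (simp add: F_def)
  define S where "S f n x = (\<Sum>I\<in>F n. (c f I * \<phi> I x)\<^sup>2)" for f n x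
  have S0: "S f n x \<ge> 0" for f n x by (auto simp: S_def intro: sum_nonneg)
  have S_mono: "S f n x \<le> S f m x" if "n \<le> m" for f n m x
    unfolding S_def using that F by (intro sum_mono2) (auto simp: F_def)
  have [measurable]: "\<phi> I \<in> borel_measurable borel" for I
    using onb by (auto simp: \<phi>_def wavelet_onb_def simp del: split_paired_All)
  have [measurable]: "S f n \<in> borel_measurable borel" for f n unfolding S_def by measurable
  define R where "R = infsum (\<lambda>I. \<integral>\<omega>. \<bar>a I \<omega>\<bar> \<partial>M) UNIV"
  have R: "(\<Sum>I\<in>J. \<integral>\<omega>. \<bar>a I \<omega>\<bar> \<partial>M) \<le> R" if "finite J" for J
    unfolding R_def using summ that by (intro finite_sum_le_infsum) auto
  define B where "B = 8 * exp (\<nu> / 2) + 2 * R\<^sup>2"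
  have B: "B > 0" by (simp add: B_def add_pos_nonneg)
  \<comment> \<open>A measurable majorant of the squared random norm; B times the full square
    function squared, written as a supremum and hence defined even where infinite.\<close>
  define V where "V f x = (SUP n. ennreal (B * S f n x))" for f x
  have [measurable]: "V f \<in> borel_measurable borel" for f unfolding V_def by measurable
  have dom: "L2sq M (wavelet_T a \<psi> f x) \<le> V f x" for f x
    using random_infsum_second_moment[OF indep subg R \<iota>, of "\<lambda>I. c f I * \<phi> I x"]
    by (simp add: wavelet_T_def[abs_def] c_def \<phi>_def V_def S_def F_def B_def mult.assoc)
  have V_lim: "(\<lambda>n. ennreal (B * S f n x)) \<longlonglongrightarrow> V f x" for f x
    unfolding V_def using B S_mono
    by (intro LIMSEQ_SUP incseq_SucI ennreal_leI mult_left_mono) auto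
  \<comment> \<open>\<open>enn2real\<close> sends infinity to 0, so the later limit of real values
    is valid only where \<open>V f x\<close> is finite. Finiteness comes from the L2 theory: by
    Bessel the integral of each \<open>S f n\<close> is at most that of f^2.\<close>
  have V_finite: "AE x in lborel. V f x < \<infinity>" if f: "L2fun f" for f
  proof -
    have "(\<integral>\<^sup>+x. V f x \<partial>lborel) \<le> ennreal (B * (\<integral>x. (f x)\<^sup>2 \<partial>lborel))"
    proof (rule nn_integral_liminf_le)
      show "(\<lambda>x. ennreal (B * S f n x)) \<in> borel_measurable lborel" for n by measurable
      show "AE x in lborel. V f x \<le> liminf (\<lambda>n. ennreal (B * S f n x))"
        using lim_imp_Liminf[OF _ V_lim] by simp
      show "(\<integral>\<^sup>+x. ennreal (B * S f n x) \<partial>lborel) \<le> ennreal (B * (\<integral>x. (f x)\<^sup>2 \<partial>lborel))" for n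
      proof -
        interpret orthonormal_family \<phi> "F n"
          unfolding \<phi>_def by (rule wavelet_onb_orthonormal_family[OF onb F])
        have int: "integrable lborel (\<lambda>x. (c f I * \<phi> I x)\<^sup>2)" if "I \<in> F n" for I
          using L2[OF that] by (simp add: L2fun_def power_mult_distrib)
        have "(\<integral>\<^sup>+x. ennreal (B * S f n x) \<partial>lborel) = ennreal (\<integral>x. B * S f n x \<partial>lborel)"
          using B S0 int by (intro nn_integral_eq_integral) (auto simp: S_def)
        also have "(\<integral>x. B * S f n x \<partial>lborel) = B * (\<Sum>I\<in>F n. \<integral>x. (c f I * \<phi> I x)\<^sup>2 \<partial>lborel)"
          using int by (simp add: S_def)
        also have "(\<Sum>I\<in>F n. \<integral>x. (c f I * \<phi> I x)\<^sup>2 \<partial>lborel) = (\<Sum>I\<in>F n. (\<integral>x. f x * \<phi> I x \<partial>lborel)\<^sup>2)"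
        proof (intro sum.cong refl)
          fix I assume "I \<in> F n"
          then have "(\<integral>x. (\<phi> I x)\<^sup>2 \<partial>lborel) = 1" using orth[of I I] by (simp add: power2_eq_square)
          then show "(\<integral>x. (c f I * \<phi> I x)\<^sup>2 \<partial>lborel) = (\<integral>x. f x * \<phi> I x \<partial>lborel)\<^sup>2"
            by (simp add: power_mult_distrib c_def wavelet_coeff_def \<phi>_def)
        qed
        also have "\<dots> \<le> (\<integral>x. (f x)\<^sup>2 \<partial>lborel)" by (rule bessel[OF f])
        finally show ?thesis using B by (simp add: ennreal_leI mult_left_mono)
      qed
    qed
    then have "(\<integral>\<^sup>+x. V f x \<partial>lborel) \<noteq> \<infinity>" by (auto simp: top_unique)
    from nn_integral_PInf_AE[OF _ this] show ?thesis by (auto simp: less_top)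
  qed
  obtain W where W: "W > 0" and weak: "\<And>n f t. L2fun f \<Longrightarrow> integrable lborel f \<Longrightarrow> t > 0 \<Longrightarrow>
      emeasure lborel {x. t < sqrt (S f n x)} \<le> ennreal (W / t * (\<integral>x. \<bar>f x\<bar> \<partial>lborel))"
    using wavelet_square_function_weak[OF deriv onb C_pos eps_pos decay] F
    unfolding S_def \<phi>_def c_def by blast
  show ?thesis
  proof (intro conjI allI impI)

    \<comment> \<open>Strong type (p, p)\<close>
    fix p :: real assume p: "1 < p"
    obtain D where D: "D > 0" and strong: "\<And>n f. L2fun f \<Longrightarrow> integrable lborel (\<lambda>x. \<bar>f x\<bar> powr p) \<Longrightarrow>
        (\<integral>\<^sup>+x. ennreal (sqrt (S f n x) powr p) \<partial>lborel) \<le> ennreal (D * (\<integral>x. \<bar>f x\<bar> powr p \<partial>lborel))"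
      using wavelet_square_function_strong[OF deriv onb C_pos eps_pos decay p] F
      unfolding S_def \<phi>_def c_def by blast
    \<comment> \<open>The p-th root of the constant for the p-th powers: \<open>sqrt B\<close> from
      the probabilistic step, \<open>D\<close> from the square function.\<close>
    define Cp where "Cp = (sqrt B powr p * D) powr (1 / p)"
    have Cp: "Cp > 0" "Cp powr p = sqrt B powr p * D"
      using B D p by (simp_all add: Cp_def powr_powr)
    show "\<exists>Cp>0. \<forall>f::real \<Rightarrow> real. f \<in> borel_measurable lborel \<and> integrable lborel (\<lambda>x. (f x)\<^sup>2)
            \<and> integrable lborel (\<lambda>x. \<bar>f x\<bar> powr p) \<longrightarrow>
              (AE x in lborel. L2sq M (wavelet_T a \<psi> f x) < \<infinity>) \<and>
              (\<integral>\<^sup>+x. ennreal ((sqrt (enn2real (L2sq M (wavelet_T a \<psi> f x)))) powr p) \<partial>lborel)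
                \<le> ennreal (Cp powr p * (\<integral>x. \<bar>f x\<bar> powr p \<partial>lborel))"
    proof (intro exI[of _ Cp] conjI allI impI Cp(1))
      fix f :: "real \<Rightarrow> real"
      assume *: "f \<in> borel_measurable lborel \<and> integrable lborel (\<lambda>x. (f x)\<^sup>2) \<and> integrable lborel (\<lambda>x. \<bar>f x\<bar> powr p)"
      then have f: "L2fun f" "integrable lborel (\<lambda>x. \<bar>f x\<bar> powr p)" by (auto simp: L2fun_def)
      show "AE x in lborel. L2sq M (wavelet_T a \<psi> f x) < \<infinity>"
        using V_finite[OF f(1)] by eventually_elim (use dom le_less_trans in blast)
      show "(\<integral>\<^sup>+x. ennreal ((sqrt (enn2real (L2sq M (wavelet_T a \<psi> f x)))) powr p) \<partial>lborel)
                \<le> ennreal (Cp powr p * (\<integral>x. \<bar>f x\<bar> powr p \<partial>lborel))"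
      proof (rule nn_integral_liminf_le)
        show "(\<lambda>x. ennreal (sqrt (B * S f n x) powr p)) \<in> borel_measurable lborel" for n by measurable
        show "(\<integral>\<^sup>+x. ennreal (sqrt (B * S f n x) powr p) \<partial>lborel) \<le> ennreal (Cp powr p * (\<integral>x. \<bar>f x\<bar> powr p \<partial>lborel))" for n
        proof -
          have "(\<integral>\<^sup>+x. ennreal (sqrt (B * S f n x) powr p) \<partial>lborel)
            = (\<integral>\<^sup>+x. ennreal (sqrt B powr p) * ennreal (sqrt (S f n x) powr p) \<partial>lborel)"
            using B S0 by (simp add: real_sqrt_mult powr_mult ennreal_mult)
          also have "\<dots> = ennreal (sqrt B powr p) * (\<integral>\<^sup>+x. ennreal (sqrt (S f n x) powr p) \<partial>lborel)"
            by (intro nn_integral_cmult) measurable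
          also have "\<dots> \<le> ennreal (sqrt B powr p) * ennreal (D * (\<integral>x. \<bar>f x\<bar> powr p \<partial>lborel))"
            by (intro mult_left_mono strong f) auto
          also have "\<dots> = ennreal (Cp powr p * (\<integral>x. \<bar>f x\<bar> powr p \<partial>lborel))"
            using D by (simp add: Cp(2) ennreal_mult[symmetric] mult.assoc)
          finally show ?thesis .
        qed
        show "AE x in lborel. ennreal ((sqrt (enn2real (L2sq M (wavelet_T a \<psi> f x)))) powr p)
          \<le> liminf (\<lambda>n. ennreal (sqrt (B * S f n x) powr p))"
          using V_finite[OF f(1)]
        proof eventually_elim
          fix x assume fin: "V f x < \<infinity>"
          have "(\<lambda>n. enn2real (ennreal (B * S f n x))) \<longlonglongrightarrow> enn2real (V f x)"
            using V_lim fin by (intro tendsto_enn2real) auto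
          then have "(\<lambda>n. B * S f n x) \<longlonglongrightarrow> enn2real (V f x)" using B S0 by simp
          then have "(\<lambda>n. ennreal (sqrt (B * S f n x) powr p)) \<longlonglongrightarrow> ennreal (sqrt (enn2real (V f x)) powr p)"
            using p B S0 by (intro tendsto_ennrealI tendsto_powr' tendsto_real_sqrt tendsto_const) auto
          from lim_imp_Liminf[OF _ this]
          have "liminf (\<lambda>n. ennreal (sqrt (B * S f n x) powr p)) = ennreal (sqrt (enn2real (V f x)) powr p)" by simp
          moreover have "enn2real (L2sq M (wavelet_T a \<psi> f x)) \<le> enn2real (V f x)"
            using dom fin by (intro enn2real_mono) auto
          ultimately show "ennreal ((sqrt (enn2real (L2sq M (wavelet_T a \<psi> f x)))) powr p)
            \<le> liminf (\<lambda>n. ennreal (sqrt (B * S f n x) powr p))"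
            using p by (simp add: ennreal_leI powr_mono2)
        qed
      qed
    qed
  next

    \<comment> \<open>Weak type (1, 1)\<close>
    show "\<exists>C'. \<forall>t>0. \<forall>f::real \<Rightarrow> real. f \<in> borel_measurable lborel \<and> integrable lborel (\<lambda>x. (f x)\<^sup>2)
            \<and> integrable lborel f \<longrightarrow>
              emeasure lborel {x. L2sq M (wavelet_T a \<psi> f x) > ennreal (t\<^sup>2)}
                \<le> ennreal (C' / t * (\<integral>x. \<bar>f x\<bar> \<partial>lborel))"
    proof (intro exI[of _ "W * sqrt B"] allI impI)
      fix t :: real and f :: "real \<Rightarrow> real"
      assume t: "0 < t" and "f \<in> borel_measurable lborel \<and> integrable lborel (\<lambda>x. (f x)\<^sup>2) \<and> integrable lborel f"
      then have f: "L2fun f" "integrable lborel f" by (auto simp: L2fun_def)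
      \<comment> \<open>The level is divided by \<open>sqrt B\<close> because \<open>V\<close>
        carries the factor \<open>B\<close>. A strict inequality against a supremum already holds
        for some n, so these sets cover the superlevel set.\<close>
      define G where "G n = {x. t / sqrt B < sqrt (S f n x)}" for n
      have [measurable]: "G n \<in> sets borel" for n unfolding G_def by measurable
      have "{x. L2sq M (wavelet_T a \<psi> f x) > ennreal (t\<^sup>2)} \<subseteq> (\<Union>n. G n)"
      proof
        fix x assume "x \<in> {x. L2sq M (wavelet_T a \<psi> f x) > ennreal (t\<^sup>2)}"
        then have "ennreal (t\<^sup>2) < V f x" using dom less_le_trans by blast
        then obtain n where "ennreal (t\<^sup>2) < ennreal (B * S f n x)" by (auto simp: V_def less_SUP_iff)
        then have "t\<^sup>2 < B * S f n x" by (simp add: ennreal_less_iff)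
        then have "sqrt (t\<^sup>2) < sqrt (B * S f n x)" by (rule real_sqrt_less_mono)
        then have "t < sqrt B * sqrt (S f n x)" using t by (simp add: real_sqrt_mult)
        then have "x \<in> G n" using B by (simp add: G_def field_simps)
        then show "x \<in> (\<Union>n. G n)" by blast
      qed
      \<comment> \<open>Monotonicity asks for measurability of the larger set only; the union
        increases, so continuity from below transfers the uniform bound.\<close>
      then have "emeasure lborel {x. L2sq M (wavelet_T a \<psi> f x) > ennreal (t\<^sup>2)} \<le> emeasure lborel (\<Union>n. G n)"
        by (intro emeasure_mono) auto
      also have "\<dots> = (SUP n. emeasure lborel (G n))"
      proof (rule SUP_emeasure_incseq[symmetric])
        have "sqrt (S f n x) \<le> sqrt (S f (Suc n) x)" for n x by (intro real_sqrt_le_mono S_mono) simp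
        then show "incseq G" unfolding G_def by (intro incseq_SucI Collect_mono) (meson less_le_trans)
      qed auto
      also have "\<dots> \<le> ennreal (W / (t / sqrt B) * (\<integral>x. \<bar>f x\<bar> \<partial>lborel))"
        unfolding G_def using t B f by (intro SUP_least weak) auto
      finally show "emeasure lborel {x. L2sq M (wavelet_T a \<psi> f x) > ennreal (t\<^sup>2)}
          \<le> ennreal (W * sqrt B / t * (\<integral>x. \<bar>f x\<bar> \<partial>lborel))" by simp
    qed
  qed
qed

end
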